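(* Let $(X,d,m)$ be an Ahlfors $N$-regular metric measure space with $m(X)=\infty$, and let $F\subset X$ be a closed subset and $\mu$ a Borel measure supported in $F$ such that $(F,d|_{F\times F},\mu)$ is Ahlfors $\delta$-regular, $0<\delta<N$. Let $0<\alpha<1$ and $1<p<\infty$ satisfy $0<\beta=\alpha-\frac{N-\delta}{p}<1$. Then there exists a continuous linear operator $$\mathcal{R}:L^{\alpha,p}(X,m)\to B^\beta_{p,\infty}(F,\mu)$$ satisfying $\mathcal{R}f=f|_F$ for continuous functions $f$.
   Context: Ahlfors regularity: a metric measure space $(Y,d,\nu)$ is Ahlfors $M$-regular ($M>0$) if there is $C>0$ with $C^{-1}r^M\leq\nu(B(x,2r))\leq Cr^M$ for each $x\in Y$ and $0<r<\mathrm{diam}(Y)$. Besov space on $F$: $E_pf(t)=\left(\int_F\frac{1}{\mu(B(x,t))}\int_{B(x,t)}|f(y)-f(x)|^pd\mu(y)d\mu(x)\right)^{1/p}$ for $t>0$, and $B^\beta_{p,\infty}(F,\mu)$ is the space of $f$ with $\|f\|_{B^\beta_{p,\infty}}=\|f\|_{L^p(\mu)}+\sup_{t>0}t^{-\beta}E_pf(t)<\infty$. Approximation of the identity: $(S_t)_{t>0}$, $S_tf(x)=\int_X s(x,y,t)f(y)\,dm(y)$, is a Coifman-type approximation of the identity on $X$, as constructed in the literature for Ahlfors $N$-regular spaces with $m(X)=\infty$. (One standard construction, as an example: take $h:[0,\infty)\to[0,1]$ nonincreasing and $C^\infty$ with $h\equiv1$ on $[0,1/2]$ and $h\equiv0$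 on $[2,\infty)$, $T_tf(x)=t^{-N}\int_X h(d(x,y)/t)f(y)\,dm(y)$, $\varphi(x,t)=1/T_t1(x)$, $\psi(x,t)=1/T_t(\varphi(\cdot,t))(x)$, and $s(x,y,t)=\frac{\varphi(x,t)\varphi(y,t)}{t^{2N}}\int_X h(\frac{d(x,z)}{t})h(\frac{d(y,z)}{t})\psi(z,t)\,dm(z)$.) Potential spaces: $k_\alpha(x,y)=\int_0^\infty\frac{\alpha t^\alpha}{(1+t^\alpha)^2}s(x,y,t)\frac{dt}{t}$, $J_\alpha g(x)=\int_X g(y)k_\alpha(x,y)\,dm(y)$, bounded on $L^p(X,m)$; $L^{\alpha,p}(X,m)=J_\alpha(L^p(X,m))$ with norm $\|f\|_{\alpha,p}=\|f\|_p+\inf\{\|g\|_p: f=J_\alpha g\}$.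
   Formalization: The formal theorem assumes that F is not a single point: for one-point F the Ahlfors condition is vacuous and the claim fails (X=ℝ, F={0}, μ a Dirac mass, N=1, δ=α=1/2, p=3/2, where point evaluation is unbounded on L^{α,p}). *)

theory Defs
  imports "HOL-Analysis.Analysis"
begin

text \<open>
  The library constant \<open>diameter\<close> is real-valued and meaningless on unbounded sets, hence the
  extended version.
\<close>

definition ediam :: "'a::metric_space set \<Rightarrow> ennreal" where
  "ediam Y = (SUP x\<in>Y. SUP y\<in>Y. ennreal (dist x y))"

text \<open>
  A measure on a subspace \<open>Y\<close> is represented by a Borel measure \<open>\<nu>\<close> of the ambient space;
  the balls of the subspace \<open>Y\<close> are the sets \<open>ball x r \<inter> Y\<close>.  Pitfall: for a one-point \<open>Y\<close>
  there are no admissible radii, so the condition is void for every \<open>\<nu>\<close>.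
\<close>

definition ahlfors_regular :: "real \<Rightarrow> 'a::metric_space set \<Rightarrow> 'a measure \<Rightarrow> bool" where
  "ahlfors_regular M Y \<nu> \<longleftrightarrow> 0 < M \<and>
     (\<exists>C>0. \<forall>x\<in>Y. \<forall>r>0. ennreal r < ediam Y \<longrightarrow>
        ennreal (r powr M / C) \<le> emeasure \<nu> (ball x (2 * r) \<inter> Y) \<and>
        emeasure \<nu> (ball x (2 * r) \<inter> Y) \<le> ennreal (C * r powr M))"

text \<open>
  Elements of the function spaces are represented by Borel functions, identified when they agree
  almost everywhere.  Norms take values in \<open>ennreal\<close>, and \<open>enn_root p x\<close> is \<open>x\<close> to the power \<open>1/p\<close>.
\<close>

definition enn_root :: "real \<Rightarrow> ennreal \<Rightarrow> ennreal" where
  "enn_root p x = (if x = \<infinity> then \<infinity> else ennreal (enn2real x powr (1 / p)))"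

definition Lp_norm :: "real \<Rightarrow> 'a measure \<Rightarrow> ('a \<Rightarrow> real) \<Rightarrow> ennreal" where
  "Lp_norm p M f = enn_root p (\<integral>\<^sup>+x. ennreal (\<bar>f x\<bar> powr p) \<partial>M)"

definition Lp_space :: "real \<Rightarrow> 'a measure \<Rightarrow> ('a \<Rightarrow> real) set" where
  "Lp_space p M = {f \<in> borel_measurable M. Lp_norm p M f < \<infinity>}"

definition besov_E :: "real \<Rightarrow> 'a::metric_space set \<Rightarrow> 'a measure \<Rightarrow> ('a \<Rightarrow> real) \<Rightarrow> real \<Rightarrow> ennreal" where
  "besov_E p F \<mu> f t = enn_root p
     (\<integral>\<^sup>+x\<in>F. (\<integral>\<^sup>+y\<in>ball x t \<inter> F. ennreal (\<bar>f y - f x\<bar> powr p) \<partial>\<mu>)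
                 / emeasure \<mu> (ball x t \<inter> F) \<partial>\<mu>)"

definition besov_norm ::
    "real \<Rightarrow> real \<Rightarrow> 'a::metric_space set \<Rightarrow> 'a measure \<Rightarrow> ('a \<Rightarrow> real) \<Rightarrow> ennreal" where
  "besov_norm \<beta> p F \<mu> f =
     Lp_norm p \<mu> f + (SUP t\<in>{0<..}. ennreal (t powr (- \<beta>)) * besov_E p F \<mu> f t)"

definition besov_space ::
    "real \<Rightarrow> real \<Rightarrow> 'a::metric_space set \<Rightarrow> 'a measure \<Rightarrow> ('a \<Rightarrow> real) set" where
  "besov_space \<beta> p F \<mu> = {f \<in> borel_measurable \<mu>. besov_norm \<beta> p F \<mu> f < \<infinity>}"

text \<open>
  The kernels \<open>s x y t\<close> of Coifman-type approximations of the identity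
  \<open>S\<^sub>t f(x) = \<integral> s(x,y,t) f(y) dm(y)\<close> are described by the properties which the constructions in
  the literature provide: conservation, symmetry, positivity, size, support and Lipschitz bounds.
  The last lemma of this theory shows that the standard construction \<open>coifman_kernel\<close> below
  has these properties.
\<close>

definition coifman_approximation ::
    "'a::metric_space measure \<Rightarrow> real \<Rightarrow> ('a \<Rightarrow> 'a \<Rightarrow> real \<Rightarrow> real) \<Rightarrow> bool" where
  "coifman_approximation m N s \<longleftrightarrow>
     (\<forall>t>0. \<forall>x. (\<integral>y. s x y t \<partial>m) = 1) \<and>
     (\<forall>t>0. \<forall>x y. s x y t = s y x t \<and> 0 \<le> s x y t) \<and>
     (\<forall>x y. continuous_on {0<..} (s x y)) \<and>
     (\<exists>C>0. \<forall>t>0. \<forall>x y.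
        s x y t \<le> C / t powr N \<and>
        (C * t < dist x y \<longrightarrow> s x y t = 0) \<and>
        (\<forall>x'. \<bar>s x y t - s x' y t\<bar> \<le> C * dist x x' / t powr (N + 1)))"

definition potential_kernel ::
    "('a \<Rightarrow> 'a \<Rightarrow> real \<Rightarrow> real) \<Rightarrow> real \<Rightarrow> 'a \<Rightarrow> 'a \<Rightarrow> real" where
  "potential_kernel s \<alpha> x y =
     (LINT t:{0<..}|lborel. \<alpha> * t powr \<alpha> / (1 + t powr \<alpha>)\<^sup>2 * s x y t / t)"

definition potential ::
    "'a measure \<Rightarrow> ('a \<Rightarrow> 'a \<Rightarrow> real \<Rightarrow> real) \<Rightarrow> real \<Rightarrow> ('a \<Rightarrow> real) \<Rightarrow> 'a \<Rightarrow> real" where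
  "potential m s \<alpha> g x = (\<integral>y. g y * potential_kernel s \<alpha> x y \<partial>m)"

definition potential_space ::
    "'a measure \<Rightarrow> ('a \<Rightarrow> 'a \<Rightarrow> real \<Rightarrow> real) \<Rightarrow> real \<Rightarrow> real \<Rightarrow> ('a \<Rightarrow> real) set" where
  "potential_space m s \<alpha> p =
     {f \<in> borel_measurable m. \<exists>g\<in>Lp_space p m. AE x in m. f x = potential m s \<alpha> g x}"

definition potential_norm ::
    "'a measure \<Rightarrow> ('a \<Rightarrow> 'a \<Rightarrow> real \<Rightarrow> real) \<Rightarrow> real \<Rightarrow> real \<Rightarrow> ('a \<Rightarrow> real) \<Rightarrow> ennreal" where
  "potential_norm m s \<alpha> p f = Lp_norm p m f +
     (INF g\<in>{g \<in> Lp_space p m. AE x in m. f x = potential m s \<alpha> g x}. Lp_norm p m g)"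

text \<open>
  \<open>R\<close> acts on representatives: it is well defined and linear up to null sets, and bounded.
\<close>

definition continuous_linear_operator ::
    "'a measure \<Rightarrow> ('a \<Rightarrow> real) set \<Rightarrow> (('a \<Rightarrow> real) \<Rightarrow> ennreal) \<Rightarrow>
     'b measure \<Rightarrow> ('b \<Rightarrow> real) set \<Rightarrow> (('b \<Rightarrow> real) \<Rightarrow> ennreal) \<Rightarrow>
     (('a \<Rightarrow> real) \<Rightarrow> ('b \<Rightarrow> real)) \<Rightarrow> bool" where
  "continuous_linear_operator m V normV \<mu> W normW R \<longleftrightarrow>
     (\<forall>f\<in>V. R f \<in> W) \<and>
     (\<forall>f\<in>V. \<forall>g\<in>V. (AE x in m. f x = g x) \<longrightarrow> (AE x in \<mu>. R f x = R g x)) \<and>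
     (\<forall>f\<in>V. \<forall>g\<in>V. \<forall>a b. AE x in \<mu>. R (\<lambda>y. a * f y + b * g y) x = a * R f x + b * R g x) \<and>
     (\<exists>C::real. \<forall>f\<in>V. normW (R f) \<le> ennreal C * normV f)"

definition cutoff :: "(real \<Rightarrow> real) \<Rightarrow> bool" where
  "cutoff h \<longleftrightarrow> (\<forall>u\<ge>0. 0 \<le> h u \<and> h u \<le> 1) \<and> antimono_on {0..} h \<and>
     (\<forall>k. (deriv ^^ k) h differentiable_on {0<..}) \<and>
     (\<forall>u\<in>{0..1/2}. h u = 1) \<and> (\<forall>u\<ge>2. h u = 0)"

definition coifman_T ::
    "'a::metric_space measure \<Rightarrow> real \<Rightarrow> (real \<Rightarrow> real) \<Rightarrow> real \<Rightarrow> ('a \<Rightarrow> real) \<Rightarrow> 'a \<Rightarrow> real" where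
  "coifman_T m N h t f x = t powr (- N) * (\<integral>y. h (dist x y / t) * f y \<partial>m)"

definition coifman_phi ::
    "'a::metric_space measure \<Rightarrow> real \<Rightarrow> (real \<Rightarrow> real) \<Rightarrow> real \<Rightarrow> 'a \<Rightarrow> real" where
  "coifman_phi m N h t x = 1 / coifman_T m N h t (\<lambda>_. 1) x"

definition coifman_psi ::
    "'a::metric_space measure \<Rightarrow> real \<Rightarrow> (real \<Rightarrow> real) \<Rightarrow> real \<Rightarrow> 'a \<Rightarrow> real" where
  "coifman_psi m N h t x = 1 / coifman_T m N h t (coifman_phi m N h t) x"

definition coifman_kernel ::
    "'a::metric_space measure \<Rightarrow> real \<Rightarrow> (real \<Rightarrow> real) \<Rightarrow> 'a \<Rightarrow> 'a \<Rightarrow> real \<Rightarrow> real" where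
  "coifman_kernel m N h x y t =
     coifman_phi m N h t x * coifman_phi m N h t y / t powr (2 * N) *
     (\<integral>z. h (dist x z / t) * h (dist y z / t) * coifman_psi m N h t z \<partial>m)"

lemma cutoff_lipschitz:
  assumes "cutoff h"
  shows "\<exists>L\<ge>0. \<forall>u\<ge>0. \<forall>v\<ge>0. \<bar>h u - h v\<bar> \<le> L * \<bar>u - v\<bar>"
proof -
  define I where "I = {1/4..3::real}"
  have d0: "h differentiable_on {0<..}"
    using assms[unfolded cutoff_def, THEN conjunct2, THEN conjunct2, THEN conjunct1, rule_format, of 0]
    by simp
  have d1: "deriv h differentiable_on {0<..}"
    using assms[unfolded cutoff_def, THEN conjunct2, THEN conjunct2, THEN conjunct1, rule_format, of 1]
    by simp
  have "continuous_on I (deriv h)"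
    using differentiable_imp_continuous_on[OF d1] by (rule continuous_on_subset) (auto simp: I_def)
  then have "bounded (deriv h ` I)"
    by (intro compact_imp_bounded compact_continuous_image) (auto simp: I_def)
  then obtain L where L: "0 < L" "\<And>u. u \<in> I \<Longrightarrow> \<bar>deriv h u\<bar> \<le> L"
    unfolding bounded_pos by auto
  have D: "(h has_real_derivative deriv h u) (at u)" if "u \<in> I" for u
  proof -
    have "h differentiable at u"
      using d0 that by (auto simp: I_def differentiable_on_def at_within_open[of _ "{0<..}"])
    then show ?thesis
      by (metis DERIV_imp_deriv real_differentiable_def)
  qed
  have lipI: "\<bar>h u - h v\<bar> \<le> L * \<bar>u - v\<bar>" if "u \<in> I" "v \<in> I" for u v
  proof -
    have "norm (h u - h v) \<le> L * norm (u - v)"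
      by (rule field_differentiable_bound[of I h "deriv h"])
         (use that D L in \<open>auto simp: I_def intro: has_field_derivative_at_within\<close>)
    then show ?thesis by simp
  qed
  define c where "c = (\<lambda>u::real. max (1/4) (min 3 u))"
  have hc: "h (c u) = h u" if "0 \<le> u" for u
  proof -
    have one: "h v = 1" if "0 \<le> v" "v \<le> 1/2" for v using assms that unfolding cutoff_def by auto
    have zero: "h v = 0" if "2 \<le> v" for v using assms that unfolding cutoff_def by auto
    consider "u \<le> 1/4" | "1/4 \<le> u" "u \<le> 3" | "3 \<le> u" by linarith
    then show ?thesis
    proof cases
      case 1
      then have "c u = 1/4" by (auto simp: c_def)
      then show ?thesis using 1 that by (simp add: one)
    next
      case 3
      then have "c u = 3" by (auto simp: c_def)
      then show ?thesis using 3 by (simp add: zero)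
    qed (auto simp: c_def)
  qed
  have "\<bar>h u - h v\<bar> \<le> L * \<bar>u - v\<bar>" if "0 \<le> u" "0 \<le> v" for u v
  proof -
    have "\<bar>h u - h v\<bar> = \<bar>h (c u) - h (c v)\<bar>" using that by (simp add: hc)
    also have "\<dots> \<le> L * \<bar>c u - c v\<bar>" by (rule lipI) (auto simp: I_def c_def)
    also have "\<dots> \<le> L * \<bar>u - v\<bar>"
      using L by (intro mult_left_mono) (auto simp: c_def)
    finally show ?thesis .
  qed
  then show ?thesis using L by (meson less_imp_le)
qed

lemma ahlfors_regular_ball_bounds:
  fixes m :: "'a::metric_space measure"
  assumes m: "sets m = sets borel" "ahlfors_regular N UNIV m" "emeasure m UNIV = \<infinity>"
    and X: "\<not> is_singleton (UNIV :: 'a set)"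
  shows "\<exists>K\<ge>1. \<forall>x. \<forall>r>0. ennreal (r powr N / K) \<le> emeasure m (ball x r) \<and>
           emeasure m (ball x r) \<le> ennreal (K * r powr N)"
proof -
  have N: "0 < N" using m(2) by (auto simp: ahlfors_regular_def)
  obtain C where C: "0 < C"
    "\<And>x r. 0 < r \<Longrightarrow> ennreal r < ediam (UNIV::'a set) \<Longrightarrow>
        ennreal (r powr N / C) \<le> emeasure m (ball x (2 * r)) \<and>
        emeasure m (ball x (2 * r)) \<le> ennreal (C * r powr N)"
    using m(2) by (auto simp: ahlfors_regular_def)
  have dist_le: "ennreal (dist x y) \<le> ediam (UNIV :: 'a set)" for x y :: 'a
    unfolding ediam_def by (intro SUP_upper2[of x] SUP_upper2[of y]) auto
  have unb: "ediam (UNIV::'a set) = \<infinity>"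
  proof (rule ccontr)
    assume "ediam (UNIV::'a set) \<noteq> \<infinity>"
    then obtain D where D: "ediam (UNIV::'a set) = ennreal D" "0 \<le> D"
      by (cases "ediam (UNIV::'a set)") auto
    obtain a b :: 'a where "a \<noteq> b" using X by (metis UNIV_I UNIV_eq_I is_singletonI' empty_iff)
    then have D0: "0 < D" using dist_le[of a b] D by (auto simp: ennreal_le_iff intro: less_le_trans[of _ "dist a b"])
    have "dist a y < 2 * (3/4 * D)" for y
      using dist_le[of a y] D D0 by (simp add: ennreal_le_iff)
    then have "ball a (2 * (3/4 * D)) = UNIV" by auto
    then show False
      using C(2)[of "3/4 * D" a] D0 D m(3) by (auto simp: ennreal_less_iff top_unique)
  qed
  define K where "K = 1 + C + C * 2 powr N"
  have K: "1 \<le> K" "C \<le> K" "C * 2 powr N \<le> K" using C(1) by (auto simp: K_def)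
  have "ennreal (r powr N / K) \<le> emeasure m (ball x r) \<and>
           emeasure m (ball x r) \<le> ennreal (K * r powr N)" if r: "0 < r" for x r
  proof -
    have b: "ennreal ((r/2) powr N / C) \<le> emeasure m (ball x r)"
      "emeasure m (ball x r) \<le> ennreal (C * (r/2) powr N)"
      using C(2)[of "r/2" x] r unb by auto
    have e: "(r/2) powr N = r powr N / 2 powr N" using r by (simp add: powr_divide)
    have "r powr N / K \<le> r powr N / (C * 2 powr N)"
      using C(1) K by (intro divide_left_mono) (auto intro!: mult_pos_pos)
    also have "\<dots> = (r/2) powr N / C" by (simp add: e)
    finally have 1: "r powr N / K \<le> (r/2) powr N / C" .
    have "C * (r/2) powr N \<le> K * r powr N"
      using r N K C(1) by (intro mult_mono powr_mono2) auto
    then show ?thesis using b 1 by (meson ennreal_leI order_trans)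
  qed
  then show ?thesis using K by blast
qed

locale coifman_construction =
  fixes m :: "'a::metric_space measure" and N C :: real and h :: "real \<Rightarrow> real" and L :: real
  assumes sets_m [measurable_cong]: "sets m = sets borel"
    and N_pos: "0 < N" and C_ge: "1 \<le> C" and L_nonneg: "0 \<le> L"
    and low: "0 < r \<Longrightarrow> ennreal (r powr N / C) \<le> emeasure m (ball x r)"
    and up: "0 < r \<Longrightarrow> emeasure m (ball x r) \<le> ennreal (C * r powr N)"
    and h_bounds: "0 \<le> u \<Longrightarrow> 0 \<le> h u \<and> h u \<le> 1"
    and h_one: "0 \<le> u \<Longrightarrow> u \<le> 1/2 \<Longrightarrow> h u = 1"
    and h_zero: "2 \<le> u \<Longrightarrow> h u = 0"
    and h_lip: "0 \<le> u \<Longrightarrow> 0 \<le> v \<Longrightarrow> \<bar>h u - h v\<bar> \<le> L * \<bar>u - v\<bar>"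
begin

lemma ball_sets [measurable]: "ball x r \<in> sets m"
  by (simp add: sets_m)

lemma space_m [simp]: "space m = UNIV"
  using sets_eq_imp_space_eq[OF sets_m] by simp

lemma ball_finite: "emeasure m (ball x r) < \<infinity>"
proof (cases "0 < r")
  case True
  then show ?thesis using up[of r x] by (auto intro: le_less_trans)
next
  case False
  then have "ball x r = {}" by simp
  show ?thesis unfolding \<open>ball x r = {}\<close> by simp
qed

lemma measure_up: "0 < r \<Longrightarrow> measure m (ball x r) \<le> C * r powr N"
  using up[of r x] C_ge by (auto simp: measure_def intro!: enn2real_leI)

lemma measure_low: "0 < r \<Longrightarrow> r powr N / C \<le> measure m (ball x r)"
  using low[of r x] ball_finite[of x r] C_ge
  by (metis emeasure_eq_ennreal_measure ennreal_le_iff infinity_ennreal_def less_irrefl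
      measure_nonneg)

lemma integrable_ball: "integrable m (indicat_real (ball x r))"
  using ball_finite by (simp add: integrable_indicator_iff)

lemma sigma_finite_m: "sigma_finite_measure m"
proof
  define A where "A = range (\<lambda>n::nat. ball (undefined::'a) (real n))"
  have "\<Union>A = UNIV"
    unfolding A_def using reals_Archimedean2 by fastforce
  moreover have "\<forall>a\<in>A. emeasure m a \<noteq> \<infinity>"
    unfolding A_def using ball_finite by (auto simp: less_top[symmetric])
  moreover have "countable A" "A \<subseteq> sets m" unfolding A_def by auto
  ultimately show "\<exists>A. countable A \<and> A \<subseteq> sets m \<and> \<Union>A = space m \<and> (\<forall>a\<in>A. emeasure m a \<noteq> \<infinity>)"
    by auto
qed

sublocale sigma_finite_measure m by (rule sigma_finite_m)
sublocale pair_sigma_finite m m ..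

text \<open>The bounds on balls make the space separable; hence the distance is product measurable.\<close>

lemma finite_net:
  fixes x0 :: 'a
  assumes e: "0 < e"
  shows "\<exists>A. finite A \<and> (\<forall>x\<in>ball x0 R. \<exists>q\<in>A. dist x q < e)"
proof (cases "0 < R")
  case False
  then have "ball x0 R = {}" by simp
  show ?thesis unfolding \<open>ball x0 R = {}\<close> by auto
next
  case R: True
  define sep where "sep A \<longleftrightarrow> finite A \<and> A \<subseteq> ball x0 R \<and> (\<forall>a\<in>A. \<forall>b\<in>A. a \<noteq> b \<longrightarrow> e \<le> dist a b)"
    for A :: "'a set"
  define c where "c = (e/2) powr N / C"
  have c: "0 < c" using e C_ge by (simp add: c_def)
  have bound: "real (card A) \<le> measure m (ball x0 (R + e)) / c" if "sep A" for A
  proof -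
    have A: "finite A" "A \<subseteq> ball x0 R" and s: "\<And>a b. a \<in> A \<Longrightarrow> b \<in> A \<Longrightarrow> a \<noteq> b \<Longrightarrow> e \<le> dist a b"
      using that by (auto simp: sep_def)
    have disj: "disjoint_family_on (\<lambda>a. ball a (e/2)) A"
    proof (unfold disjoint_family_on_def, intro ballI impI)
      fix a b assume "a \<in> A" "b \<in> A" "a \<noteq> b"
      then have "e \<le> dist a b" by (rule s)
      show "ball a (e/2) \<inter> ball b (e/2) = {}"
      proof (rule ccontr)
        assume "ball a (e/2) \<inter> ball b (e/2) \<noteq> {}"
        then obtain z where "dist a z < e/2" "dist b z < e/2" by auto
        then show False using \<open>e \<le> dist a b\<close> dist_triangle2[of a b z] by linarith
      qed
    qed
    have "real (card A) * c = (\<Sum>a\<in>A. c)" by simp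
    also have "\<dots> \<le> (\<Sum>a\<in>A. measure m (ball a (e/2)))"
      using measure_low[of "e/2"] e by (intro sum_mono) (simp add: c_def)
    also have "\<dots> = measure m (\<Union>a\<in>A. ball a (e/2))"
      by (rule measure_UNION'[symmetric])
         (use A disj ball_finite in \<open>auto simp: fmeasurable_def disjoint_family_on_def pairwise_def disjnt_def\<close>)
    also have "\<dots> \<le> measure m (ball x0 (R + e))"
    proof (rule measure_mono_fmeasurable)
      show "(\<Union>a\<in>A. ball a (e/2)) \<subseteq> ball x0 (R + e)"
      proof
        fix z assume "z \<in> (\<Union>a\<in>A. ball a (e/2))"
        then obtain a where "a \<in> A" "dist a z < e/2" by auto
        moreover have "dist x0 a < R" using A \<open>a \<in> A\<close> by auto
        ultimately show "z \<in> ball x0 (R + e)"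
          using dist_triangle[of x0 z a] e by simp
      qed
    qed (use A ball_finite in \<open>auto simp: fmeasurable_def\<close>)
    finally show ?thesis using c by (simp add: field_simps)
  qed
  have "sep {}" by (simp add: sep_def)
  have "\<exists>A. sep A \<and> (\<forall>B. sep B \<longrightarrow> card B \<le> card A)"
  proof (rule ex_has_greatest_nat[of sep "{}" card "Suc (nat \<lceil>measure m (ball x0 (R + e)) / c\<rceil>)"])
    show "\<forall>B. sep B \<longrightarrow> card B < Suc (nat \<lceil>measure m (ball x0 (R + e)) / c\<rceil>)"
    proof (intro allI impI)
      fix B assume "sep B"
      then have "real (card B) \<le> measure m (ball x0 (R + e)) / c" by (rule bound)
      then have "real (card B) \<le> real (nat \<lceil>measure m (ball x0 (R + e)) / c\<rceil>)"
        using real_nat_ceiling_ge order_trans by blast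
      then show "card B < Suc (nat \<lceil>measure m (ball x0 (R + e)) / c\<rceil>)" by linarith
    qed
  qed fact
  then obtain A where A: "sep A" "\<And>B. sep B \<Longrightarrow> card B \<le> card A" by blast
  have "\<exists>q\<in>A. dist x q < e" if "x \<in> ball x0 R" for x
  proof (rule ccontr)
    assume "\<not> ?thesis"
    then have far: "\<And>q. q \<in> A \<Longrightarrow> e \<le> dist x q" by force
    then have "x \<notin> A" using e by force
    moreover have "sep (insert x A)"
      using A(1) far that by (auto simp: sep_def dist_commute)
    ultimately show False using A(2)[of "insert x A"] A(1) by (simp add: sep_def)
  qed
  then show ?thesis using A(1) by (auto simp: sep_def)
qed

lemma countable_dense: "\<exists>D::'a set. countable D \<and> (\<forall>x. \<forall>e>0. \<exists>q\<in>D. dist x q < e)"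
proof -
  have "\<exists>A. finite A \<and> (\<forall>x\<in>ball (undefined::'a) (real k). \<exists>q\<in>A. dist x q < 1 / real (Suc n))" for n k :: nat
    by (rule finite_net) simp
  then have "\<forall>n k. \<exists>A. finite A \<and> (\<forall>x\<in>ball (undefined::'a) (real k). \<exists>q\<in>A. dist x q < 1 / real (Suc n))"
    by blast
  then have "\<exists>A. \<forall>n k. finite (A n k) \<and> (\<forall>x\<in>ball (undefined::'a) (real k). \<exists>q\<in>A n k. dist x q < 1 / real (Suc n))"
    by (simp only: choice_iff)
  then obtain A where A: "\<And>n k::nat. finite (A n k)"
    "\<And>n k x. x \<in> ball (undefined::'a) (real k) \<Longrightarrow> \<exists>q\<in>A n k. dist x q < 1 / real (Suc n)"
    by blast
  have "\<exists>q\<in>(\<Union>n k. A n k). dist x q < e" if e: "0 < e" for x e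
  proof -
    obtain n where n: "1 / real (Suc n) < e" using e by (rule nat_approx_posE)
    obtain k :: nat where "dist undefined x < real k" using reals_Archimedean2 by blast
    then obtain q where "q \<in> A n k" "dist x q < 1 / real (Suc n)" using A(2)[of x k n] by auto
    then show ?thesis using n by (intro bexI[of _ q]) auto
  qed
  moreover have "countable (\<Union>n k. A n k)"
    using A(1) by (intro countable_UN) (auto intro: countable_finite)
  ultimately show ?thesis by blast
qed

lemma measurable_dist: "(\<lambda>w. dist (fst w) (snd w)) \<in> borel_measurable (m \<Otimes>\<^sub>M m)"
proof -
  obtain D :: "'a set" where D: "countable D" "\<And>x e. 0 < e \<Longrightarrow> \<exists>q\<in>D. dist x q < e"
    using countable_dense by metis
  have meas: "(\<lambda>x. dist x q) \<in> borel_measurable m" for q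
  proof -
    have "continuous_on UNIV (\<lambda>x. dist x q)" by (intro continuous_intros)
    then show ?thesis using borel_measurable_continuous_onI measurable_cong_sets[OF sets_m refl] by blast
  qed
  have [measurable]: "(\<lambda>w. dist (fst w) q + dist (snd w) q) \<in> borel_measurable (m \<Otimes>\<^sub>M m)" for q
    by (intro borel_measurable_add measurable_compose[OF measurable_fst meas]
        measurable_compose[OF measurable_snd meas])
  have "{w \<in> space (m \<Otimes>\<^sub>M m). dist (fst w) (snd w) < a} =
      (\<Union>q\<in>D. {w \<in> space (m \<Otimes>\<^sub>M m). dist (fst w) q + dist (snd w) q < a})" for a
  proof (intro set_eqI iffI)
    fix w assume "w \<in> {w \<in> space (m \<Otimes>\<^sub>M m). dist (fst w) (snd w) < a}"
    then have w: "w \<in> space (m \<Otimes>\<^sub>M m)" "dist (fst w) (snd w) < a" by auto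
    obtain q where q: "q \<in> D" "dist (fst w) q < (a - dist (fst w) (snd w)) / 2"
      using D(2)[of "(a - dist (fst w) (snd w)) / 2" "fst w"] w by auto
    have "dist (snd w) q \<le> dist (fst w) (snd w) + dist (fst w) q"
      using dist_triangle3[of "snd w" q "fst w"] by simp
    then have "dist (fst w) q + dist (snd w) q < a" using q by (simp add: field_simps)
    then show "w \<in> (\<Union>q\<in>D. {w \<in> space (m \<Otimes>\<^sub>M m). dist (fst w) q + dist (snd w) q < a})"
      using q w by blast
  next
    fix w assume "w \<in> (\<Union>q\<in>D. {w \<in> space (m \<Otimes>\<^sub>M m). dist (fst w) q + dist (snd w) q < a})"
    then show "w \<in> {w \<in> space (m \<Otimes>\<^sub>M m). dist (fst w) (snd w) < a}"
      using dist_triangle2[of "fst w" "snd w"] by (force intro: le_less_trans)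
  qed
  moreover have "(\<Union>q\<in>D. {w \<in> space (m \<Otimes>\<^sub>M m). dist (fst w) q + dist (snd w) q < a})
      \<in> sets (m \<Otimes>\<^sub>M m)" for a
    using D(1) by (intro sets.countable_UN') auto
  ultimately show ?thesis by (simp add: borel_measurable_iff_less)
qed

definition H :: "real \<Rightarrow> 'a \<Rightarrow> 'a \<Rightarrow> real" where "H t x y = h (dist x y / t)"
abbreviation "T \<equiv> coifman_T m N h"
abbreviation "phi \<equiv> coifman_phi m N h"
abbreviation "psi \<equiv> coifman_psi m N h"

lemma T_eq: "T t f x = t powr (- N) * (\<integral>y. H t x y * f y \<partial>m)"
  by (simp add: coifman_T_def H_def)

lemma H_commute: "H t x y = H t y x" by (simp add: H_def dist_commute)

lemma H_bounds: "0 < t \<Longrightarrow> 0 \<le> H t x y" "0 < t \<Longrightarrow> H t x y \<le> 1"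
  using h_bounds[of "dist x y / t"] by (auto simp: H_def)

lemma H_zero: "0 < t \<Longrightarrow> 2 * t \<le> dist x y \<Longrightarrow> H t x y = 0"
  by (simp add: H_def h_zero pos_le_divide_eq)

lemma H_le: "0 < t \<Longrightarrow> H t x y \<le> indicator (ball x (2 * t)) y"
  using H_bounds[of t x y] H_zero[of t x y] by (auto simp: indicator_def)

lemma H_ge: "0 < t \<Longrightarrow> indicator (ball x (t / 2)) y \<le> H t x y"
  using H_bounds[of t x y] h_one[of "dist x y / t"] by (auto simp: indicator_def H_def field_simps)

lemma H_lip: "0 < t \<Longrightarrow> \<bar>H t x y - H t x' y\<bar> \<le> L * (dist x x' / t)"
proof -
  assume t: "0 < t"
  have "\<bar>H t x y - H t x' y\<bar> \<le> L * \<bar>dist x y / t - dist x' y / t\<bar>"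
    unfolding H_def using t by (intro h_lip) auto
  also have "\<bar>dist x y / t - dist x' y / t\<bar> = \<bar>dist x y - dist x' y\<bar> / t"
    using t by (simp add: diff_divide_distrib[symmetric])
  also have "L * (\<bar>dist x y - dist x' y\<bar> / t) \<le> L * (dist x x' / t)"
    using t L_nonneg dist_triangle[of x y x'] dist_triangle[of x' y x]
    by (intro mult_left_mono divide_right_mono) (auto simp: dist_commute abs_le_iff)
  finally show ?thesis .
qed

lemma continuous_lipschitz:
  fixes g :: "'a \<Rightarrow> real"
  assumes "\<And>x x'. \<bar>g x - g x'\<bar> \<le> B * dist x x'"
  shows "g \<in> borel_measurable m"
proof -
  have "\<bar>g x - g x'\<bar> \<le> \<bar>B\<bar> * dist x x'" for x x'
    using assms[of x x'] mult_right_mono[of B "\<bar>B\<bar>" "dist x x'"] by (meson abs_ge_self order_trans zero_le_dist)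
  then have "\<bar>B\<bar>-lipschitz_on UNIV g" by (intro lipschitz_onI) (auto simp: dist_real_def)
  then have "continuous_on UNIV g" by (rule lipschitz_on_continuous_on)
  then show ?thesis using borel_measurable_continuous_onI measurable_cong_sets[OF sets_m refl] by blast
qed

lemma H_measurable [measurable]: "0 < t \<Longrightarrow> H t x \<in> borel_measurable m"
proof (rule continuous_lipschitz)
  show "\<bar>H t x y - H t x y'\<bar> \<le> (L / t) * dist y y'" if "0 < t" for y y'
    using H_lip[OF that, of y x y'] by (simp add: H_commute[of t x])
qed

lemma H_measurable_pair:
  assumes t: "0 < t" shows "(\<lambda>w. H t (fst w) (snd w)) \<in> borel_measurable (m \<Otimes>\<^sub>M m)"
proof -
  have "L-lipschitz_on UNIV (\<lambda>u. h (max 0 u))"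
  proof (rule lipschitz_onI)
    fix u v :: real
    have "\<bar>h (max 0 u) - h (max 0 v)\<bar> \<le> L * \<bar>max 0 u - max 0 v\<bar>" by (rule h_lip) auto
    also have "\<dots> \<le> L * \<bar>u - v\<bar>" using L_nonneg by (intro mult_left_mono) auto
    finally show "dist (h (max 0 u)) (h (max 0 v)) \<le> L * dist u v" by (simp add: dist_real_def)
  qed (rule L_nonneg)
  then have "continuous_on UNIV (\<lambda>u. h (max 0 u))" by (rule lipschitz_on_continuous_on)
  then have "(\<lambda>u. h (max 0 u)) \<in> borel_measurable borel" by (rule borel_measurable_continuous_onI)
  then have "(\<lambda>w. h (max 0 (dist (fst w) (snd w) / t))) \<in> borel_measurable (m \<Otimes>\<^sub>M m)"
    by (rule measurable_compose_rev)
       (intro borel_measurable_divide measurable_dist borel_measurable_const)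
  moreover have "max 0 (dist x y / t) = dist x y / t" for x y :: 'a using t by simp
  ultimately show ?thesis by (simp add: H_def)
qed

lemma integrable_H:
  assumes t: "0 < t" and f: "f \<in> borel_measurable m" "\<And>y. \<bar>f y\<bar> \<le> B"
  shows "integrable m (\<lambda>y. H t x y * f y)"
proof (rule Bochner_Integration.integrable_bound[of _ "\<lambda>y. B * indicator (ball x (2 * t)) y"])
  show "integrable m (\<lambda>y. B * indicat_real (ball x (2 * t)) y)" using integrable_ball by simp
  have "\<bar>H t x y * f y\<bar> \<le> \<bar>B * indicator (ball x (2 * t)) y\<bar>" for y
  proof -
    have "\<bar>H t x y * f y\<bar> \<le> indicator (ball x (2 * t)) y * B"
      unfolding abs_mult using t H_le[OF t] H_bounds[OF t] f(2) by (intro mult_mono) auto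
    then show ?thesis by (simp add: mult.commute)
  qed
  then show "AE y in m. norm (H t x y * f y) \<le> norm (B * indicat_real (ball x (2 * t)) y)" by simp
qed (use t f in measurable)

definition K :: real where "K = C * 2 powr N"

lemma K_ge: "1 \<le> K"
proof -
  have "1 * 1 \<le> C * 2 powr N" using C_ge N_pos by (intro mult_mono) (auto intro: ge_one_powr_ge_zero)
  then show ?thesis by (simp add: K_def)
qed

lemma powr_cancel: "0 < t \<Longrightarrow> t powr (- N) * t powr N = 1"
  by (simp add: powr_minus field_simps)

lemma T_upper:
  assumes t: "0 < t" and f: "f \<in> borel_measurable m" "\<And>y. 0 \<le> f y \<and> f y \<le> b"
  shows "T t f x \<le> K * b" "0 \<le> T t f x"
proof -
  have b: "0 \<le> b" using f(2) order_trans by blast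
  have i: "integrable m (\<lambda>y. H t x y * f y)" by (rule integrable_H[where B=b]) (use t f in auto)
  have "(\<integral>y. H t x y * f y \<partial>m) \<le> (\<integral>y. indicator (ball x (2 * t)) y * b \<partial>m)"
    using i integrable_ball H_le[OF t] H_bounds[OF t] f(2)
    by (intro integral_mono mult_mono) auto
  also have "\<dots> = measure m (ball x (2 * t)) * b" by simp
  also have "\<dots> \<le> (C * (2 * t) powr N) * b" using measure_up t b by (intro mult_right_mono) auto
  finally have "T t f x \<le> t powr (- N) * ((C * (2 * t) powr N) * b)"
    unfolding T_eq by (intro mult_left_mono) auto
  also have "\<dots> = K * b * (t powr (- N) * t powr N)" using t by (simp add: K_def powr_mult)
  finally show "T t f x \<le> K * b" by (simp add: powr_cancel t)
  show "0 \<le> T t f x" unfolding T_eq using H_bounds[OF t] f(2) by (auto intro!: integral_nonneg mult_nonneg_nonneg)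
qed

lemma T_lower:
  assumes t: "0 < t" and f: "f \<in> borel_measurable m" "\<And>y. a \<le> f y \<and> f y \<le> b" and a: "0 \<le> a"
  shows "a / K \<le> T t f x"
proof -
  have i: "integrable m (\<lambda>y. H t x y * f y)"
  proof (rule integrable_H[where B=b])
    show "\<bar>f y\<bar> \<le> b" for y using f(2)[of y] a by auto
  qed (use t f in auto)
  have "a / K * (t powr N) = a * ((t/2) powr N / C)"
    using t by (simp add: K_def powr_divide)
  also have "\<dots> \<le> a * measure m (ball x (t/2))"
    using measure_low[of "t/2" x] t a by (intro mult_left_mono) auto
  also have "\<dots> = (\<integral>y. indicator (ball x (t/2)) y * a \<partial>m)" by simp
  also have "\<dots> \<le> (\<integral>y. H t x y * f y \<partial>m)"
    using i integrable_ball H_ge[OF t] H_bounds[OF t] f(2) a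
    by (intro integral_mono mult_mono) auto
  finally have "t powr (- N) * (a / K * t powr N) \<le> T t f x"
    unfolding T_eq by (intro mult_left_mono) auto
  moreover have "t powr (- N) * (a / K * t powr N) = a / K"
    using powr_cancel[OF t] by (metis mult.left_commute mult.right_neutral)
  ultimately show ?thesis by argo
qed

lemma T_lip:
  assumes t: "0 < t" and f: "f \<in> borel_measurable m" "\<And>y. \<bar>f y\<bar> \<le> b"
  shows "\<bar>T t f x - T t f x'\<bar> \<le> 2 * L * K * b * (dist x x' / t)"
proof -
  define d where "d = L * (dist x x' / t)"
  have b: "0 \<le> b" using f(2)[of undefined] by linarith
  have d: "0 \<le> d" using L_nonneg t by (simp add: d_def)
  have i: "integrable m (\<lambda>y. H t z y * f y)" for z by (rule integrable_H[OF t f])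
  let ?g = "\<lambda>y. (indicator (ball x (2 * t)) y + indicator (ball x' (2 * t)) y) * (d * b)"
  have pt: "\<bar>H t x y * f y - H t x' y * f y\<bar> \<le> ?g y" for y
  proof (cases "dist x y < 2 * t \<or> dist x' y < 2 * t")
    case True
    then have g1: "1 \<le> (indicator (ball x (2 * t)) y + indicator (ball x' (2 * t)) y :: real)"
      by (auto simp: indicator_def)
    have "\<bar>H t x y * f y - H t x' y * f y\<bar> = \<bar>H t x y - H t x' y\<bar> * \<bar>f y\<bar>"
      by (simp add: abs_mult[symmetric] left_diff_distrib)
    also have "\<dots> \<le> d * b" unfolding d_def using H_lip[OF t] f(2) d by (intro mult_mono) (auto simp: d_def)
    also have "\<dots> \<le> ?g y" using mult_right_mono[OF g1, of "d * b"] d b by simp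
    finally show ?thesis .
  next
    case False
    then show ?thesis using H_zero[OF t] d b by (simp add: indicator_def)
  qed
  have "\<bar>(\<integral>y. H t x y * f y \<partial>m) - (\<integral>y. H t x' y * f y \<partial>m)\<bar> = \<bar>\<integral>y. H t x y * f y - H t x' y * f y \<partial>m\<bar>"
    using i by simp
  also have "\<dots> \<le> (\<integral>y. ?g y \<partial>m)"
  proof (rule order_trans[OF integral_abs_bound integral_mono])
    show "integrable m (\<lambda>y. \<bar>H t x y * f y - H t x' y * f y\<bar>)" using i by auto
    show "integrable m ?g" using integrable_ball by auto
  qed (rule pt)
  also have "\<dots> = (measure m (ball x (2 * t)) + measure m (ball x' (2 * t))) * (d * b)"
    using integrable_ball by simp
  also have "\<dots> \<le> (C * (2 * t) powr N + C * (2 * t) powr N) * (d * b)"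
    using measure_up t d b by (intro mult_right_mono add_mono) auto
  also have "\<dots> = 2 * K * t powr N * d * b" using t by (simp add: K_def powr_mult)
  finally have "t powr (- N) * \<bar>(\<integral>y. H t x y * f y \<partial>m) - (\<integral>y. H t x' y * f y \<partial>m)\<bar>
      \<le> t powr (- N) * (2 * K * t powr N * d * b)" by (intro mult_left_mono) auto
  also have "\<dots> = 2 * K * d * b * (t powr (- N) * t powr N)" by simp
  also have "\<dots> = 2 * L * K * b * (dist x x' / t)" by (simp add: powr_cancel t d_def)
  finally show ?thesis
    unfolding T_eq by (simp add: right_diff_distrib[symmetric] abs_mult)
qed

lemma T_measurable:
  assumes t: "0 < t" and f: "f \<in> borel_measurable m" "\<And>y. \<bar>f y\<bar> \<le> b"
  shows "T t f \<in> borel_measurable m"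
  using T_lip[OF t f] by (intro continuous_lipschitz[of _ "2 * L * K * b / t"]) simp

lemma phi_bounds:
  assumes t: "0 < t" shows "1 / K \<le> phi t x" "phi t x \<le> K" "0 < T t (\<lambda>_. 1) x"
proof -
  have "1 / K \<le> T t (\<lambda>_. 1) x" by (rule T_lower[OF t, of _ 1 1]) auto
  moreover have "T t (\<lambda>_. 1) x \<le> K * 1" by (rule T_upper(1)[OF t]) auto
  moreover have "0 < 1 / K" using K_ge by simp
  ultimately have *: "0 < T t (\<lambda>_. 1) x" "T t (\<lambda>_. 1) x \<le> K" "1 \<le> K * T t (\<lambda>_. 1) x"
    using K_ge less_le_trans[of 0 "1 / K" "T t (\<lambda>_. 1) x"] by (auto simp: field_simps)
  then show "0 < T t (\<lambda>_. 1) x" "1 / K \<le> phi t x" "phi t x \<le> K"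
    using K_ge by (auto simp: coifman_phi_def pos_divide_le_eq frac_le)
qed

lemma phi_nonneg: "0 < t \<Longrightarrow> 0 \<le> phi t x"
  using phi_bounds(3)[of t x] by (simp add: coifman_phi_def)

lemma phi_measurable [measurable]: "0 < t \<Longrightarrow> phi t \<in> borel_measurable m"
proof -
  assume "0 < t"
  then have [measurable]: "T t (\<lambda>_. 1) \<in> borel_measurable m" by (intro T_measurable[of _ _ 1]) auto
  show ?thesis unfolding coifman_phi_def[abs_def] by measurable
qed

lemma psi_bounds:
  assumes t: "0 < t" shows "0 \<le> psi t x" "psi t x \<le> K * K" "0 < T t (phi t) x"
proof -
  have "1 / K / K \<le> T t (phi t) x"
    by (rule T_lower[OF t, of _ _ K]) (use phi_bounds[OF t] phi_measurable[OF t] K_ge in auto)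
  moreover have "0 < 1 / K / K" using K_ge by simp
  ultimately have *: "0 < T t (phi t) x" "1 \<le> (K * K) * T t (phi t) x"
    using K_ge less_le_trans[of 0 "1 / K / K" "T t (phi t) x"] by (auto simp: field_simps)
  then show "0 < T t (phi t) x" "0 \<le> psi t x" "psi t x \<le> K * K"
    using K_ge by (auto simp: coifman_psi_def pos_divide_le_eq)
qed

lemma psi_measurable [measurable]: "0 < t \<Longrightarrow> psi t \<in> borel_measurable m"
proof -
  assume t: "0 < t"
  have [measurable]: "T t (phi t) \<in> borel_measurable m"
    by (rule T_measurable[OF t, of _ K]) (use phi_bounds[OF t] phi_nonneg[OF t] phi_measurable[OF t] in auto)
  show ?thesis unfolding coifman_psi_def[abs_def] by measurable
qed

abbreviation "s \<equiv> coifman_kernel m N h"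

lemma s_eq: "0 < t \<Longrightarrow> s x y t = phi t x * (phi t y * t powr (- N) * T t (\<lambda>z. H t y z * psi t z) x)"
proof -
  assume t: "0 < t"
  have "inverse (t powr (2 * N)) = t powr (- N) * t powr (- N)"
    using t by (simp add: powr_minus[symmetric] powr_add[symmetric])
  then show ?thesis
    by (simp add: coifman_kernel_def T_eq H_def divide_inverse mult_ac)
qed

lemma Hpsi_bounds:
  assumes t: "0 < t" shows "0 \<le> H t y z * psi t z" "H t y z * psi t z \<le> K * K"
proof -
  show "0 \<le> H t y z * psi t z" using H_bounds[OF t] psi_bounds[OF t] by simp
  have "H t y z * psi t z \<le> 1 * (K * K)"
    using H_bounds[OF t] psi_bounds[OF t] by (intro mult_mono) auto
  then show "H t y z * psi t z \<le> K * K" by simp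
qed

lemma Hpsi_measurable [measurable]: "0 < t \<Longrightarrow> (\<lambda>z. H t y z * psi t z) \<in> borel_measurable m"
  by measurable

lemma G_bounds:
  assumes t: "0 < t"
  shows "0 \<le> T t (\<lambda>z. H t y z * psi t z) x" "T t (\<lambda>z. H t y z * psi t z) x \<le> K * (K * K)"
  by (rule T_upper[OF t]; use Hpsi_bounds[OF t] Hpsi_measurable[OF t] in auto)+

lemma s_symm: "s x y t = s y x t"
  by (simp add: coifman_kernel_def mult_ac)

lemma s_nonneg: "0 < t \<Longrightarrow> 0 \<le> s x y t"
  using phi_nonneg G_bounds by (simp add: s_eq)

lemma s_upper:
  assumes t: "0 < t" shows "s x y t \<le> K ^ 5 / t powr N"
proof -
  have "s x y t \<le> K * (K * t powr (- N) * (K * (K * K)))"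
    unfolding s_eq[OF t] using phi_nonneg[OF t] phi_bounds[OF t] G_bounds[OF t] K_ge
    by (intro mult_mono) auto
  also have "\<dots> = K ^ 5 / t powr N" by (simp add: powr_minus divide_inverse eval_nat_numeral mult_ac)
  finally show ?thesis .
qed

lemma s_support:
  assumes t: "0 < t" and d: "4 * t \<le> dist x y" shows "s x y t = 0"
proof -
  have "H t x z * H t y z = 0" for z
    using H_zero[OF t, of x z] H_zero[OF t, of y z] dist_triangle2[of x y z] d by fastforce
  then have "(\<lambda>z. h (dist x z / t) * h (dist y z / t) * psi t z) = (\<lambda>z. 0)"
    unfolding H_def by (intro ext) (metis mult_zero_left)
  then show ?thesis unfolding coifman_kernel_def by simp
qed

lemma phi_lip:
  assumes t: "0 < t" shows "\<bar>phi t x - phi t x'\<bar> \<le> 2 * L * K ^ 3 * (dist x x' / t)"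
proof -
  let ?a = "T t (\<lambda>_. 1) x" and ?b = "T t (\<lambda>_. 1) x'"
  have "phi t x - phi t x' = (?b - ?a) * (phi t x * phi t x')"
    using phi_bounds(3)[OF t, of x] phi_bounds(3)[OF t, of x'] by (simp add: coifman_phi_def field_simps)
  then have "\<bar>phi t x - phi t x'\<bar> = \<bar>?a - ?b\<bar> * (phi t x * phi t x')"
    using phi_nonneg[OF t] by (simp add: abs_mult abs_minus_commute)
  also have "\<dots> \<le> (2 * L * K * 1 * (dist x x' / t)) * (K * K)"
    using phi_nonneg[OF t] phi_bounds[OF t] K_ge L_nonneg t
    by (intro mult_mono T_lip[OF t]) auto
  finally show ?thesis by (simp add: eval_nat_numeral mult_ac)
qed

lemma s_lip:
  assumes t: "0 < t"
  shows "\<bar>s x y t - s x' y t\<bar> \<le> 4 * L * K ^ 7 * dist x x' / t powr (N + 1)"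
proof -
  let ?G = "T t (\<lambda>z. H t y z * psi t z)" and ?d = "dist x x' / t"
  have d: "0 \<le> ?d" using t by simp
  have "\<bar>?G x - ?G x'\<bar> \<le> 2 * L * K * (K * K) * ?d"
    by (rule T_lip[OF t]) (use Hpsi_bounds[OF t] Hpsi_measurable[OF t] in auto)
  then have 1: "phi t x * \<bar>?G x - ?G x'\<bar> \<le> K * (2 * L * K * (K * K) * ?d)"
    using phi_nonneg[OF t] phi_bounds[OF t] K_ge by (intro mult_mono) auto
  have 2: "\<bar>phi t x - phi t x'\<bar> * ?G x' \<le> (2 * L * K ^ 3 * ?d) * (K * (K * K))"
    by (intro mult_mono phi_lip[OF t] G_bounds[OF t])
       (use d L_nonneg K_ge mult_nonneg_nonneg[of "2 * L * K ^ 3" ?d] in auto)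
  have 3: "K ^ 4 \<le> K ^ 6" using K_ge by (intro power_increasing) auto
  have "\<bar>phi t x * ?G x - phi t x' * ?G x'\<bar> = \<bar>phi t x * (?G x - ?G x') + (phi t x - phi t x') * ?G x'\<bar>"
    by (simp add: algebra_simps)
  also have "\<dots> \<le> phi t x * \<bar>?G x - ?G x'\<bar> + \<bar>phi t x - phi t x'\<bar> * ?G x'"
    using phi_nonneg[OF t, of x] G_bounds(1)[OF t, of y x'] by (intro order_trans[OF abs_triangle_ineq]) (simp add: abs_mult)
  also have "\<dots> \<le> 2 * L * ?d * K ^ 4 + 2 * L * ?d * K ^ 6"
    using 1 2 by (simp add: eval_nat_numeral mult_ac)
  also have "\<dots> \<le> 2 * L * ?d * K ^ 6 + 2 * L * ?d * K ^ 6"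
    using mult_left_mono[OF 3, of "2 * L * ?d"] mult_nonneg_nonneg[OF L_nonneg d] by simp
  finally have 4: "\<bar>phi t x * ?G x - phi t x' * ?G x'\<bar> \<le> 4 * L * ?d * K ^ 6" by simp
  have "\<bar>s x y t - s x' y t\<bar> = phi t y * t powr (- N) * \<bar>phi t x * ?G x - phi t x' * ?G x'\<bar>"
  proof -
    have "s x y t - s x' y t = phi t y * t powr (- N) * (phi t x * ?G x - phi t x' * ?G x')"
      unfolding s_eq[OF t] by (simp add: algebra_simps)
    then show ?thesis using phi_nonneg[OF t, of y] by (simp add: abs_mult)
  qed
  also have "\<dots> \<le> K * t powr (- N) * (4 * L * ?d * K ^ 6)"
    using 4 phi_nonneg[OF t] phi_bounds[OF t] K_ge by (intro mult_mono) auto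
  also have "\<dots> = 4 * L * K ^ 7 * dist x x' / t powr (N + 1)"
    using t by (simp add: powr_add powr_minus divide_inverse eval_nat_numeral mult_ac)
  finally show ?thesis .
qed

lemma s_integral:
  assumes t: "0 < t" shows "(\<integral>y. s x y t \<partial>m) = 1"
proof -
  let ?u = "\<lambda>y z. H t x z * H t y z * psi t z * phi t y"
  let ?S = "ball x (4 * t) \<times> ball x (2 * t)"
  have int: "integrable (m \<Otimes>\<^sub>M m) (\<lambda>(y, z). ?u y z)"
  proof (rule Bochner_Integration.integrable_bound[of _ "\<lambda>w. indicator ?S w * (K * K * K)"])
    have "emeasure (m \<Otimes>\<^sub>M m) ?S = emeasure m (ball x (4 * t)) * emeasure m (ball x (2 * t))"
      by (rule sigma_finite_measure.emeasure_pair_measure_Times[OF sigma_finite_m]) (rule ball_sets)+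
    then have "emeasure (m \<Otimes>\<^sub>M m) ?S < \<infinity>"
      using ball_finite[of x "4 * t"] ball_finite[of x "2 * t"] by (simp add: ennreal_mult_less_top)
    then show "integrable (m \<Otimes>\<^sub>M m) (\<lambda>w. indicat_real ?S w * (K * K * K))"
      by (simp add: integrable_indicator_iff)
    note [measurable] = H_measurable_pair[OF t] psi_measurable[OF t] phi_measurable[OF t] H_measurable[OF t]
    show "(\<lambda>(y, z). ?u y z) \<in> borel_measurable (m \<Otimes>\<^sub>M m)"
      unfolding case_prod_beta by measurable
    have "\<bar>?u y z\<bar> \<le> indicator ?S (y, z) * (K * K * K)" for y z
    proof (cases "dist x z < 2 * t \<and> dist y z < 2 * t")
      case True
      then have "dist x y < 4 * t" using dist_triangle2[of x y z] by simp
      then have ind: "indicator ?S (y, z) = (1::real)" using True by (simp add: indicator_def)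
      have "\<bar>?u y z\<bar> = H t x z * H t y z * psi t z * phi t y"
        using H_bounds[OF t] psi_bounds[OF t] phi_nonneg[OF t] by (simp add: abs_mult)
      also have "\<dots> \<le> 1 * 1 * (K * K) * K"
        using H_bounds[OF t] psi_bounds[OF t] phi_nonneg[OF t] phi_bounds[OF t] K_ge
        by (intro mult_mono) auto
      finally show ?thesis using ind by simp
    next
      case False
      then have "H t x z * H t y z = 0" using H_zero[OF t, of x z] H_zero[OF t, of y z] by auto
      then have "?u y z = 0" by auto
      show ?thesis unfolding \<open>?u y z = 0\<close> using K_ge by simp
    qed
    then show "AE w in m \<Otimes>\<^sub>M m. norm (case w of (y, z) \<Rightarrow> ?u y z) \<le> norm (indicat_real ?S w * (K * K * K))"
      using K_ge by (auto simp: abs_mult)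
  qed
  have tN: "t powr N * t powr N = t powr (2 * N)" using t by (simp add: powr_add[symmetric])
  have Tphi: "(\<integral>y. H t z y * phi t y \<partial>m) = t powr N / psi t z" for z
    using t powr_cancel[OF t] psi_bounds(3)[OF t, of z]
    by (simp add: coifman_psi_def T_eq powr_minus divide_simps)
  have psi_pos: "0 < psi t z" for z using psi_bounds(3)[OF t, of z] by (simp add: coifman_psi_def)
  have "(\<integral>y. s x y t \<partial>m) = (\<integral>y. (phi t x / t powr (2 * N)) * (\<integral>z. ?u y z \<partial>m) \<partial>m)"
    by (intro Bochner_Integration.integral_cong) (auto simp: coifman_kernel_def H_def)
  also have "\<dots> = phi t x / t powr (2 * N) * (\<integral>y. (\<integral>z. ?u y z \<partial>m) \<partial>m)" by simp
  also have "(\<integral>y. (\<integral>z. ?u y z \<partial>m) \<partial>m) = (\<integral>z. (\<integral>y. ?u y z \<partial>m) \<partial>m)"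
    using Fubini_integral[of "\<lambda>y z. ?u y z"] int by simp
  also have "\<dots> = (\<integral>z. H t x z * t powr N \<partial>m)"
  proof (intro Bochner_Integration.integral_cong refl)
    fix z
    have "(\<integral>y. ?u y z \<partial>m) = (\<integral>y. H t x z * psi t z * (H t z y * phi t y) \<partial>m)"
      by (intro Bochner_Integration.integral_cong refl) (simp add: H_commute[of t z] mult_ac)
    also have "\<dots> = H t x z * psi t z * (t powr N / psi t z)" by (simp add: Tphi)
    finally show "(\<integral>y. ?u y z \<partial>m) = H t x z * t powr N" using psi_pos[of z] by simp
  qed
  also have "\<dots> = t powr N * t powr N * T t (\<lambda>_. 1) x"
    using t by (simp add: T_eq powr_minus)
  finally show ?thesis
    using phi_bounds(3)[OF t, of x] t by (simp add: tN coifman_phi_def)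
qed

lemma H_cont_t: "continuous_on {0<..} (\<lambda>t. H t x y)"
proof -
  have "L-lipschitz_on {0..} h"
    using h_lip L_nonneg by (intro lipschitz_onI) (auto simp: dist_real_def)
  then have "continuous_on {0..} h" by (rule lipschitz_on_continuous_on)
  moreover have "continuous_on {0<..} (\<lambda>t. dist x y / t)" by (intro continuous_intros) auto
  ultimately show ?thesis unfolding H_def
    by (rule continuous_on_compose2) auto
qed

lemma T_cont_t:
  assumes f: "\<And>t. 0 < t \<Longrightarrow> f t \<in> borel_measurable m" "\<And>t y. 0 < t \<Longrightarrow> \<bar>f t y\<bar> \<le> B"
    "\<And>y. continuous_on {0<..} (\<lambda>t. f t y)"
  shows "continuous_on {0<..} (\<lambda>t. T t (f t) x)"
proof -
  have "continuous_on {0<..} (\<lambda>t. \<integral>y. H t x y * f t y \<partial>m)"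
    unfolding continuous_on_sequentially
  proof (intro allI impI ballI, elim conjE)
    fix u :: "nat \<Rightarrow> real" and a assume a: "a \<in> {0<..}" and u: "\<forall>n. u n \<in> {0<..}" "u \<longlonglongrightarrow> a"
    have "0 < a" using a by simp
    have u0: "0 < u n" for n using u(1) by auto
    obtain R where "\<And>n. norm (u n) \<le> R"
      using convergent_imp_Bseq[OF convergentI[OF u(2)]] unfolding Bseq_def by blast
    then have R: "u n \<le> R" for n by (metis abs_le_D1 real_norm_def)
    have B: "0 \<le> B" by (rule order_trans[OF abs_ge_zero f(2)[OF \<open>0 < a\<close>]])
    have "(\<lambda>n. \<integral>y. H (u n) x y * f (u n) y \<partial>m) \<longlonglongrightarrow> (\<integral>y. H a x y * f a y \<partial>m)"
    proof (rule integral_dominated_convergence[where w="\<lambda>y. B * indicator (ball x (2 * R)) y"])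
      show "integrable m (\<lambda>y. B * indicat_real (ball x (2 * R)) y)" using integrable_ball by simp
      show "AE y in m. (\<lambda>n. H (u n) x y * f (u n) y) \<longlonglongrightarrow> H a x y * f a y"
      proof (rule AE_I2)
        fix y
        have "continuous_on {0<..} (\<lambda>t. H t x y * f t y)"
          by (intro continuous_intros H_cont_t f)
        then show "(\<lambda>n. H (u n) x y * f (u n) y) \<longlonglongrightarrow> H a x y * f a y"
          using a u unfolding continuous_on_sequentially comp_def by blast
      qed
      show "AE y in m. norm (H (u n) x y * f (u n) y) \<le> B * indicator (ball x (2 * R)) y" for n
      proof (rule AE_I2)
        fix y
        have "H (u n) x y \<le> indicator (ball x (2 * R)) y"
          using H_le[OF u0, of n x y] R[of n] H_bounds[OF u0, of n x y]
          by (cases "y \<in> ball x (2 * R)") (auto simp: indicator_def split: if_splits)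
        then have "\<bar>H (u n) x y\<bar> * \<bar>f (u n) y\<bar> \<le> indicator (ball x (2 * R)) y * B"
          using H_bounds[OF u0] f(2)[OF u0] by (intro mult_mono) auto
        then show "norm (H (u n) x y * f (u n) y) \<le> B * indicator (ball x (2 * R)) y"
          by (simp add: abs_mult mult.commute)
      qed
    qed (use H_measurable[OF u0] H_measurable[OF \<open>0 < a\<close>] f(1)[OF u0] f(1)[OF \<open>0 < a\<close>] in measurable)
    then show "((\<lambda>t. \<integral>y. H t x y * f t y \<partial>m) \<circ> u) \<longlonglongrightarrow> (\<integral>y. H a x y * f a y \<partial>m)"
      by (simp add: comp_def)
  qed
  then show ?thesis unfolding T_eq by (intro continuous_intros) auto
qed

lemma phi_cont_t: "continuous_on {0<..} (\<lambda>t. phi t x)"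
  unfolding coifman_phi_def
proof (intro continuous_intros T_cont_t[of _ 1] ballI)
  show "T t (\<lambda>_. 1) x \<noteq> 0" if "t \<in> {0<..}" for t using phi_bounds(3)[of t x] that by simp
qed auto

lemma psi_cont_t: "continuous_on {0<..} (\<lambda>t. psi t x)"
  unfolding coifman_psi_def
proof (intro continuous_intros T_cont_t[of _ K] ballI phi_cont_t)
  show "T t (phi t) x \<noteq> 0" if "t \<in> {0<..}" for t using psi_bounds(3)[of t x] that by simp
qed (use phi_bounds phi_nonneg in auto)

lemma s_cont_t: "continuous_on {0<..} (s x y)"
proof -
  have "continuous_on {0<..} (\<lambda>t. phi t x * (phi t y * t powr (- N) * T t (\<lambda>z. H t y z * psi t z) x))"
    by (intro continuous_intros phi_cont_t psi_cont_t H_cont_t T_cont_t[of _ "K * K"])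
       (use Hpsi_bounds Hpsi_measurable in auto)
  then show ?thesis by (rule continuous_on_eq) (simp add: s_eq)
qed

lemma s_coifman: "coifman_approximation m N s"
proof -
  define A where "A = K ^ 5 + 4 + 4 * L * K ^ 7"
  have k: "0 \<le> K ^ 5" "0 \<le> 4 * L * K ^ 7" using K_ge L_nonneg by auto
  have A: "0 < A" "K ^ 5 \<le> A" "4 \<le> A" "4 * L * K ^ 7 \<le> A"
    using k unfolding A_def by linarith+
  have "s x y t \<le> A / t powr N \<and> (A * t < dist x y \<longrightarrow> s x y t = 0) \<and>
        (\<forall>x'. \<bar>s x y t - s x' y t\<bar> \<le> A * dist x x' / t powr (N + 1))" if t: "0 < t" for t x y
  proof (intro conjI impI allI)
    show "s x y t \<le> A / t powr N"
      using s_upper[OF t, of x y] A(2) by (meson divide_right_mono order_trans powr_ge_zero)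
    show "s x y t = 0" if "A * t < dist x y"
      using mult_right_mono[OF A(3), of t] t that by (intro s_support) linarith+
    show "\<bar>s x y t - s x' y t\<bar> \<le> A * dist x x' / t powr (N + 1)" for x'
      using s_lip[OF t, of x y x'] A(4)
      by (meson divide_right_mono mult_right_mono order_trans powr_ge_zero zero_le_dist)
  qed
  then show ?thesis
    unfolding coifman_approximation_def using A(1) s_integral s_symm s_nonneg s_cont_t by blast
qed

end

lemma coifman_approximation_coifman_kernel:
  fixes m :: "'a::metric_space measure"
  assumes m: "sets m = sets borel" "ahlfors_regular N UNIV m" "emeasure m UNIV = \<infinity>"
    and X: "\<not> is_singleton (UNIV :: 'a set)"
    and h: "cutoff h"
  shows "coifman_approximation m N (coifman_kernel m N h)"
proof -
  have N: "0 < N" using m(2) by (auto simp: ahlfors_regular_def)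
  obtain C where C: "1 \<le> C" "\<And>x r. 0 < r \<Longrightarrow> ennreal (r powr N / C) \<le> emeasure m (ball x r) \<and>
           emeasure m (ball x r) \<le> ennreal (C * r powr N)"
    using ahlfors_regular_ball_bounds[OF m X] by blast
  obtain L where L: "0 \<le> L" "\<And>u v. 0 \<le> u \<Longrightarrow> 0 \<le> v \<Longrightarrow> \<bar>h u - h v\<bar> \<le> L * \<bar>u - v\<bar>"
    using cutoff_lipschitz[OF h] by blast
  interpret coifman_construction m N C h L
    using m N C L h by unfold_locales (auto simp: cutoff_def)
  show ?thesis by (rule s_coifman)
qed

end

theory Submission
  imports Defs
begin

text \<open>
  Everything is estimated through the double integral over \<open>(y, t)\<close> defining \<open>J\<^sub>\<alpha> g\<close>; the kernel
  \<open>k\<^sub>\<alpha>\<close> itself is never bounded pointwise, so that no case distinction between \<open>\<alpha>\<close> and \<open>N\<close> arises.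
  Since \<open>s(x,y,t) \<le> C t\<^bsup>-N\<^esup>\<close> is supported in \<open>d(x,y) \<le> C t\<close>, the potential is dominated by an average
  over scales \<open>t\<close> of the means of \<open>\<bar>g\<bar>\<close> over balls of radius \<open>C t\<close>.  One application of the power mean
  inequality, weighted by the expected size \<open>t\<^bsup>(\<eta>-N)/p\<^esup>\<close> of the scale \<open>t\<close>, bounds such averages from
  \<open>L\<^sup>p(m)\<close> to \<open>L\<^sup>p(\<mu>)\<close> for every \<open>\<mu>\<close> with \<open>\<mu>(B(x,r)) \<le> D r\<^bsup>\<eta>\<^esup>\<close>.  For \<open>d(x,x') < r\<close> the scales \<open>t < r\<close> are
  estimated by size and the scales \<open>t \<ge> r\<close> by the Lipschitz bound on \<open>s\<close>, which gives
  \<open>\<integral> \<integral>\<^bsub>B(x,r)\<^esub> \<bar>J\<^sub>\<alpha> g(y) - J\<^sub>\<alpha> g(x)\<bar>\<^sup>p d\<nu>(y) / \<nu>(B(x,r)) d\<mu>(x) \<le> K r\<^bsup>\<beta> p\<^esup> \<parallel>g\<parallel>\<^sup>p\<close>.  With \<open>\<nu> = \<mu>\<close> this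
  is the Besov estimate.  With \<open>\<nu> = m\<close> and \<open>r \<rightarrow> 0\<close> it shows that a continuous function which equals
  \<open>J\<^sub>\<alpha> g\<close> \<open>m\<close>-almost everywhere equals it \<open>\<mu>\<close>-almost everywhere; applied to the zero function this
  makes \<open>R (J\<^sub>\<alpha> g) = J\<^sub>\<alpha> g\<close> well defined.
\<close>

section \<open>Powers of extended nonnegative reals\<close>

text \<open>The same operation gives the p-th powers of ball averages and, by
  \<open>enn_root_eq\<close>, the roots in the norms. It keeps \<infinity> fixed, so averages need
  not be known to be finite before they are raised to a power.\<close>

definition enn_powr :: "ennreal \<Rightarrow> real \<Rightarrow> ennreal" where
  "enn_powr x p = (if x = \<infinity> then \<infinity> else ennreal (enn2real x powr p))"

lemma enn_root_eq: "enn_root p x = enn_powr x (1 / p)"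
  by (simp add: enn_root_def enn_powr_def)

lemma enn_powr_ennreal [simp]: "0 \<le> a \<Longrightarrow> enn_powr (ennreal a) p = ennreal (a powr p)"
  by (simp add: enn_powr_def)

lemma enn_powr_top [simp]: "enn_powr \<infinity> p = \<infinity>" "enn_powr top p = top"
  by (simp_all add: enn_powr_def)

lemma enn_powr_0 [simp]: "enn_powr 0 p = 0"
  by (simp add: enn_powr_def)

lemma enn_powr_finite_iff [simp]: "enn_powr x p < top \<longleftrightarrow> x < top" "enn_powr x p = top \<longleftrightarrow> x = top"
  by (cases x; simp)+

lemma enn_powr_mono: "x \<le> y \<Longrightarrow> 0 \<le> p \<Longrightarrow> enn_powr x p \<le> enn_powr y p"
  by (cases x; cases y) (auto simp: powr_mono2 top_unique)

lemma enn_powr_mult: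
  assumes "0 < p" shows "enn_powr (x * y) p = enn_powr x p * enn_powr y p"
proof (cases x)
  case (real a)
  note xa = this
  show ?thesis
  proof (cases y)
    case (real b)
    then show ?thesis using xa by (simp add: ennreal_mult[symmetric] powr_mult)
  next
    case top
    then show ?thesis using xa assms by (cases "a = 0") (auto simp: ennreal_mult_top)
  qed
next
  case top
  note xt = this
  show ?thesis
  proof (cases y)
    case (real b)
    then show ?thesis using xt assms by (cases "b = 0") (auto simp: ennreal_top_mult)
  qed (use xt in simp)
qed

lemma borel_measurable_enn_powr [measurable]:
  assumes [measurable]: "f \<in> borel_measurable M"
  shows "(\<lambda>x. enn_powr (f x) p) \<in> borel_measurable M"
  unfolding enn_powr_def by measurable

text \<open>The sum is at most three times the largest term, whose power is one of the three on the
  right. Three terms are what \<open>potential_diff_le\<close> produces.\<close>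

lemma enn_powr_add3:
  assumes "0 < p"
  shows "enn_powr (x + y + z) p \<le> ennreal (3 powr p) * (enn_powr x p + enn_powr y p + enn_powr z p)"
proof -
  define v where "v = max x (max y z)"
  have "x + y + z \<le> v + v + v" unfolding v_def by (intro add_mono) (auto simp: le_max_iff_disj)
  also have "\<dots> = 3 * v"
  proof -
    have "3 * v = (1 + 1 + 1) * v" by simp
    then show ?thesis by (simp only: distrib_right mult_1)
  qed
  finally have "enn_powr (x + y + z) p \<le> enn_powr (3 * v) p"
    using assms by (intro enn_powr_mono) auto
  also have "\<dots> = ennreal (3 powr p) * enn_powr v p"
    using enn_powr_ennreal[of 3 p] by (simp add: enn_powr_mult[OF assms])
  also have "enn_powr v p \<le> enn_powr x p + enn_powr y p + enn_powr z p"
    unfolding v_def max_def by (auto intro: add_increasing add_increasing2)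
  finally show ?thesis by (simp add: mult_left_mono)
qed

section \<open>Weighted power mean inequality\<close>

text \<open>Convexity of the p-th power: its tangent at \<open>b\<close> lies below the graph. This
  is Young's inequality for \<open>a powr p\<close> and \<open>b powr p\<close> with weights
  \<open>1 / p\<close> and \<open>1 - 1 / p\<close>.\<close>

lemma power_mean_tangent:
  fixes a b p :: real
  assumes "0 \<le> a" "0 < b" "1 < p"
  shows "p * b powr (p - 1) * a \<le> a powr p + (p - 1) * b powr p"
proof (cases "a = 0")
  case False
  have "(a powr p) powr (1/p) * (b powr p) powr (1 - 1/p) \<le> 1/p * a powr p + (1 - 1/p) * b powr p"
    using assms False by (intro Youngs_inequality_0) auto
  moreover have "(a powr p) powr (1/p) = a" using assms by (simp add: powr_powr)
  moreover have "(b powr p) powr (1 - 1/p) = b powr (p - 1)"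
    using assms by (simp add: powr_powr right_diff_distrib)
  ultimately have "p * (a * b powr (p - 1)) \<le> p * (1/p * a powr p + (1 - 1/p) * b powr p)"
    using assms by (intro mult_left_mono) auto
  then show ?thesis using assms by (simp add: algebra_simps)
qed (use assms in simp)

text \<open>Jensen's inequality for the measure with density \<open>k\<close>, whose mass is only
  known to be at most \<open>W\<close>. The tangent inequality is integrated against
  \<open>k\<close>, and the tangent point is then taken to be the mean \<open>I / W\<close>.\<close>

lemma nn_integral_weighted_power_mean:
  fixes f k :: "'b \<Rightarrow> real"
  assumes [measurable]: "f \<in> borel_measurable M" "k \<in> borel_measurable M"
    and f: "\<And>x. 0 \<le> f x" and k: "\<And>x. 0 \<le> k x" and p: "1 < p" and W: "0 \<le> W"
    and kW: "(\<integral>\<^sup>+x. ennreal (k x) \<partial>M) \<le> ennreal W"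
  shows "enn_powr (\<integral>\<^sup>+x. ennreal (f x * k x) \<partial>M) p
           \<le> ennreal (W powr (p - 1)) * (\<integral>\<^sup>+x. ennreal (f x powr p * k x) \<partial>M)"
    (is "enn_powr ?I p \<le> _ * ?R")
proof -
  have tangent: "ennreal (p * b powr (p - 1)) * ?I \<le> ?R + ennreal ((p - 1) * b powr p * W)" if b: "0 < b" for b
  proof -
    have "ennreal (p * b powr (p - 1)) * ?I = (\<integral>\<^sup>+x. ennreal (p * b powr (p - 1) * f x * k x) \<partial>M)"
      using p b by (subst nn_integral_cmult[symmetric]) (auto simp: ennreal_mult'[symmetric] mult.assoc)
    also have "\<dots> \<le> (\<integral>\<^sup>+x. ennreal (f x powr p * k x) + ennreal ((p - 1) * b powr p) * ennreal (k x) \<partial>M)"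
    proof (rule nn_integral_mono)
      fix x
      have "p * b powr (p - 1) * f x * k x \<le> (f x powr p + (p - 1) * b powr p) * k x"
        by (intro mult_right_mono power_mean_tangent f k b p)
      also have "\<dots> = f x powr p * k x + (p - 1) * b powr p * k x" by (simp add: algebra_simps)
      finally show "ennreal (p * b powr (p - 1) * f x * k x)
          \<le> ennreal (f x powr p * k x) + ennreal ((p - 1) * b powr p) * ennreal (k x)"
        using p k by (simp add: ennreal_mult'[symmetric] ennreal_plus[symmetric] del: ennreal_plus)
    qed
    also have "\<dots> = ?R + ennreal ((p - 1) * b powr p) * (\<integral>\<^sup>+x. ennreal (k x) \<partial>M)"
      by (simp add: nn_integral_add nn_integral_cmult)
    also have "\<dots> \<le> ?R + ennreal ((p - 1) * b powr p) * ennreal W"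
      by (intro add_left_mono mult_left_mono kW) auto
    also have "\<dots> = ?R + ennreal ((p - 1) * b powr p * W)"
      using p W by (simp add: ennreal_mult'[symmetric])
    finally show ?thesis .
  qed
  show ?thesis
  proof (cases "W = 0")
    case True
    then have "(\<integral>\<^sup>+x. ennreal (k x) \<partial>M) = 0" using kW by simp
    then have "AE x in M. ennreal (k x) = 0" by (subst (asm) nn_integral_0_iff_AE) auto
    then have "AE x in M. ennreal (f x * k x) = 0" proof eventually_elim
      fix x assume "ennreal (k x) = 0"
      then have "k x = 0" using k[of x] by (simp add: ennreal_eq_0_iff)
      then show "ennreal (f x * k x) = 0" by simp
    qed
    then have "?I = 0" by (subst nn_integral_0_iff_AE) auto
    then show ?thesis by simp
  next
    case False
    then have W0: "0 < W" using W by simp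
    show ?thesis
    proof (cases ?R)
      case top
      then show ?thesis using W0 by (simp add: ennreal_mult_top)
    next
      case (real R)
      \<comment> \<open>The tangent at 1 serves only to show that the integral is finite, so that it
        can be treated as a real number.\<close>
      have "ennreal p * ?I \<le> ennreal (R + (p - 1) * W)"
        using tangent[of 1] real p W by (simp add: ennreal_plus)
      then have "ennreal p * ?I < top" by (rule le_less_trans) simp
      then have "?I < top" using p by (auto simp: ennreal_mult_less_top)
      then obtain I where I: "?I = ennreal I" "0 \<le> I" by (cases ?I) auto
      have "I powr p \<le> W powr (p - 1) * R"
      proof (cases "I = 0")
        case True
        then show ?thesis using real p by simp
      next
        case False
        define b where "b = I / W"
        have b: "0 < b" using False I W0 by (simp add: b_def)
        have "ennreal (p * b powr (p - 1) * I) \<le> ennreal (R + (p - 1) * b powr p * W)"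
          using tangent[OF b] real I p W b by (simp add: ennreal_mult'[symmetric] ennreal_plus[symmetric] del: ennreal_plus)
        then have 1: "p * b powr (p - 1) * I \<le> R + (p - 1) * b powr p * W"
          using real p W by (subst (asm) ennreal_le_iff) auto
        have "b powr p * W = b powr (p - 1) * (b * W)"
          using b by (simp add: powr_diff)
        also have "b * W = I" using W0 by (simp add: b_def)
        finally have 2: "b powr p * W = b powr (p - 1) * I" .
        have "p * (b powr (p - 1) * I) \<le> R + (p - 1) * (b powr p * W)" using 1 by (simp add: mult.assoc)
        then have 3: "b powr (p - 1) * I \<le> R" unfolding 2 by (simp add: algebra_simps)
        have "I powr p = W powr (p - 1) * (b powr (p - 1) * I)"
        proof -
          have "I powr p = I powr (p - 1) * I" using False I by (simp add: powr_mult_base mult.commute)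
          also have "I powr (p - 1) = (W * b) powr (p - 1)" using W0 by (simp add: b_def)
          also have "\<dots> = W powr (p - 1) * b powr (p - 1)" using W0 b by (simp add: powr_mult)
          finally show ?thesis by simp
        qed
        then show ?thesis using 3 by (simp add: mult_left_mono)
      qed
      then show ?thesis using I real by (simp add: ennreal_mult'[symmetric] del: ennreal_mult)
    qed
  qed
qed

section \<open>Integrals of powers, and quotients of extended reals\<close>

lemma nn_integral_powr_near_0:
  fixes b r :: real
  assumes "0 < b" "0 \<le> r"
  shows "(\<integral>\<^sup>+t. ennreal (indicator {0<..<r} t * t powr (b - 1)) \<partial>lborel) \<le> ennreal (r powr b / b)"
proof -
  have "(\<integral>\<^sup>+t. ennreal (indicator {0<..<r} t * t powr (b - 1)) \<partial>lborel)
      \<le> (\<integral>\<^sup>+t. ennreal (if t \<in> {0..r} then t powr (b - 1) else 0) \<partial>lborel)"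
    by (intro nn_integral_mono ennreal_leI) (auto simp: indicator_def)
  also have "\<dots> = ennreal (r powr b / b)"
    using has_integral_powr_from_0[of "b - 1" r] assms
    by (intro nn_integral_has_integral_lborel) (auto simp only: has_integral_restrict_UNIV, auto)
  finally show ?thesis .
qed

lemma nn_integral_powr_at_top:
  fixes b r :: real
  assumes "0 < b" "0 < r"
  shows "(\<integral>\<^sup>+t. ennreal (indicator {r..} t * t powr (- b - 1)) \<partial>lborel) = ennreal (r powr (- b) / b)"
proof -
  have "(\<integral>\<^sup>+t. ennreal (indicator {r..} t * t powr (- b - 1)) \<partial>lborel)
      = (\<integral>\<^sup>+t. ennreal (if t \<in> {r..} then t powr (- b - 1) else 0) \<partial>lborel)"
    by (intro nn_integral_cong) (auto simp: indicator_def)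
  also have "\<dots> = ennreal (r powr (- b) / b)"
    using has_integral_powr_to_inf[of "- b - 1" r] assms
    by (intro nn_integral_has_integral_lborel) (auto simp only: has_integral_restrict_UNIV, auto)
  finally show ?thesis .
qed

text \<open>For \<open>b = 0\<close> and \<open>b = \<infinity>\<close> the left side is 0. The
  inequality lets the measure of a ball be cancelled without a proof that it is positive.\<close>

lemma ennreal_mult_divide_le: "a * b / b \<le> (a :: ennreal)"
proof -
  have "b * inverse b \<le> 1"
  proof (cases b)
    case (real r)
    then show ?thesis
      by (cases "r = 0") (auto simp: inverse_ennreal ennreal_mult'[symmetric])
  qed simp
  then have "a * (b * inverse b) \<le> a * 1" by (rule mult_left_mono) simp
  then show ?thesis by (simp add: divide_ennreal_def mult.assoc)
qed

lemma inverse_ennreal_antimono: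
  assumes "0 < c" "ennreal c \<le> b" shows "inverse b \<le> inverse (ennreal c)"
proof (cases b)
  case (real r)
  then have "c \<le> r" using assms by simp
  then show ?thesis using real assms by (simp add: inverse_ennreal ennreal_leI le_imp_inverse_le)
qed simp

section \<open>Modulars and mean oscillation\<close>

text \<open>The p-th power of the norm. Estimates are made at this level, where they are plain
  integrals; roots are taken in \<open>besov_norm_potential_le\<close>.\<close>

definition Lp_modular :: "real \<Rightarrow> 'a measure \<Rightarrow> ('a \<Rightarrow> real) \<Rightarrow> ennreal" where
  "Lp_modular p M f = (\<integral>\<^sup>+x. ennreal (\<bar>f x\<bar> powr p) \<partial>M)"

text \<open>For \<nu> = \<mu> this is the p-th power of \<open>besov_E\<close>, see
  \<open>besov_E_eq\<close>. The second measure permits averages over balls with respect to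
  \<open>m\<close> at points chosen by \<mu>.\<close>

definition mean_oscillation ::
    "real \<Rightarrow> 'a::metric_space measure \<Rightarrow> 'a measure \<Rightarrow> ('a \<Rightarrow> real) \<Rightarrow> real \<Rightarrow> ennreal" where
  "mean_oscillation p \<mu> \<nu> u r =
     (\<integral>\<^sup>+x. (\<integral>\<^sup>+y\<in>ball x r. ennreal (\<bar>u y - u x\<bar> powr p) \<partial>\<nu>) / emeasure \<nu> (ball x r) \<partial>\<mu>)"

text \<open>A Schur-type condition: by Tonelli it bounds the passage from a function to its
  \<nu>-means over balls of radius r, from L^1(\<nu>) to L^1(\<mu>). The exponent \<kappa> is the
  difference of the dimensions of \<mu> and \<nu>.\<close>

definition averaging :: "real \<Rightarrow> real \<Rightarrow> 'a::metric_space measure \<Rightarrow> 'a measure \<Rightarrow> bool" where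
  "averaging G \<kappa> \<mu> \<nu> \<longleftrightarrow> 0 \<le> G \<and>
     (\<forall>y r. 0 < r \<longrightarrow> (\<integral>\<^sup>+x\<in>ball y r. inverse (emeasure \<nu> (ball x r)) \<partial>\<mu>) \<le> ennreal (G * r powr \<kappa>))"

lemma Lp_norm_eq: "Lp_norm p M f = enn_powr (Lp_modular p M f) (1 / p)"
  by (simp add: Lp_norm_def Lp_modular_def enn_root_eq)

section \<open>Function spaces modulo null sets\<close>

lemma Lp_space_iff: "g \<in> Lp_space p M \<longleftrightarrow> g \<in> borel_measurable M \<and> Lp_modular p M g < \<infinity>"
  by (simp add: Lp_space_def Lp_norm_eq)

lemma Lp_modular_cong_AE: "AE x in M. f x = g x \<Longrightarrow> Lp_modular p M f = Lp_modular p M g"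
  unfolding Lp_modular_def by (rule nn_integral_cong_AE) auto

lemma mean_oscillation_cong_AE:
  fixes \<mu> :: "'a::metric_space measure"
  assumes eq: "AE x in \<mu>. u x = v x"
  shows "mean_oscillation p \<mu> \<mu> u r = mean_oscillation p \<mu> \<mu> v r"
  unfolding mean_oscillation_def
proof (rule nn_integral_cong_AE, use eq in eventually_elim)
  fix x assume x: "u x = v x"
  have "(\<integral>\<^sup>+y\<in>ball x r. ennreal (\<bar>u y - u x\<bar> powr p) \<partial>\<mu>) = (\<integral>\<^sup>+y\<in>ball x r. ennreal (\<bar>v y - v x\<bar> powr p) \<partial>\<mu>)"
    by (rule nn_integral_cong_AE, use eq in eventually_elim) (simp add: x)
  then show "(\<integral>\<^sup>+y\<in>ball x r. ennreal (\<bar>u y - u x\<bar> powr p) \<partial>\<mu>) / emeasure \<mu> (ball x r)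
      = (\<integral>\<^sup>+y\<in>ball x r. ennreal (\<bar>v y - v x\<bar> powr p) \<partial>\<mu>) / emeasure \<mu> (ball x r)"
    by simp
qed

text \<open>The complement of \<open>F\<close> is a \<mu>-null set, so the restrictions to
  \<open>F\<close> disappear from both integrals and from the measure of the ball.\<close>

lemma besov_E_eq:
  fixes \<mu> :: "'a::metric_space measure"
  assumes sets: "sets \<mu> = sets borel" and F: "closed F" "emeasure \<mu> (- F) = 0"
  shows "besov_E p F \<mu> u t = enn_powr (mean_oscillation p \<mu> \<mu> u t) (1 / p)"
proof -
  have "- F \<in> null_sets \<mu>" using F by (auto simp: null_sets_def sets)
  then have AE: "AE x in \<mu>. x \<in> F" by (rule AE_I') auto
  have "emeasure \<mu> (ball x t \<inter> F) = emeasure \<mu> (ball x t)" for x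
    using F by (intro emeasure_eq_AE) (use AE in \<open>auto simp: sets\<close>)
  moreover have "(\<integral>\<^sup>+y\<in>ball x t \<inter> F. ennreal (\<bar>u y - u x\<bar> powr p) \<partial>\<mu>)
      = (\<integral>\<^sup>+y\<in>ball x t. ennreal (\<bar>u y - u x\<bar> powr p) \<partial>\<mu>)" for x
    by (rule nn_integral_cong_AE, use AE in eventually_elim) (simp add: indicator_def)
  moreover have "(\<integral>\<^sup>+x\<in>F. h x \<partial>\<mu>) = (\<integral>\<^sup>+x. h x \<partial>\<mu>)" for h
    by (rule nn_integral_cong_AE, use AE in eventually_elim) simp
  ultimately show ?thesis
    by (simp add: besov_E_def mean_oscillation_def enn_root_eq)
qed

lemma besov_norm_cong_AE:
  fixes \<mu> :: "'a::metric_space measure"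
  assumes "sets \<mu> = sets borel" "closed F" "emeasure \<mu> (- F) = 0" "AE x in \<mu>. u x = v x"
  shows "besov_norm \<beta> p F \<mu> u = besov_norm \<beta> p F \<mu> v"
  using assms
  by (simp add: besov_norm_def besov_E_eq Lp_norm_eq Lp_modular_cong_AE mean_oscillation_cong_AE)

text \<open>Finiteness is all that matters, so \<open>enn_powr_add3\<close> with third summand 0
  replaces the sharp triangle inequality.\<close>

lemma Lp_space_linear:
  assumes g: "g \<in> Lp_space p M" and h: "h \<in> Lp_space p M" and p: "1 < p"
  shows "(\<lambda>y. a * g y + b * h y) \<in> Lp_space p M"
proof -
  have [measurable]: "g \<in> borel_measurable M" "h \<in> borel_measurable M"
    using g h by (auto simp: Lp_space_iff)
  have "Lp_modular p M (\<lambda>y. a * g y + b * h y)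
      \<le> (\<integral>\<^sup>+y. ennreal (3 powr p) * (ennreal (\<bar>a\<bar> powr p) * ennreal (\<bar>g y\<bar> powr p)
          + ennreal (\<bar>b\<bar> powr p) * ennreal (\<bar>h y\<bar> powr p)) \<partial>M)"
    unfolding Lp_modular_def
  proof (rule nn_integral_mono)
    fix y
    have "\<bar>a * g y + b * h y\<bar> \<le> \<bar>a\<bar> * \<bar>g y\<bar> + \<bar>b\<bar> * \<bar>h y\<bar>"
      by (metis abs_mult abs_triangle_ineq)
    then have "ennreal \<bar>a * g y + b * h y\<bar> \<le> ennreal (\<bar>a\<bar> * \<bar>g y\<bar>) + ennreal (\<bar>b\<bar> * \<bar>h y\<bar>) + 0"
      by (simp add: ennreal_plus[symmetric] ennreal_leI del: ennreal_plus)
    then have "enn_powr (ennreal \<bar>a * g y + b * h y\<bar>) p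
        \<le> enn_powr (ennreal (\<bar>a\<bar> * \<bar>g y\<bar>) + ennreal (\<bar>b\<bar> * \<bar>h y\<bar>) + 0) p"
      using p by (intro enn_powr_mono) auto
    also have "\<dots> \<le> ennreal (3 powr p) * (enn_powr (ennreal (\<bar>a\<bar> * \<bar>g y\<bar>)) p + enn_powr (ennreal (\<bar>b\<bar> * \<bar>h y\<bar>)) p + enn_powr 0 p)"
      using p by (intro enn_powr_add3) auto
    finally show "ennreal (\<bar>a * g y + b * h y\<bar> powr p) \<le> ennreal (3 powr p) * (ennreal (\<bar>a\<bar> powr p) * ennreal (\<bar>g y\<bar> powr p)
          + ennreal (\<bar>b\<bar> powr p) * ennreal (\<bar>h y\<bar> powr p))"
      using p by (simp add: enn_powr_mult ennreal_mult)
  qed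
  also have "\<dots> = ennreal (3 powr p) * (ennreal (\<bar>a\<bar> powr p) * Lp_modular p M g + ennreal (\<bar>b\<bar> powr p) * Lp_modular p M h)"
    by (simp add: nn_integral_cmult nn_integral_add Lp_modular_def)
  also have "\<dots> < \<infinity>" using g h by (simp add: Lp_space_iff ennreal_mult_less_top)
  finally show ?thesis by (simp add: Lp_space_iff)
qed

text \<open>Division by the finite positive \<open>c\<close> brings the factor inside the infimum. A
  bound valid for every density thereby passes to \<open>potential_norm\<close>.\<close>

lemma ennreal_le_mult_INF:
  fixes b :: ennreal
  assumes "0 < c" "\<And>i. i \<in> I \<Longrightarrow> b \<le> ennreal c * f i"
  shows "b \<le> ennreal c * (INF i\<in>I. f i)"
proof -
  have "b / ennreal c \<le> (INF i\<in>I. f i)"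
    using assms by (intro INF_greatest divide_le_posI_ennreal) auto
  then have "ennreal c * (b / ennreal c) \<le> ennreal c * (INF i\<in>I. f i)"
    by (rule mult_left_mono) simp
  moreover have "ennreal c * (b / ennreal c) = b"
    using assms(1) mult_divide_eq_ennreal[of "ennreal c" b]
    by (simp add: ennreal_times_divide mult.commute)
  ultimately show ?thesis by simp
qed

section \<open>Ball averages on a regular space\<close>

text \<open>In contrast to \<open>ahlfors_regular\<close> on \<open>F\<close>, the centres range
  over the whole space and the radii are unbounded; \<open>ahlfors_regular_subset_bounds\<close>
  supplies the passage.\<close>

definition upper_regular :: "real \<Rightarrow> real \<Rightarrow> 'a::metric_space measure \<Rightarrow> bool" where
  "upper_regular \<eta> D \<mu> \<longleftrightarrow> sets \<mu> = sets borel \<and> 0 \<le> D \<and>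
     (\<forall>x r. 0 < r \<longrightarrow> emeasure \<mu> (ball x r) \<le> ennreal (D * r powr \<eta>))"

lemma upper_regularD:
  assumes "upper_regular \<eta> D \<mu>"
  shows "sets \<mu> = sets borel" "0 \<le> D" "0 < r \<Longrightarrow> emeasure \<mu> (ball x r) \<le> ennreal (D * r powr \<eta>)"
  using assms by (auto simp: upper_regular_def)

lemma upper_regular_ball_finite:
  assumes "upper_regular \<eta> D \<mu>" shows "emeasure \<mu> (ball x r) < \<infinity>"
proof (cases "0 < r")
  case True
  then show ?thesis using upper_regularD(3)[OF assms, of r x] by (auto intro: le_less_trans)
qed (use ball_eq_empty[of x r] in \<open>simp del: ball_eq_empty\<close>)

lemma upper_regular_sigma_finite:
  assumes "upper_regular \<eta> D \<mu>" shows "sigma_finite_measure \<mu>"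
proof
  define A where "A = range (\<lambda>n::nat. ball (undefined::'a) (real n))"
  have "\<Union>A = UNIV"
    unfolding A_def using reals_Archimedean2 by fastforce
  moreover have "\<forall>a\<in>A. emeasure \<mu> a \<noteq> \<infinity>"
    unfolding A_def using upper_regular_ball_finite[OF assms] by (auto simp: less_top[symmetric])
  moreover have "space \<mu> = UNIV"
    using sets_eq_imp_space_eq[OF upper_regularD(1)[OF assms]] by simp
  moreover have "countable A" "A \<subseteq> sets \<mu>"
    unfolding A_def by (auto simp: upper_regularD(1)[OF assms])
  ultimately show "\<exists>A. countable A \<and> A \<subseteq> sets \<mu> \<and> \<Union>A = space \<mu> \<and> (\<forall>a\<in>A. emeasure \<mu> a \<noteq> \<infinity>)"
    by auto
qed

locale regular_space =
  fixes m :: "'a::metric_space measure" and N C :: real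
  assumes m_sets: "sets m = sets borel"
    and N_pos: "0 < N" and C_ge: "1 \<le> C"
    and m_low: "0 < r \<Longrightarrow> ennreal (r powr N / C) \<le> emeasure m (ball x r)"
    and m_up: "0 < r \<Longrightarrow> emeasure m (ball x r) \<le> ennreal (C * r powr N)"
begin

text \<open>A piecewise linear profile makes the facts on \<open>m\<close> from the construction
  available: \<sigma>-finiteness, a countable dense set and measurability of the distance.\<close>

sublocale cut: coifman_construction m N C "\<lambda>u. max 0 (min 1 (2 - u))" 1
  using m_sets N_pos C_ge m_low m_up by unfold_locales auto

lemma upper_regular_m: "upper_regular N C m"
  using m_sets C_ge m_up by (auto simp: upper_regular_def)

section \<open>Joint measurability\<close>

text \<open>Measurability on a product depends only on the \<sigma>-algebras of the factors, so the
  result for \<open>m\<close> transfers to any two Borel measures.\<close>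

lemma borel_measurable_dist_pair:
  fixes \<mu> \<nu> :: "'a measure"
  assumes "sets \<mu> = sets borel" "sets \<nu> = sets borel"
  shows "(\<lambda>w. dist (fst w) (snd w)) \<in> borel_measurable (\<mu> \<Otimes>\<^sub>M \<nu>)"
proof -
  have "(borel_measurable (\<mu> \<Otimes>\<^sub>M \<nu>) :: ('a \<times> 'a \<Rightarrow> real) set) = borel_measurable (m \<Otimes>\<^sub>M m)"
    by (intro measurable_cong_sets sets_pair_measure_cong) (simp_all add: assms m_sets)
  then show ?thesis using cut.measurable_dist by blast
qed

lemma borel_measurable_dist [measurable (raw)]:
  assumes "f \<in> measurable M borel" "g \<in> measurable M (borel :: 'a measure)"
  shows "(\<lambda>x. dist (f x) (g x)) \<in> borel_measurable M"
proof -
  have "(\<lambda>x. (f x, g x)) \<in> measurable M (borel \<Otimes>\<^sub>M borel)"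
    using assms by measurable
  from measurable_compose[OF this borel_measurable_dist_pair[OF refl refl]] show ?thesis by simp
qed

text \<open>Approximate \<open>x\<close> by a point of a countable dense set which depends measurably on \<open>x\<close>.\<close>

lemma borel_measurable_Caratheodory:
  fixes f :: "'a \<Rightarrow> 'b \<Rightarrow> real"
  assumes cont: "\<And>w. w \<in> space M \<Longrightarrow> continuous_on UNIV (\<lambda>x. f x w)"
    and meas [measurable]: "\<And>x. f x \<in> borel_measurable M"
  shows "(\<lambda>z. f (fst z) (snd z)) \<in> borel_measurable (borel \<Otimes>\<^sub>M M)"
proof -
  obtain D :: "'a set" where D: "countable D" "\<And>x e. 0 < e \<Longrightarrow> \<exists>q\<in>D. dist x q < e"
    using cut.countable_dense by metis
  have "D \<noteq> {}" using D(2)[of 1] by auto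
  define d where "d = from_nat_into D"
  have d: "\<exists>i. dist x (d i) < e" if "0 < e" for x e
    using D(2)[OF that, of x] from_nat_into_surj[OF D(1)] unfolding d_def by metis
  \<comment> \<open>Taking the least index makes the choice a measurable map into the natural
    numbers, so each approximant is measurable as a countable composition.\<close>
  define l where "l n x = (LEAST i. dist x (d i) < 1 / real (Suc n))" for n x
  have l: "dist x (d (l n x)) < 1 / real (Suc n)" for n x
    unfolding l_def by (rule LeastI_ex[OF d]) simp
  have [measurable]: "l n \<in> measurable borel (count_space UNIV)" for n
    unfolding l_def by measurable
  have *: "(\<lambda>z. f (d (l n (fst z))) (snd z)) \<in> borel_measurable (borel \<Otimes>\<^sub>M M)" for n
    by (rule measurable_compose_countable[where f="\<lambda>i z. f (d i) (snd z)"]) measurable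
  show ?thesis
  proof (rule borel_measurable_LIMSEQ_metric[OF *])
    fix z assume z: "z \<in> space ((borel :: 'a measure) \<Otimes>\<^sub>M M)"
    have "(\<lambda>n. dist (fst z) (d (l n (fst z)))) \<longlonglongrightarrow> 0"
      by (rule tendsto_sandwich[OF _ _ tendsto_const LIMSEQ_inverse_real_of_nat])
         (use l in \<open>auto simp: inverse_eq_divide intro!: always_eventually less_imp_le\<close>)
    then have "(\<lambda>n. d (l n (fst z))) \<longlonglongrightarrow> fst z"
      by (simp add: tendsto_dist_iff[of _ "fst z"] dist_commute)
    moreover have "isCont (\<lambda>x. f x (snd z)) (fst z)"
      using cont[of "snd z"] z by (auto simp: space_pair_measure continuous_on_eq_continuous_at)
    ultimately show "(\<lambda>n. f (d (l n (fst z))) (snd z)) \<longlonglongrightarrow> f (fst z) (snd z)"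
      by (rule isCont_tendsto_compose[rotated])
  qed
qed

section \<open>Averages over balls of all scales\<close>

definition ball_kernel :: "(real \<Rightarrow> real) \<Rightarrow> real \<Rightarrow> 'a \<Rightarrow> 'a \<times> real \<Rightarrow> real" where
  "ball_kernel c A x z = indicator {0<..} (snd z) * c (snd z) * snd z powr (- N) *
     indicator (ball x (A * snd z)) (fst z)"

text \<open>The pair \<open>z\<close> consists of a point y and a scale t. Since m(B(x, A t)) is
  comparable to \<open>t powr N\<close>, this is up to constants the integral over t > 0 of
  \<open>c t\<close> times the mean of \<bar>g\<bar> over \<open>ball x (A * t)\<close>.\<close>

definition ball_averages :: "(real \<Rightarrow> real) \<Rightarrow> real \<Rightarrow> ('a \<Rightarrow> real) \<Rightarrow> 'a \<Rightarrow> ennreal" where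
  "ball_averages c A g x = (\<integral>\<^sup>+z. ennreal (\<bar>g (fst z)\<bar> * ball_kernel c A x z) \<partial>(m \<Otimes>\<^sub>M lborel))"

sublocale pair_lborel: pair_sigma_finite m lborel
  by (simp add: pair_sigma_finite_def cut.sigma_finite_m sigma_finite_lborel)

lemma ball_kernel_nonneg:
  "(\<And>t. 0 < t \<Longrightarrow> 0 \<le> c t) \<Longrightarrow> 0 \<le> ball_kernel c A x z"
  by (auto simp: ball_kernel_def indicator_def)

text \<open>The form with composed maps covers joint measurability in x, y and t, as needed for
  integrals in which any of them is a parameter.\<close>

lemma ball_kernel_measurable [measurable (raw)]:
  assumes [measurable]: "f \<in> measurable M borel" "h \<in> measurable M m" "k \<in> borel_measurable M"
    "c \<in> borel_measurable borel"
  shows "(\<lambda>w. ball_kernel c A (f w) (h w, k w)) \<in> borel_measurable M"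
proof -
  have [measurable]: "h \<in> measurable M borel"
    using assms(2) measurable_cong_sets[OF refl m_sets] by blast
  have "(\<lambda>w. if 0 < k w \<and> dist (f w) (h w) < A * k w then c (k w) * k w powr (- N) else 0) \<in> borel_measurable M"
    by measurable
  then show ?thesis
    by (rule measurable_cong[THEN iffD1, rotated]) (auto simp: ball_kernel_def indicator_def)
qed

lemma ball_kernel_measurable_pair [measurable]:
  assumes [measurable]: "c \<in> borel_measurable borel"
  shows "ball_kernel c A x \<in> borel_measurable (m \<Otimes>\<^sub>M lborel)"
proof -
  have "(\<lambda>z. ball_kernel c A x (fst z, snd z)) \<in> borel_measurable (m \<Otimes>\<^sub>M lborel)" by measurable
  then show ?thesis by simp
qed

lemma ball_averages_measurable [measurable]:
  assumes [measurable]: "g \<in> borel_measurable m" "c \<in> borel_measurable borel"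
  shows "ball_averages c A g \<in> borel_measurable borel"
proof -
  have "(\<lambda>x. \<integral>\<^sup>+z. ennreal (\<bar>g (fst z)\<bar> * ball_kernel c A x (fst z, snd z)) \<partial>(m \<Otimes>\<^sub>M lborel)) \<in> borel_measurable borel"
    by measurable
  then show ?thesis unfolding ball_averages_def[abs_def] by simp
qed

text \<open>A power of t is moved from \<bar>g\<bar> to the kernel before the power mean inequality
  is applied. Tonelli then integrates over x first, and \<mu>(B(y, A t)) supplies exactly the power
  of t that cancels the others.\<close>

lemma ball_averages_bound:
  assumes \<mu>: "upper_regular \<eta> D \<mu>"
    and [measurable]: "g \<in> borel_measurable m" "c \<in> borel_measurable borel"
    and c: "\<And>t. 0 < t \<Longrightarrow> 0 \<le> c t" and A: "0 < A" and p: "1 < p" and z: "0 \<le> z"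
    and cz: "(\<integral>\<^sup>+t. ennreal (indicator {0<..} t * c t * t powr ((\<eta> - N) / p)) \<partial>lborel) \<le> ennreal z"
  shows "(\<integral>\<^sup>+x. enn_powr (ball_averages c A g x) p \<partial>\<mu>)
    \<le> ennreal ((C * A powr N) powr (p - 1) * D * A powr \<eta> * z powr p) * (\<integral>\<^sup>+y. ennreal (\<bar>g y\<bar> powr p) \<partial>m)"
proof -
  note [measurable_cong] = upper_regularD(1)[OF \<mu>]
  have space: "space \<mu> = UNIV" "space m = UNIV"
    using sets_eq_imp_space_eq[OF upper_regularD(1)[OF \<mu>]] sets_eq_imp_space_eq[OF m_sets] by simp_all
  interpret \<mu>: sigma_finite_measure \<mu> by (rule upper_regular_sigma_finite[OF \<mu>])
  interpret \<mu>z: pair_sigma_finite \<mu> "m \<Otimes>\<^sub>M lborel" ..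
  have D: "0 \<le> D" using \<mu> by (rule upper_regularD)
  \<comment> \<open>At scale t the means of g have norm of order
    \<open>t powr ((\<eta> - N) / p)\<close> in L^p(\<mu>). Dividing by this factor balances the
    scales.\<close>
  define B where "B t = t powr ((\<eta> - N) / p)" for t :: real
  define b where "b t = indicator {0<..} t * c t * B t" for t :: real
  have b_nonneg: "0 \<le> b t" for t using c by (auto simp: b_def B_def indicator_def)
  have [measurable]: "B \<in> borel_measurable borel" unfolding B_def by measurable
  have [measurable]: "b \<in> borel_measurable borel" unfolding b_def by measurable
  define f where "f z = \<bar>g (fst z)\<bar> / B (snd z)" for z
  define k where "k x z = ball_kernel c A x z * B (snd z)" for x z
  have [measurable]: "f \<in> borel_measurable (m \<Otimes>\<^sub>M lborel)" unfolding f_def by measurable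
  have [measurable]: "k x \<in> borel_measurable (m \<Otimes>\<^sub>M lborel)" for x unfolding k_def by measurable
  have f_nonneg: "0 \<le> f z" for z by (simp add: f_def B_def)
  have k_nonneg: "0 \<le> k x z" for x z
    using ball_kernel_nonneg[of c] c by (simp add: k_def B_def)
  have k_eq: "k x z = b (snd z) * snd z powr (- N) * indicator (ball x (A * snd z)) (fst z)" for x z
    by (simp add: k_def ball_kernel_def b_def)
  \<comment> \<open>The kernel vanishes at nonpositive scales, so the default value of the quotient
    by \<open>B\<close> is harmless there.\<close>
  have fk: "f z * k x z = \<bar>g (fst z)\<bar> * ball_kernel c A x z" for x z
    by (auto simp: f_def k_def ball_kernel_def B_def indicator_def)
  define W where "W = C * A powr N * z"
  have W: "0 \<le> W" using C_ge z by (simp add: W_def)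
  have kW: "(\<integral>\<^sup>+z. ennreal (k x z) \<partial>(m \<Otimes>\<^sub>M lborel)) \<le> ennreal W" for x
  proof -
    have "(\<integral>\<^sup>+z. ennreal (k x z) \<partial>(m \<Otimes>\<^sub>M lborel)) = (\<integral>\<^sup>+t. \<integral>\<^sup>+y. ennreal (k x (y, t)) \<partial>m \<partial>lborel)"
      by (rule pair_lborel.nn_integral_snd[symmetric]) measurable
    also have "\<dots> \<le> (\<integral>\<^sup>+t. ennreal (C * A powr N) * ennreal (b t) \<partial>lborel)"
    proof (rule nn_integral_mono)
      fix t :: real
      show "(\<integral>\<^sup>+y. ennreal (k x (y, t)) \<partial>m) \<le> ennreal (C * A powr N) * ennreal (b t)"
      proof (cases "0 < t")
        case True
        have "(\<integral>\<^sup>+y. ennreal (k x (y, t)) \<partial>m) = (\<integral>\<^sup>+y. ennreal (b t * t powr (- N)) * indicator (ball x (A * t)) y \<partial>m)"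
          using b_nonneg by (intro nn_integral_cong) (auto simp: k_eq indicator_def)
        also have "\<dots> = ennreal (b t * t powr (- N)) * emeasure m (ball x (A * t))"
          by (simp add: nn_integral_cmult_indicator)
        also have "\<dots> \<le> ennreal (b t * t powr (- N)) * ennreal (C * (A * t) powr N)"
          using A True by (intro mult_left_mono m_up) auto
        also have "\<dots> = ennreal (C * A powr N) * ennreal (b t)"
          using A True b_nonneg C_ge
          by (simp add: ennreal_mult'[symmetric] powr_mult powr_minus field_simps)
        finally show ?thesis .
      qed (simp add: k_eq b_def)
    qed
    also have "\<dots> = ennreal (C * A powr N) * (\<integral>\<^sup>+t. ennreal (b t) \<partial>lborel)"
      by (rule nn_integral_cmult) measurable
    also have "\<dots> \<le> ennreal (C * A powr N) * ennreal z"
      using cz by (intro mult_left_mono) (simp_all add: b_def B_def)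
    also have "\<dots> = ennreal W" using C_ge z by (simp add: W_def ennreal_mult'[symmetric])
    finally show ?thesis .
  qed
  have fpk_meas: "(\<lambda>w. ennreal (f (snd w) powr p * k (fst w) (snd w))) \<in> borel_measurable (\<mu> \<Otimes>\<^sub>M (m \<Otimes>\<^sub>M lborel))"
  proof -
    have "(\<lambda>w. ennreal (f (snd w) powr p * (ball_kernel c A (fst w) (fst (snd w), snd (snd w)) * B (snd (snd w)))))
        \<in> borel_measurable (\<mu> \<Otimes>\<^sub>M (m \<Otimes>\<^sub>M lborel))"
      by measurable
    then show ?thesis by (simp add: k_def)
  qed
  have inner: "(\<integral>\<^sup>+x. ennreal (f z powr p * k x z) \<partial>\<mu>)
      \<le> ennreal (D * A powr \<eta>) * (ennreal (\<bar>g (fst z)\<bar> powr p) * ennreal (b (snd z)))" for z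
  proof (cases "0 < snd z")
    case True
    define t where "t = snd z"
    have t: "0 < t" using True by (simp add: t_def)
    have "(\<integral>\<^sup>+x. ennreal (f z powr p * k x z) \<partial>\<mu>)
        = (\<integral>\<^sup>+x. ennreal (f z powr p * b t * t powr (- N)) * indicator (ball (fst z) (A * t)) x \<partial>\<mu>)"
      by (intro nn_integral_cong) (auto simp: k_eq t_def indicator_def dist_commute mult.assoc)
    also have "\<dots> = ennreal (f z powr p * b t * t powr (- N)) * emeasure \<mu> (ball (fst z) (A * t))"
      by (intro nn_integral_cmult_indicator) (simp add: upper_regularD(1)[OF \<mu>])
    also have "\<dots> \<le> ennreal (f z powr p * b t * t powr (- N)) * ennreal (D * (A * t) powr \<eta>)"
      using A t by (intro mult_left_mono upper_regularD(3)[OF \<mu>]) auto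
    also have "\<dots> = ennreal (f z powr p * b t * t powr (- N) * (D * (A * t) powr \<eta>))"
      using b_nonneg D by (intro ennreal_mult'[symmetric]) auto
    also have "f z powr p * b t * t powr (- N) * (D * (A * t) powr \<eta>) = D * A powr \<eta> * (\<bar>g (fst z)\<bar> powr p * b t)"
    proof -
      have "f z powr p = \<bar>g (fst z)\<bar> powr p * t powr (N - \<eta>)"
      proof -
        have "B t powr p = t powr (\<eta> - N)" using p by (simp add: B_def powr_powr)
        then have "f z powr p = \<bar>g (fst z)\<bar> powr p / t powr (\<eta> - N)"
          using p by (simp add: f_def t_def[symmetric] powr_divide)
        also have "\<dots> = \<bar>g (fst z)\<bar> powr p * t powr (N - \<eta>)"
          using powr_minus_divide[of t "\<eta> - N"] by simp
        finally show ?thesis .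
      qed
      moreover have "t powr (N - \<eta>) * t powr (- N) * t powr \<eta> = 1"
        using t by (simp add: powr_add[symmetric])
      moreover have "(A * t) powr \<eta> = A powr \<eta> * t powr \<eta>" using A t by (simp add: powr_mult)
      ultimately show ?thesis
        by (metis (no_types, opaque_lifting) mult.assoc mult.commute mult_1)
    qed
    also have "ennreal \<dots> = ennreal (D * A powr \<eta>) * (ennreal (\<bar>g (fst z)\<bar> powr p) * ennreal (b t))"
      using D b_nonneg by (simp add: ennreal_mult)
    finally show ?thesis by (simp add: t_def)
  qed (simp add: k_eq b_def)
  have "(\<integral>\<^sup>+x. (\<integral>\<^sup>+z. ennreal (f z powr p * k x z) \<partial>(m \<Otimes>\<^sub>M lborel)) \<partial>\<mu>)
      = (\<integral>\<^sup>+z. (\<integral>\<^sup>+x. ennreal (f z powr p * k x z) \<partial>\<mu>) \<partial>(m \<Otimes>\<^sub>M lborel))"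
    using \<mu>z.nn_integral_snd[OF fpk_meas] pair_lborel.P.nn_integral_fst[OF fpk_meas] by simp
  also have "\<dots> \<le> (\<integral>\<^sup>+z. ennreal (D * A powr \<eta>) * (ennreal (\<bar>g (fst z)\<bar> powr p) * ennreal (b (snd z))) \<partial>(m \<Otimes>\<^sub>M lborel))"
    by (intro nn_integral_mono inner)
  also have "\<dots> = ennreal (D * A powr \<eta>) * (\<integral>\<^sup>+z. ennreal (\<bar>g (fst z)\<bar> powr p) * ennreal (b (snd z)) \<partial>(m \<Otimes>\<^sub>M lborel))"
    by (rule nn_integral_cmult) measurable
  finally have outer: "(\<integral>\<^sup>+x. (\<integral>\<^sup>+z. ennreal (f z powr p * k x z) \<partial>(m \<Otimes>\<^sub>M lborel)) \<partial>\<mu>) \<le> \<dots>" .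
  have "(\<integral>\<^sup>+z. ennreal (\<bar>g (fst z)\<bar> powr p) * ennreal (b (snd z)) \<partial>(m \<Otimes>\<^sub>M lborel))
      = (\<integral>\<^sup>+y. \<integral>\<^sup>+t. ennreal (\<bar>g y\<bar> powr p) * ennreal (b t) \<partial>lborel \<partial>m)"
    by (subst sigma_finite_measure.nn_integral_fst[OF sigma_finite_lborel, symmetric]) simp_all
  also have "\<dots> = (\<integral>\<^sup>+y. ennreal (\<bar>g y\<bar> powr p) * (\<integral>\<^sup>+t. ennreal (b t) \<partial>lborel) \<partial>m)"
    by (intro nn_integral_cong nn_integral_cmult) measurable
  also have "\<dots> = (\<integral>\<^sup>+y. ennreal (\<bar>g y\<bar> powr p) \<partial>m) * (\<integral>\<^sup>+t. ennreal (b t) \<partial>lborel)"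
    by (rule nn_integral_multc) measurable
  also have "\<dots> \<le> (\<integral>\<^sup>+y. ennreal (\<bar>g y\<bar> powr p) \<partial>m) * ennreal z"
    using cz by (intro mult_left_mono) (simp_all add: b_def B_def)
  finally have split: "(\<integral>\<^sup>+z. ennreal (\<bar>g (fst z)\<bar> powr p) * ennreal (b (snd z)) \<partial>(m \<Otimes>\<^sub>M lborel)) \<le> \<dots>" .
  have "(\<integral>\<^sup>+x. enn_powr (ball_averages c A g x) p \<partial>\<mu>)
      \<le> (\<integral>\<^sup>+x. ennreal (W powr (p - 1)) * (\<integral>\<^sup>+z. ennreal (f z powr p * k x z) \<partial>(m \<Otimes>\<^sub>M lborel)) \<partial>\<mu>)"
    unfolding ball_averages_def fk[symmetric]
    by (intro nn_integral_mono nn_integral_weighted_power_mean f_nonneg k_nonneg p W kW) measurable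
  also have "\<dots> = ennreal (W powr (p - 1)) * (\<integral>\<^sup>+x. (\<integral>\<^sup>+z. ennreal (f z powr p * k x z) \<partial>(m \<Otimes>\<^sub>M lborel)) \<partial>\<mu>)"
    by (rule nn_integral_cmult) (use pair_lborel.P.borel_measurable_nn_integral_fst[OF fpk_meas] in simp)
  also have "\<dots> \<le> ennreal (W powr (p - 1)) * (ennreal (D * A powr \<eta>) * ((\<integral>\<^sup>+y. ennreal (\<bar>g y\<bar> powr p) \<partial>m) * ennreal z))"
    by (intro mult_left_mono order_trans[OF outer] split) auto
  also have "\<dots> = ennreal (W powr (p - 1) * (D * A powr \<eta>) * z) * (\<integral>\<^sup>+y. ennreal (\<bar>g y\<bar> powr p) \<partial>m)"
    using D z by (simp add: ennreal_mult mult_ac)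
  \<comment> \<open>The mass of the kernel contributes \<open>z powr (p - 1)\<close> and the
    integration over scales one more factor \<open>z\<close>.\<close>
  also have "W powr (p - 1) * (D * A powr \<eta>) * z = (C * A powr N) powr (p - 1) * D * A powr \<eta> * z powr p"
  proof -
    have "W powr (p - 1) = (C * A powr N) powr (p - 1) * z powr (p - 1)"
      using z C_ge by (simp add: W_def powr_mult)
    moreover have "z powr (p - 1) * z = z powr p"
      using z by (cases "z = 0") (auto simp: powr_diff)
    ultimately show ?thesis by (simp add: mult_ac)
  qed
  finally show ?thesis .
qed

end

section \<open>Potentials\<close>

locale potential_theory = regular_space m N C
  for m :: "'a::metric_space measure" and N C :: real +
  fixes s :: "'a \<Rightarrow> 'a \<Rightarrow> real \<Rightarrow> real" and \<alpha> Cs :: real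
  assumes \<alpha>_pos: "0 < \<alpha>" and Cs_pos: "0 < Cs"
    and s_symm: "0 < t \<Longrightarrow> s x y t = s y x t"
    and s_nonneg: "0 < t \<Longrightarrow> 0 \<le> s x y t"
    and s_cont: "continuous_on {0<..} (s x y)"
    and s_le: "0 < t \<Longrightarrow> s x y t \<le> Cs / t powr N"
    and s_support: "0 < t \<Longrightarrow> Cs * t < dist x y \<Longrightarrow> s x y t = 0"
    and s_lip: "0 < t \<Longrightarrow> \<bar>s x y t - s x' y t\<bar> \<le> Cs * dist x x' / t powr (N + 1)"
begin

section \<open>Scale weights and the integrand on points and scales\<close>

text \<open>The scale density in \<open>potential_kernel\<close>, with the factor 1/t of the measure
  dt/t included.\<close>

definition weight :: "real \<Rightarrow> real" where
  "weight t = \<alpha> * t powr \<alpha> / (1 + t powr \<alpha>)\<^sup>2 / t"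

definition weight_low :: "real \<Rightarrow> real \<Rightarrow> real" where
  "weight_low r t = indicator {..<r} t * weight t"

text \<open>The factor r/t is the gain of the Lipschitz bound over the size bound for two points at
  distance less than r.\<close>

definition weight_high :: "real \<Rightarrow> real \<Rightarrow> real" where
  "weight_high r t = indicator {r..} t * (r * weight t / t)"

definition integrand :: "'a \<Rightarrow> 'a \<times> real \<Rightarrow> real" where
  "integrand x z = indicator {0<..} (snd z) * (weight (snd z) * s x (fst z) (snd z))"

text \<open>The surplus 2 places the support of \<open>s x y t\<close> in y inside an open ball
  about x, and also that of \<open>s x' y t\<close> when dist x x' < r \<le> t.\<close>

definition dilation :: real where "dilation = Cs + 2"

lemma dilation_pos: "0 < dilation" using Cs_pos by (simp add: dilation_def)

lemma weight_nonneg: "0 < t \<Longrightarrow> 0 \<le> weight t"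
  using \<alpha>_pos by (simp add: weight_def)

lemma weight_low_nonneg: "0 < t \<Longrightarrow> 0 \<le> weight_low r t"
  using weight_nonneg by (simp add: weight_low_def)

lemma weight_high_nonneg: "0 < r \<Longrightarrow> 0 < t \<Longrightarrow> 0 \<le> weight_high r t"
  using weight_nonneg by (simp add: weight_high_def)

lemma weight_measurable [measurable]: "weight \<in> borel_measurable borel"
  unfolding weight_def by measurable

lemma weight_low_measurable [measurable]: "weight_low r \<in> borel_measurable borel"
  unfolding weight_low_def by measurable

lemma weight_high_measurable [measurable]: "weight_high r \<in> borel_measurable borel"
  unfolding weight_high_def by measurable

lemma s_continuous: "0 < t \<Longrightarrow> continuous_on UNIV (\<lambda>x. s x y t)"
proof -
  assume t: "0 < t"
  have "(Cs / t powr (N + 1))-lipschitz_on UNIV (\<lambda>x. s x y t)"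
    using s_lip[OF t] Cs_pos by (intro lipschitz_onI) (auto simp: dist_real_def)
  then show ?thesis by (rule lipschitz_on_continuous_on)
qed

text \<open>Extended by zero to t \<le> 0, the kernel is Lipschitz in x, hence by symmetry in y, and
  measurable in t. Two applications of \<open>borel_measurable_Caratheodory\<close> yield joint
  measurability.\<close>

lemma integrand_measurable [measurable (raw)]:
  assumes f: "f \<in> measurable M borel" and h: "h \<in> measurable M m" and k: "k \<in> borel_measurable M"
  shows "(\<lambda>w. integrand (f w) (h w, k w)) \<in> borel_measurable M"
proof -
  let ?s = "\<lambda>x y t. indicator {0<..} t * s x y t"
  have "continuous_on UNIV (\<lambda>x. ?s x y t)" for y t
    by (cases "0 < t") (auto intro: s_continuous)
  note x = this
  have y: "continuous_on UNIV (\<lambda>y. ?s x y t)" for x t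
  proof (cases "0 < t")
    case True
    have "continuous_on UNIV (\<lambda>y. s x y t)"
      using s_continuous[OF True, of x] by (rule continuous_on_eq) (rule s_symm[OF True])
    then show ?thesis using True by simp
  qed simp
  have t: "(\<lambda>t. ?s x y t) \<in> borel_measurable borel" for x y
    using borel_measurable_continuous_on_indicator[OF _ s_cont[of x y]] by simp
  have "(\<lambda>z. ?s x (fst z) (snd z)) \<in> borel_measurable (borel \<Otimes>\<^sub>M borel)" for x
    by (rule borel_measurable_Caratheodory) (use y t in auto)
  then have "(\<lambda>w. ?s (fst w) (fst (snd w)) (snd (snd w))) \<in> borel_measurable (borel \<Otimes>\<^sub>M (borel \<Otimes>\<^sub>M borel))"
    by (rule borel_measurable_Caratheodory[where f="\<lambda>x z. ?s x (fst z) (snd z)", rotated]) (use x in auto)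
  moreover have "(\<lambda>w. (f w, (h w, k w))) \<in> measurable M (borel \<Otimes>\<^sub>M (borel \<Otimes>\<^sub>M borel))"
    using f k h measurable_cong_sets[OF refl m_sets, of M] by (intro measurable_Pair) auto
  ultimately have "(\<lambda>w. ?s (fst (f w, h w, k w)) (fst (snd (f w, h w, k w))) (snd (snd (f w, h w, k w)))) \<in> borel_measurable M"
    by (rule measurable_compose[rotated])
  then have [measurable]: "(\<lambda>w. ?s (f w) (h w) (k w)) \<in> borel_measurable M"
    by (simp only: fst_conv snd_conv)
  note [measurable] = k
  have "(\<lambda>w. weight (k w) * ?s (f w) (h w) (k w)) \<in> borel_measurable M" by measurable
  then show ?thesis by (simp add: integrand_def mult_ac)
qed

lemma integrand_measurable_pair [measurable]: "integrand x \<in> borel_measurable (m \<Otimes>\<^sub>M lborel)"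
proof -
  have "(\<lambda>z. integrand x (fst z, snd z)) \<in> borel_measurable (m \<Otimes>\<^sub>M lborel)" by measurable
  then show ?thesis by simp
qed

section \<open>The potential as a double integral\<close>

text \<open>A constant factor can be moved into a Bochner integral without integrability, so the
  identity holds at every x, even where the double integral diverges. Measurability of the potential
  follows.\<close>

lemma potential_eq_iterated: "potential m s \<alpha> g x = (\<integral>y. (\<integral>t. g y * integrand x (y, t) \<partial>lborel) \<partial>m)"
proof -
  have "potential_kernel s \<alpha> x y = (\<integral>t. integrand x (y, t) \<partial>lborel)" for y
    unfolding potential_kernel_def set_lebesgue_integral_def
    by (intro Bochner_Integration.integral_cong) (auto simp: integrand_def weight_def)
  then show ?thesis by (simp add: potential_def)
qed

lemma potential_measurable [measurable]:
  assumes [measurable]: "g \<in> borel_measurable m"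
  shows "potential m s \<alpha> g \<in> borel_measurable borel"
proof -
  have "(\<lambda>x. \<integral>y. (\<integral>t. g y * integrand x (y, t) \<partial>lborel) \<partial>m) \<in> borel_measurable borel"
    by measurable
  then show ?thesis by (subst measurable_cong[OF potential_eq_iterated])
qed

lemma s_le_ball:
  assumes t: "0 < t" shows "s x y t \<le> Cs * (t powr (- N) * indicator (ball x (dilation * t)) y)"
proof (cases "Cs * t < dist x y")
  case True
  then show ?thesis using s_support[OF t True] Cs_pos by simp
next
  case False
  then have "y \<in> ball x (dilation * t)" using t by (simp add: dilation_def algebra_simps)
  then show ?thesis using s_le[OF t, of x y] by (simp add: powr_minus divide_inverse)
qed

lemma integrand_nonneg: "0 \<le> integrand x z"
  using weight_nonneg s_nonneg by (auto simp: integrand_def indicator_def)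

lemma integrand_le: "integrand x z \<le> Cs * ball_kernel weight dilation x z"
proof (cases "0 < snd z")
  case True
  have "weight (snd z) * s x (fst z) (snd z)
      \<le> weight (snd z) * (Cs * (snd z powr (- N) * indicator (ball x (dilation * snd z)) (fst z)))"
    using weight_nonneg s_le_ball True by (intro mult_left_mono) auto
  then show ?thesis using True by (simp add: integrand_def ball_kernel_def mult_ac)
qed (simp add: integrand_def ball_kernel_def)

text \<open>Below scale r the two integrands are estimated separately by size. From scale r on the
  Lipschitz bound gives the factor r/t, and one enlarged ball about x contains both
  supports.\<close>

lemma integrand_diff_le:
  assumes r: "dist x x' < r"
  shows "\<bar>integrand x z - integrand x' z\<bar> \<le> Cs * (ball_kernel (weight_low r) dilation x z +
     ball_kernel (weight_low r) dilation x' z + ball_kernel (weight_high r) dilation x z)"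
proof (cases "0 < snd z")
  case True
  define y t where "y = fst z" and "t = snd z"
  have t: "0 < t" using True by (simp add: t_def)
  have r0: "0 < r" using r by (rule le_less_trans[OF zero_le_dist])
  show ?thesis
  proof (cases "t < r")
    case True
    have "\<bar>integrand x z - integrand x' z\<bar> \<le> integrand x z + integrand x' z"
      using integrand_nonneg[of x z] integrand_nonneg[of x' z] by linarith
    also have "\<dots> \<le> Cs * ball_kernel weight dilation x z + Cs * ball_kernel weight dilation x' z"
      by (intro add_mono integrand_le)
    also have "\<dots> = Cs * (ball_kernel (weight_low r) dilation x z + ball_kernel (weight_low r) dilation x' z)"
      using True by (simp add: ball_kernel_def weight_low_def t_def[symmetric] algebra_simps)
    also have "\<dots> \<le> Cs * (ball_kernel (weight_low r) dilation x z +
        ball_kernel (weight_low r) dilation x' z + ball_kernel (weight_high r) dilation x z)"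
      using Cs_pos ball_kernel_nonneg[of "weight_high r" dilation x z] weight_high_nonneg[OF r0]
      by (intro mult_left_mono) auto
    finally show ?thesis .
  next
    case False
    have s: "\<bar>s x y t - s x' y t\<bar> \<le> Cs * (r / t * t powr (- N) * indicator (ball x (dilation * t)) y)"
    proof (cases "y \<in> ball x (dilation * t)")
      case True
      have "\<bar>s x y t - s x' y t\<bar> \<le> Cs * dist x x' / t powr (N + 1)" by (rule s_lip[OF t])
      also have "\<dots> \<le> Cs * r / t powr (N + 1)"
        using r Cs_pos by (intro divide_right_mono mult_left_mono) auto
      finally show ?thesis using True t by (simp add: powr_add powr_minus field_simps)
    next
      case out: False
      then have 1: "(Cs + 2) * t \<le> dist x y" by (simp add: dilation_def)
      have "dist x y \<le> dist x x' + dist x' y" by (rule dist_triangle)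
      then have "Cs * t < dist x y" "Cs * t < dist x' y"
        using 1 r False t by (auto simp: algebra_simps)
      then have "s x y t = 0" "s x' y t = 0" by (auto intro: s_support[OF t])
      then show ?thesis using r0 t Cs_pos by simp
    qed
    have "\<bar>integrand x z - integrand x' z\<bar> = weight t * \<bar>s x y t - s x' y t\<bar>"
      using t weight_nonneg[OF t]
      by (simp add: integrand_def t_def[symmetric] y_def[symmetric] right_diff_distrib[symmetric] abs_mult)
    also have "\<dots> \<le> weight t * (Cs * (r / t * t powr (- N) * indicator (ball x (dilation * t)) y))"
      using weight_nonneg[OF t] by (intro mult_left_mono s)
    also have "\<dots> = Cs * ball_kernel (weight_high r) dilation x z"
      using t False by (simp add: ball_kernel_def weight_high_def t_def[symmetric] y_def[symmetric])
    also have "\<dots> \<le> Cs * (ball_kernel (weight_low r) dilation x z +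
        ball_kernel (weight_low r) dilation x' z + ball_kernel (weight_high r) dilation x z)"
      using Cs_pos ball_kernel_nonneg[of "weight_low r" dilation] weight_low_nonneg
      by (intro mult_left_mono) auto
    finally show ?thesis .
  qed
qed (simp add: integrand_def ball_kernel_def)

lemma nn_integral_integrand_le:
  assumes [measurable]: "g \<in> borel_measurable m"
  shows "(\<integral>\<^sup>+z. ennreal (norm (g (fst z) * integrand x z)) \<partial>(m \<Otimes>\<^sub>M lborel))
    \<le> ennreal Cs * ball_averages weight dilation g x"
proof -
  have "(\<integral>\<^sup>+z. ennreal (norm (g (fst z) * integrand x z)) \<partial>(m \<Otimes>\<^sub>M lborel))
      \<le> (\<integral>\<^sup>+z. ennreal Cs * ennreal (\<bar>g (fst z)\<bar> * ball_kernel weight dilation x z) \<partial>(m \<Otimes>\<^sub>M lborel))"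
  proof (rule nn_integral_mono)
    fix z
    have "\<bar>g (fst z)\<bar> * integrand x z \<le> \<bar>g (fst z)\<bar> * (Cs * ball_kernel weight dilation x z)"
      by (intro mult_left_mono integrand_le) auto
    then show "ennreal (norm (g (fst z) * integrand x z))
        \<le> ennreal Cs * ennreal (\<bar>g (fst z)\<bar> * ball_kernel weight dilation x z)"
      using Cs_pos integrand_nonneg[of x z]
      by (auto simp: abs_mult ennreal_mult'[symmetric] mult_ac intro!: ennreal_leI)
  qed
  also have "\<dots> = ennreal Cs * ball_averages weight dilation g x"
    unfolding ball_averages_def by (rule nn_integral_cmult) measurable
  finally show ?thesis .
qed

text \<open>A finite ball average gives absolute integrability over points and scales at x, hence
  Fubini.\<close>

lemma potential_eq:
  assumes [measurable]: "g \<in> borel_measurable m"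
    and fin: "ball_averages weight dilation g x < \<infinity>"
  shows "integrable (m \<Otimes>\<^sub>M lborel) (\<lambda>z. g (fst z) * integrand x z)"
    and "potential m s \<alpha> g x = (\<integral>z. g (fst z) * integrand x z \<partial>(m \<Otimes>\<^sub>M lborel))"
proof -
  show int: "integrable (m \<Otimes>\<^sub>M lborel) (\<lambda>z. g (fst z) * integrand x z)"
  proof (rule integrableI_bounded)
    show "(\<integral>\<^sup>+z. ennreal (norm (g (fst z) * integrand x z)) \<partial>(m \<Otimes>\<^sub>M lborel)) < \<infinity>"
      by (rule le_less_trans[OF nn_integral_integrand_le[OF assms(1)]])
         (use fin in \<open>simp add: ennreal_mult_less_top\<close>)
  qed measurable
  show "potential m s \<alpha> g x = (\<integral>z. g (fst z) * integrand x z \<partial>(m \<Otimes>\<^sub>M lborel))"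
    using pair_lborel.integral_fst'[OF int] by (simp add: potential_eq_iterated)
qed

text \<open>Valid at every x: where the average is infinite, the right side is \<infinity> because
  \<open>Cs\<close> is positive.\<close>

lemma potential_le:
  assumes "g \<in> borel_measurable m"
  shows "ennreal \<bar>potential m s \<alpha> g x\<bar> \<le> ennreal Cs * ball_averages weight dilation g x"
proof (cases "ball_averages weight dilation g x < \<infinity>")
  case True
  have "ennreal \<bar>potential m s \<alpha> g x\<bar> \<le> (\<integral>\<^sup>+z. ennreal (norm (g (fst z) * integrand x z)) \<partial>(m \<Otimes>\<^sub>M lborel))"
    using integral_norm_bound_ennreal[OF potential_eq(1)[OF assms True]] potential_eq(2)[OF assms True] by simp
  also have "\<dots> \<le> ennreal Cs * ball_averages weight dilation g x"
    by (rule nn_integral_integrand_le[OF assms])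
  finally show ?thesis .
next
  case False
  then have "ball_averages weight dilation g x = top" by (simp add: not_less top_unique)
  then show ?thesis using Cs_pos by (simp add: ennreal_mult_top)
qed

text \<open>Finiteness at both points lets the difference of the potentials be written as one
  integral, to which \<open>integrand_diff_le\<close> applies.\<close>

lemma potential_diff_le:
  assumes [measurable]: "g \<in> borel_measurable m"
    and fin: "ball_averages weight dilation g x < \<infinity>" "ball_averages weight dilation g x' < \<infinity>"
    and r: "dist x x' < r"
  shows "ennreal \<bar>potential m s \<alpha> g x' - potential m s \<alpha> g x\<bar> \<le> ennreal Cs *
    (ball_averages (weight_low r) dilation g x + ball_averages (weight_low r) dilation g x' +
     ball_averages (weight_high r) dilation g x)"
proof -
  let ?l = "ball_kernel (weight_low r) dilation" and ?h = "ball_kernel (weight_high r) dilation"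
  have r0: "0 < r" using r by (rule le_less_trans[OF zero_le_dist])
  note P = potential_eq[OF assms(1) fin(1)] potential_eq[OF assms(1) fin(2)]
  have "\<bar>potential m s \<alpha> g x' - potential m s \<alpha> g x\<bar>
      = norm (\<integral>z. g (fst z) * integrand x z - g (fst z) * integrand x' z \<partial>(m \<Otimes>\<^sub>M lborel))"
    using P by (simp add: Bochner_Integration.integral_diff abs_minus_commute)
  also have "ennreal \<dots> \<le> (\<integral>\<^sup>+z. ennreal (norm (g (fst z) * integrand x z - g (fst z) * integrand x' z)) \<partial>(m \<Otimes>\<^sub>M lborel))"
    using P by (intro integral_norm_bound_ennreal Bochner_Integration.integrable_diff)
  also have "\<dots> \<le> (\<integral>\<^sup>+z. ennreal Cs * (ennreal (\<bar>g (fst z)\<bar> * ?l x z) + ennreal (\<bar>g (fst z)\<bar> * ?l x' z)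
      + ennreal (\<bar>g (fst z)\<bar> * ?h x z)) \<partial>(m \<Otimes>\<^sub>M lborel))"
  proof (rule nn_integral_mono)
    fix z
    have nn: "0 \<le> ?l x z" "0 \<le> ?l x' z" "0 \<le> ?h x z"
      using ball_kernel_nonneg weight_low_nonneg weight_high_nonneg[OF r0] by blast+
    have "norm (g (fst z) * integrand x z - g (fst z) * integrand x' z)
        = \<bar>g (fst z)\<bar> * \<bar>integrand x z - integrand x' z\<bar>"
      by (simp add: right_diff_distrib[symmetric] abs_mult)
    also have "\<dots> \<le> \<bar>g (fst z)\<bar> * (Cs * (?l x z + ?l x' z + ?h x z))"
      by (intro mult_left_mono integrand_diff_le r) auto
    also have "\<dots> = Cs * (\<bar>g (fst z)\<bar> * ?l x z + \<bar>g (fst z)\<bar> * ?l x' z + \<bar>g (fst z)\<bar> * ?h x z)"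
      by (simp add: algebra_simps)
    finally have "norm (g (fst z) * integrand x z - g (fst z) * integrand x' z) \<le> \<dots>" .
    then have "ennreal (norm (g (fst z) * integrand x z - g (fst z) * integrand x' z))
        \<le> ennreal (Cs * (\<bar>g (fst z)\<bar> * ?l x z + \<bar>g (fst z)\<bar> * ?l x' z + \<bar>g (fst z)\<bar> * ?h x z))"
      by (rule ennreal_leI)
    also have "\<dots> = ennreal Cs * (ennreal (\<bar>g (fst z)\<bar> * ?l x z) + ennreal (\<bar>g (fst z)\<bar> * ?l x' z)
        + ennreal (\<bar>g (fst z)\<bar> * ?h x z))"
      using nn Cs_pos by (simp add: ennreal_mult'[of Cs])
    finally show "ennreal (norm (g (fst z) * integrand x z - g (fst z) * integrand x' z)) \<le> \<dots>" .
  qed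
  also have "\<dots> = ennreal Cs *
    (ball_averages (weight_low r) dilation g x + ball_averages (weight_low r) dilation g x' +
     ball_averages (weight_high r) dilation g x)"
    unfolding ball_averages_def by (simp add: nn_integral_cmult nn_integral_add)
  finally show ?thesis .
qed

lemma potential_linear:
  assumes [measurable]: "g \<in> borel_measurable m" "h \<in> borel_measurable m"
    and fin: "ball_averages weight dilation g x < \<infinity>" "ball_averages weight dilation h x < \<infinity>"
  shows "potential m s \<alpha> (\<lambda>y. a * g y + b * h y) x = a * potential m s \<alpha> g x + b * potential m s \<alpha> h x"
proof -
  note P = potential_eq[OF assms(1) fin(1)] potential_eq[OF assms(2) fin(2)]
  let ?i = "\<lambda>z. a * (g (fst z) * integrand x z) + b * (h (fst z) * integrand x z)"
  have "integrable (m \<Otimes>\<^sub>M lborel) ?i" using P by simp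
  from pair_lborel.integral_fst'[OF this]
  have "potential m s \<alpha> (\<lambda>y. a * g y + b * h y) x = (\<integral>z. ?i z \<partial>(m \<Otimes>\<^sub>M lborel))"
    by (simp add: potential_eq_iterated algebra_simps)
  then show ?thesis using P by simp
qed

section \<open>Integrals of the scale weights\<close>

text \<open>With T = t^\<alpha>, the denominator (1 + T)^2 is at least 1 and at least T^2.\<close>

lemma weight_le: "0 < t \<Longrightarrow> weight t \<le> \<alpha> * t powr (\<alpha> - 1)" "0 < t \<Longrightarrow> weight t \<le> \<alpha> * t powr (- \<alpha> - 1)"
proof -
  assume t: "0 < t"
  define T where "T = t powr \<alpha>"
  have T: "0 < T" using t by (simp add: T_def)
  have "1 \<le> (1 + T)\<^sup>2" using T by (simp add: power2_eq_square algebra_simps)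
  moreover have "T / (1 + T)\<^sup>2 \<le> T / 1" using T \<open>1 \<le> (1 + T)\<^sup>2\<close> by (intro divide_left_mono) auto
  ultimately have "\<alpha> * (T / (1 + T)\<^sup>2) / t \<le> \<alpha> * T / t"
    using \<alpha>_pos t by (intro divide_right_mono mult_left_mono) auto
  then show "weight t \<le> \<alpha> * t powr (\<alpha> - 1)" using t by (simp add: weight_def T_def powr_diff)
  have "T * T \<le> (1 + T)\<^sup>2" using T by (simp add: power2_eq_square algebra_simps)
  then have "T / (1 + T)\<^sup>2 \<le> T / (T * T)" using T by (intro divide_left_mono) auto
  then have "\<alpha> * (T / (1 + T)\<^sup>2) / t \<le> \<alpha> * (T / (T * T)) / t"
    using \<alpha>_pos t by (intro divide_right_mono mult_left_mono) auto
  moreover have "\<alpha> * (T / (T * T)) / t = \<alpha> * t powr (- \<alpha> - 1)"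
    using t by (simp add: T_def powr_diff powr_minus field_simps)
  ultimately show "weight t \<le> \<alpha> * t powr (- \<alpha> - 1)" using t by (simp add: weight_def T_def)
qed

text \<open>Convergence at 0 rests on \<alpha> + a > 0. For a = (\<delta> - N)/p this sum is
  \<beta>.\<close>

lemma nn_integral_weight_low:
  assumes "0 < \<alpha> + a" "0 < r"
  shows "(\<integral>\<^sup>+t. ennreal (indicator {0<..} t * weight_low r t * t powr a) \<partial>lborel)
    \<le> ennreal (\<alpha> / (\<alpha> + a) * r powr (\<alpha> + a))"
proof -
  have "(\<integral>\<^sup>+t. ennreal (indicator {0<..} t * weight_low r t * t powr a) \<partial>lborel)
      \<le> (\<integral>\<^sup>+t. ennreal \<alpha> * ennreal (indicator {0<..<r} t * t powr (\<alpha> + a - 1)) \<partial>lborel)"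
  proof (rule nn_integral_mono)
    fix t :: real
    show "ennreal (indicator {0<..} t * weight_low r t * t powr a)
        \<le> ennreal \<alpha> * ennreal (indicator {0<..<r} t * t powr (\<alpha> + a - 1))"
    proof (cases "0 < t \<and> t < r")
      case True
      have "weight t * t powr a \<le> \<alpha> * t powr (\<alpha> - 1) * t powr a"
        using weight_le True by (intro mult_right_mono) auto
      also have "\<dots> = \<alpha> * t powr (\<alpha> + a - 1)"
        using True by (simp add: mult.assoc powr_add[symmetric] algebra_simps)
      finally show ?thesis using True \<alpha>_pos by (simp add: weight_low_def ennreal_mult'[symmetric] ennreal_leI)
    qed (auto simp: weight_low_def indicator_def)
  qed
  also have "\<dots> = ennreal \<alpha> * (\<integral>\<^sup>+t. ennreal (indicator {0<..<r} t * t powr (\<alpha> + a - 1)) \<partial>lborel)"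
    by (rule nn_integral_cmult) measurable
  also have "\<dots> \<le> ennreal \<alpha> * ennreal (r powr (\<alpha> + a) / (\<alpha> + a))"
    using assms by (intro mult_left_mono nn_integral_powr_near_0) auto
  also have "\<dots> = ennreal (\<alpha> / (\<alpha> + a) * r powr (\<alpha> + a))"
    using \<alpha>_pos by (simp add: ennreal_mult'[symmetric])
  finally show ?thesis .
qed

text \<open>The Lipschitz gain lowers the exponent to \<alpha> + a - 2, which is integrable at
  infinity because \<alpha> + a < 1. This is where \<beta> < 1 enters.\<close>

lemma nn_integral_weight_high:
  assumes "\<alpha> + a < 1" "0 < r"
  shows "(\<integral>\<^sup>+t. ennreal (indicator {0<..} t * weight_high r t * t powr a) \<partial>lborel)
    \<le> ennreal (\<alpha> / (1 - (\<alpha> + a)) * r powr (\<alpha> + a))"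
proof -
  let ?b = "1 - (\<alpha> + a)"
  have "(\<integral>\<^sup>+t. ennreal (indicator {0<..} t * weight_high r t * t powr a) \<partial>lborel)
      \<le> (\<integral>\<^sup>+t. ennreal (\<alpha> * r) * ennreal (indicator {r..} t * t powr (- ?b - 1)) \<partial>lborel)"
  proof (rule nn_integral_mono)
    fix t :: real
    show "ennreal (indicator {0<..} t * weight_high r t * t powr a)
        \<le> ennreal (\<alpha> * r) * ennreal (indicator {r..} t * t powr (- ?b - 1))"
    proof (cases "r \<le> t")
      case True
      then have t: "0 < t" using assms by simp
      have "r * weight t / t * t powr a \<le> r * (\<alpha> * t powr (\<alpha> - 1)) / t * t powr a"
        using weight_le t assms by (intro mult_right_mono divide_right_mono mult_left_mono) auto
      also have "\<dots> = \<alpha> * r * t powr (- ?b - 1)"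
      proof -
        have "t powr (\<alpha> - 1) * t powr (-1) * t powr a = t powr (\<alpha> - 1 + (-1) + a)"
          by (simp only: powr_add)
        moreover have "\<alpha> - 1 + (-1) + a = - ?b - 1" by simp
        ultimately have "t powr (- ?b - 1) = t powr (\<alpha> - 1) * t powr (-1) * t powr a"
          by metis
        then show ?thesis using t by (simp add: powr_minus divide_inverse)
      qed
      finally show ?thesis using True t \<alpha>_pos assms
        by (simp add: weight_high_def ennreal_mult'[symmetric] ennreal_leI)
    qed (auto simp: weight_high_def indicator_def)
  qed
  also have "\<dots> = ennreal (\<alpha> * r) * (\<integral>\<^sup>+t. ennreal (indicator {r..} t * t powr (- ?b - 1)) \<partial>lborel)"
    by (rule nn_integral_cmult) measurable
  also have "\<dots> = ennreal (\<alpha> * r) * ennreal (r powr (- ?b) / ?b)"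
    using assms by (subst nn_integral_powr_at_top) auto
  also have "\<dots> = ennreal (\<alpha> / ?b * r powr (\<alpha> + a))"
  proof -
    have "r * r powr (- ?b) = r powr (\<alpha> + a)" using assms by (simp add: powr_mult_base)
    then have "\<alpha> * r * (r powr (- ?b) / ?b) = \<alpha> / ?b * r powr (\<alpha> + a)" by (simp add: mult_ac)
    then show ?thesis using \<alpha>_pos assms by (simp add: ennreal_mult'[symmetric])
  qed
  finally show ?thesis .
qed

text \<open>The integral is split at t = 1; above it the decaying bound on the weight is used
  together with \<open>t powr a \<le> 1\<close>.\<close>

lemma nn_integral_weight:
  assumes "0 < \<alpha> + a" "a \<le> 0"
  shows "(\<integral>\<^sup>+t. ennreal (indicator {0<..} t * weight t * t powr a) \<partial>lborel) \<le> ennreal (\<alpha> / (\<alpha> + a) + 1)"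
proof -
  have "(\<integral>\<^sup>+t. ennreal (indicator {0<..} t * weight t * t powr a) \<partial>lborel)
      \<le> (\<integral>\<^sup>+t. ennreal (indicator {0<..} t * weight_low 1 t * t powr a)
          + ennreal \<alpha> * ennreal (indicator {1..} t * t powr (- \<alpha> - 1)) \<partial>lborel)"
  proof (rule nn_integral_mono)
    fix t :: real
    show "ennreal (indicator {0<..} t * weight t * t powr a)
        \<le> ennreal (indicator {0<..} t * weight_low 1 t * t powr a)
          + ennreal \<alpha> * ennreal (indicator {1..} t * t powr (- \<alpha> - 1))"
    proof (cases "1 \<le> t")
      case True
      have "t powr a \<le> t powr 0" using True assms by (intro powr_mono) auto
      then have "weight t * t powr a \<le> \<alpha> * t powr (- \<alpha> - 1) * 1"
        using weight_le[of t] True \<alpha>_pos by (intro mult_mono) auto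
      then show ?thesis using True \<alpha>_pos
        by (simp add: weight_low_def ennreal_mult'[symmetric] ennreal_leI)
    qed (auto simp: weight_low_def indicator_def)
  qed
  also have "\<dots> = (\<integral>\<^sup>+t. ennreal (indicator {0<..} t * weight_low 1 t * t powr a) \<partial>lborel)
      + ennreal \<alpha> * (\<integral>\<^sup>+t. ennreal (indicator {1..} t * t powr (- \<alpha> - 1)) \<partial>lborel)"
    by (simp add: nn_integral_add nn_integral_cmult)
  also have "\<dots> \<le> ennreal (\<alpha> / (\<alpha> + a) * 1 powr (\<alpha> + a)) + ennreal \<alpha> * ennreal (1 powr (- \<alpha>) / \<alpha>)"
    using nn_integral_powr_at_top[of \<alpha> 1] nn_integral_weight_low[OF assms(1), of 1] \<alpha>_pos
    by (intro add_mono mult_left_mono) auto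
  also have "\<dots> = ennreal (\<alpha> / (\<alpha> + a) + 1)"
    using \<alpha>_pos assms by (simp add: ennreal_mult'[symmetric] ennreal_plus)
  finally show ?thesis .
qed

section \<open>Bounds for potentials in L^p\<close>

definition averages_const :: "real \<Rightarrow> real \<Rightarrow> real \<Rightarrow> real" where
  "averages_const p \<eta> D = (C * dilation powr N) powr (p - 1) * D * dilation powr \<eta>"

lemma averages_const_nonneg: "0 \<le> D \<Longrightarrow> 0 \<le> averages_const p \<eta> D"
  using C_ge by (simp add: averages_const_def)

lemma ball_averages_le:
  assumes \<mu>: "upper_regular \<eta> D \<mu>" and p: "1 < p" and z: "0 \<le> z"
    and g: "g \<in> borel_measurable m" and c: "c \<in> borel_measurable borel" "\<And>t. 0 < t \<Longrightarrow> 0 \<le> c t"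
    and cz: "(\<integral>\<^sup>+t. ennreal (indicator {0<..} t * c t * t powr ((\<eta> - N) / p)) \<partial>lborel) \<le> ennreal z"
  shows "(\<integral>\<^sup>+x. enn_powr (ball_averages c dilation g x) p \<partial>\<mu>)
    \<le> ennreal (averages_const p \<eta> D * z powr p) * Lp_modular p m g"
  using ball_averages_bound[OF \<mu> g c dilation_pos p z cz]
  by (simp add: averages_const_def Lp_modular_def)

lemma ball_averages_weight_le:
  assumes "upper_regular \<eta> D \<mu>" "1 < p" "\<eta> \<le> N" "0 < \<alpha> + (\<eta> - N) / p" "g \<in> borel_measurable m"
  shows "(\<integral>\<^sup>+x. enn_powr (ball_averages weight dilation g x) p \<partial>\<mu>)
    \<le> ennreal (averages_const p \<eta> D * (\<alpha> / (\<alpha> + (\<eta> - N) / p) + 1) powr p) * Lp_modular p m g"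
proof (rule ball_averages_le)
  show "(\<integral>\<^sup>+t. ennreal (indicator {0<..} t * weight t * t powr ((\<eta> - N) / p)) \<partial>lborel)
      \<le> ennreal (\<alpha> / (\<alpha> + (\<eta> - N) / p) + 1)"
    by (rule nn_integral_weight) (use assms in \<open>auto simp: divide_nonpos_pos\<close>)
qed (use assms weight_nonneg \<alpha>_pos in auto)

text \<open>A finite integral of the p-th power forces finiteness almost everywhere. This makes
  \<open>potential\<close> itself meaningful on \<mu>-almost all of \<open>F\<close>, even if \<mu>
  is singular.\<close>

lemma ball_averages_weight_finite:
  assumes \<mu>: "upper_regular \<eta> D \<mu>" and p: "1 < p" and \<eta>: "\<eta> \<le> N" "0 < \<alpha> + (\<eta> - N) / p"
    and g [measurable]: "g \<in> borel_measurable m" and fin: "Lp_modular p m g < \<infinity>"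
  shows "AE x in \<mu>. ball_averages weight dilation g x < \<infinity>"
proof -
  note [measurable_cong] = upper_regularD(1)[OF \<mu>]
  have "(\<integral>\<^sup>+x. enn_powr (ball_averages weight dilation g x) p \<partial>\<mu>) < \<infinity>"
    by (rule le_less_trans[OF ball_averages_weight_le[OF \<mu> p \<eta> g]]) (use fin in \<open>simp add: ennreal_mult_less_top\<close>)
  then have "AE x in \<mu>. enn_powr (ball_averages weight dilation g x) p \<noteq> \<infinity>"
    by (intro nn_integral_PInf_AE) auto
  then show ?thesis by eventually_elim (simp add: less_top)
qed

lemma Lp_modular_potential_le:
  assumes \<mu>: "upper_regular \<eta> D \<mu>" and p: "1 < p" and \<eta>: "\<eta> \<le> N" "0 < \<alpha> + (\<eta> - N) / p"
    and g [measurable]: "g \<in> borel_measurable m"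
  shows "Lp_modular p \<mu> (potential m s \<alpha> g)
    \<le> ennreal (Cs powr p * (averages_const p \<eta> D * (\<alpha> / (\<alpha> + (\<eta> - N) / p) + 1) powr p)) * Lp_modular p m g"
proof -
  note [measurable_cong] = upper_regularD(1)[OF \<mu>]
  have "Lp_modular p \<mu> (potential m s \<alpha> g)
      \<le> (\<integral>\<^sup>+x. ennreal (Cs powr p) * enn_powr (ball_averages weight dilation g x) p \<partial>\<mu>)"
    unfolding Lp_modular_def
  proof (rule nn_integral_mono)
    fix x
    have "enn_powr (ennreal \<bar>potential m s \<alpha> g x\<bar>) p \<le> enn_powr (ennreal Cs * ball_averages weight dilation g x) p"
      using p by (intro enn_powr_mono potential_le) auto
    then show "ennreal (\<bar>potential m s \<alpha> g x\<bar> powr p) \<le> ennreal (Cs powr p) * enn_powr (ball_averages weight dilation g x) p"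
      using p Cs_pos by (simp add: enn_powr_mult)
  qed
  also have "\<dots> = ennreal (Cs powr p) * (\<integral>\<^sup>+x. enn_powr (ball_averages weight dilation g x) p \<partial>\<mu>)"
    by (rule nn_integral_cmult) measurable
  also have "\<dots> \<le> ennreal (Cs powr p) * (ennreal (averages_const p \<eta> D * (\<alpha> / (\<alpha> + (\<eta> - N) / p) + 1) powr p) * Lp_modular p m g)"
    by (intro mult_left_mono ball_averages_weight_le assms) auto
  finally show ?thesis by (simp add: ennreal_mult' mult.assoc)
qed

section \<open>Oscillation of potentials\<close>

text \<open>In \<open>potential_diff_le\<close> the two terms at x survive the averaging over y
  unchanged and are integrated over \<mu>. The term at y is transferred to an integral over \<nu> by
  \<open>averaging\<close>.\<close>

lemma mean_oscillation_potential:
  assumes \<mu>: "upper_regular \<delta> D \<mu>" and \<nu>: "upper_regular \<eta> E \<nu>"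
    and avg: "averaging G (\<delta> - \<eta>) \<mu> \<nu>"
    and le: "\<delta> \<le> N" "\<eta> \<le> N" and p: "1 < p"
    and \<beta>: "\<beta> = \<alpha> + (\<delta> - N) / p" "0 < \<beta>" "\<beta> < 1"
    and \<gamma>: "\<gamma> = \<alpha> + (\<eta> - N) / p" "0 < \<gamma>"
  shows "\<exists>K\<ge>0. \<forall>g\<in>borel_measurable m. Lp_modular p m g < \<infinity> \<longrightarrow> (\<forall>r>0.
    mean_oscillation p \<mu> \<nu> (potential m s \<alpha> g) r \<le> ennreal (K * r powr (\<beta> * p)) * Lp_modular p m g)"
proof -
  note [measurable_cong] = upper_regularD(1)[OF \<mu>] upper_regularD(1)[OF \<nu>]
  interpret \<mu>: sigma_finite_measure \<mu> by (rule upper_regular_sigma_finite[OF \<mu>])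
  interpret \<nu>: sigma_finite_measure \<nu> by (rule upper_regular_sigma_finite[OF \<nu>])
  interpret \<mu>\<nu>: pair_sigma_finite \<mu> \<nu> ..
  have G: "0 \<le> G" and D: "0 \<le> D" and E: "0 \<le> E"
    using avg upper_regularD(2)[OF \<mu>] upper_regularD(2)[OF \<nu>] by (auto simp: averaging_def)
  \<comment> \<open>These belong to the integrals of \<open>l\<close> and \<open>h\<close> over
    \<mu> and of \<open>l\<close> over \<nu>; none of them depends on g or r.\<close>
  define k1 k2 k3 where "k1 = averages_const p \<delta> D * (\<alpha> / \<beta>) powr p"
    and "k2 = averages_const p \<delta> D * (\<alpha> / (1 - \<beta>)) powr p"
    and "k3 = averages_const p \<eta> E * (\<alpha> / \<gamma>) powr p"
  define M where "M = Cs powr p * 3 powr p"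
  define K where "K = M * (k1 + k2 + G * k3)"
  have k: "0 \<le> k1" "0 \<le> k2" "0 \<le> k3" "0 \<le> M"
    using averages_const_nonneg D E by (auto simp: k1_def k2_def k3_def M_def)
  have "mean_oscillation p \<mu> \<nu> (potential m s \<alpha> g) r \<le> ennreal (K * r powr (\<beta> * p)) * Lp_modular p m g"
    if g [measurable]: "g \<in> borel_measurable m" and fin: "Lp_modular p m g < \<infinity>" and r: "0 < r" for g r
  proof -
    define u where "u = potential m s \<alpha> g"
    define I where "I = Lp_modular p m g"
    define l where "l x = enn_powr (ball_averages (weight_low r) dilation g x) p" for x
    define h where "h x = enn_powr (ball_averages (weight_high r) dilation g x) p" for x
    define V where "V x = emeasure \<nu> (ball x r)" for x
    have [measurable]: "u \<in> borel_measurable borel" unfolding u_def by measurable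
    have [measurable]: "l \<in> borel_measurable borel" "h \<in> borel_measurable borel"
      unfolding l_def h_def by measurable
    have ind: "indicator (ball x r) y = (if dist x y < r then 1 else 0 :: ennreal)" for x y
      by (simp add: indicator_def)
    have V_eq: "V x = (\<integral>\<^sup>+y. (if dist x y < r then 1 else 0) \<partial>\<nu>)" for x
      unfolding V_def using nn_integral_indicator[of "ball x r" \<nu>] by (simp add: upper_regularD(1)[OF \<nu>] ind)
    have [measurable]: "V \<in> borel_measurable borel" unfolding V_eq by measurable
    have l_\<mu>: "(\<integral>\<^sup>+x. l x \<partial>\<mu>) \<le> ennreal (k1 * r powr (\<beta> * p)) * I"
    proof -
      have "(\<integral>\<^sup>+x. l x \<partial>\<mu>) \<le> ennreal (averages_const p \<delta> D * (\<alpha> / \<beta> * r powr \<beta>) powr p) * I"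
        unfolding l_def I_def
        using nn_integral_weight_low[of "(\<delta> - N) / p" r] \<beta> r \<alpha>_pos weight_low_nonneg
        by (intro ball_averages_le \<mu> p g) auto
      moreover have "(\<alpha> / \<beta> * r powr \<beta>) powr p = (\<alpha> / \<beta>) powr p * r powr (\<beta> * p)"
        by (simp only: powr_mult powr_powr)
      ultimately show ?thesis by (simp add: k1_def mult.assoc)
    qed
    have h_\<mu>: "(\<integral>\<^sup>+x. h x \<partial>\<mu>) \<le> ennreal (k2 * r powr (\<beta> * p)) * I"
    proof -
      have "(\<integral>\<^sup>+x. h x \<partial>\<mu>) \<le> ennreal (averages_const p \<delta> D * (\<alpha> / (1 - \<beta>) * r powr \<beta>) powr p) * I"
        unfolding h_def I_def
        using nn_integral_weight_high[of "(\<delta> - N) / p" r] \<beta> r \<alpha>_pos weight_high_nonneg[OF r]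
        by (intro ball_averages_le \<mu> p g) auto
      moreover have "(\<alpha> / (1 - \<beta>) * r powr \<beta>) powr p = (\<alpha> / (1 - \<beta>)) powr p * r powr (\<beta> * p)"
        by (simp only: powr_mult powr_powr)
      ultimately show ?thesis by (simp add: k2_def mult.assoc)
    qed
    have l_\<nu>: "(\<integral>\<^sup>+x. l x \<partial>\<nu>) \<le> ennreal (k3 * r powr (\<gamma> * p)) * I"
    proof -
      have "(\<integral>\<^sup>+x. l x \<partial>\<nu>) \<le> ennreal (averages_const p \<eta> E * (\<alpha> / \<gamma> * r powr \<gamma>) powr p) * I"
        unfolding l_def I_def
        using nn_integral_weight_low[of "(\<eta> - N) / p" r] \<gamma> r \<alpha>_pos weight_low_nonneg
        by (intro ball_averages_le \<nu> p g) auto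
      moreover have "(\<alpha> / \<gamma> * r powr \<gamma>) powr p = (\<alpha> / \<gamma>) powr p * r powr (\<gamma> * p)"
        by (simp only: powr_mult powr_powr)
      ultimately show ?thesis by (simp add: k3_def mult.assoc)
    qed
    have fin_\<mu>: "AE x in \<mu>. ball_averages weight dilation g x < \<infinity>"
      using ball_averages_weight_finite[OF \<mu> p le(1) _ g fin] \<beta> by simp
    have fin_\<nu>: "AE x in \<nu>. ball_averages weight dilation g x < \<infinity>"
      using ball_averages_weight_finite[OF \<nu> p le(2) _ g fin] \<gamma> by simp
    define w where "w x = (\<integral>\<^sup>+y. l y * indicator (ball x r) y \<partial>\<nu>)" for x
    have [measurable]: "w \<in> borel_measurable borel" unfolding w_def ind by measurable
    have pointwise: "(\<integral>\<^sup>+y\<in>ball x r. ennreal (\<bar>u y - u x\<bar> powr p) \<partial>\<nu>) / V x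
        \<le> ennreal M * (l x + h x + w x / V x)"
      if x: "ball_averages weight dilation g x < \<infinity>" for x
    proof -
      have "(\<integral>\<^sup>+y\<in>ball x r. ennreal (\<bar>u y - u x\<bar> powr p) \<partial>\<nu>)
          \<le> (\<integral>\<^sup>+y. ennreal M * ((l x + h x) * indicator (ball x r) y + l y * indicator (ball x r) y) \<partial>\<nu>)"
        using fin_\<nu>
      proof (intro nn_integral_mono_AE, eventually_elim)
        fix y assume y: "ball_averages weight dilation g y < \<infinity>"
        show "ennreal (\<bar>u y - u x\<bar> powr p) * indicator (ball x r) y
            \<le> ennreal M * ((l x + h x) * indicator (ball x r) y + l y * indicator (ball x r) y)"
        proof (cases "y \<in> ball x r")
          case True
          then have d: "dist x y < r" by simp
          have "enn_powr (ennreal \<bar>u y - u x\<bar>) p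
              \<le> enn_powr (ennreal Cs * (ball_averages (weight_low r) dilation g x +
                ball_averages (weight_low r) dilation g y + ball_averages (weight_high r) dilation g x)) p"
            unfolding u_def using p by (intro enn_powr_mono potential_diff_le g x y d) auto
          also have "\<dots> = ennreal (Cs powr p) * enn_powr (ball_averages (weight_low r) dilation g x +
                ball_averages (weight_low r) dilation g y + ball_averages (weight_high r) dilation g x) p"
            using p Cs_pos by (simp add: enn_powr_mult)
          also have "\<dots> \<le> ennreal (Cs powr p) * (ennreal (3 powr p) * (l x + l y + h x))"
            unfolding l_def h_def using p by (intro mult_left_mono enn_powr_add3) auto
          also have "\<dots> = ennreal M * (l x + h x + l y)"
            by (simp add: M_def ennreal_mult' mult.assoc add.assoc add.commute[of "h x"])
          finally show ?thesis using True by simp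
        qed simp
      qed
      also have "\<dots> = ennreal M * ((l x + h x) * V x + w x)"
        unfolding w_def V_def
        by (simp add: nn_integral_cmult nn_integral_add upper_regularD(1)[OF \<nu>])
      finally have "(\<integral>\<^sup>+y\<in>ball x r. ennreal (\<bar>u y - u x\<bar> powr p) \<partial>\<nu>) / V x
          \<le> ennreal M * ((l x + h x) * V x + w x) / V x"
        by (rule divide_right_mono_ennreal)
      also have "\<dots> = ennreal M * ((l x + h x) * V x / V x + w x / V x)"
        by (simp add: divide_ennreal_def distrib_right distrib_left mult.assoc)
      \<comment> \<open>Cancelling \<open>V x\<close> as an inequality also covers balls of
        \<nu>-measure 0.\<close>
      also have "\<dots> \<le> ennreal M * (l x + h x + w x / V x)"
        by (intro mult_left_mono add_right_mono ennreal_mult_divide_le) auto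
      finally show ?thesis .
    qed
    \<comment> \<open>After the exchange of integrals, \<open>l y\<close> is multiplied by the
      integral of \<open>inverse (V x)\<close> over the ball about y, which \<open>averaging\<close>
      controls.\<close>
    have w_le: "(\<integral>\<^sup>+x. w x / V x \<partial>\<mu>) \<le> ennreal (G * k3 * r powr (\<beta> * p)) * I"
    proof -
      have "(\<integral>\<^sup>+x. w x / V x \<partial>\<mu>) = (\<integral>\<^sup>+x. \<integral>\<^sup>+y. l y * (if dist x y < r then 1 else 0) * inverse (V x) \<partial>\<nu> \<partial>\<mu>)"
        unfolding w_def divide_ennreal_def ind by (intro nn_integral_cong nn_integral_multc[symmetric]) measurable
      also have "\<dots> = (\<integral>\<^sup>+y. \<integral>\<^sup>+x. l y * (if dist x y < r then 1 else 0) * inverse (V x) \<partial>\<mu> \<partial>\<nu>)"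
        by (rule \<mu>\<nu>.Fubini'[symmetric]) measurable
      also have "\<dots> \<le> (\<integral>\<^sup>+y. l y * ennreal (G * r powr (\<delta> - \<eta>)) \<partial>\<nu>)"
      proof (rule nn_integral_mono)
        fix y
        have "(\<integral>\<^sup>+x. l y * (if dist x y < r then 1 else 0) * inverse (V x) \<partial>\<mu>)
            = l y * (\<integral>\<^sup>+x\<in>ball y r. inverse (V x) \<partial>\<mu>)"
          by (subst nn_integral_cmult[symmetric])
             (auto intro!: nn_integral_cong simp: ind dist_commute upper_regularD(1)[OF \<mu>])
        also have "\<dots> \<le> l y * ennreal (G * r powr (\<delta> - \<eta>))"
          using avg r by (intro mult_left_mono) (auto simp: averaging_def V_def)
        finally show "(\<integral>\<^sup>+x. l y * (if dist x y < r then 1 else 0) * inverse (V x) \<partial>\<mu>) \<le> \<dots>" .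
      qed
      also have "\<dots> = (\<integral>\<^sup>+y. l y \<partial>\<nu>) * ennreal (G * r powr (\<delta> - \<eta>))"
        by (rule nn_integral_multc) measurable
      also have "\<dots> \<le> ennreal (k3 * r powr (\<gamma> * p)) * I * ennreal (G * r powr (\<delta> - \<eta>))"
        by (intro mult_right_mono l_\<nu>) auto
      also have "\<dots> = ennreal (k3 * r powr (\<gamma> * p) * (G * r powr (\<delta> - \<eta>))) * I"
        using k G by (simp add: ennreal_mult mult_ac)
      also have "k3 * r powr (\<gamma> * p) * (G * r powr (\<delta> - \<eta>)) = G * k3 * r powr (\<beta> * p)"
      proof -
        \<comment> \<open>The change of dimension in \<open>averaging\<close> compensates exactly
          for the difference between \<gamma> and \<beta>.\<close>
        have "\<gamma> * p + (\<delta> - \<eta>) = \<beta> * p" using p unfolding \<beta>(1) \<gamma>(1) by (simp add: field_simps)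
        then have "r powr (\<gamma> * p) * r powr (\<delta> - \<eta>) = r powr (\<beta> * p)" by (simp add: powr_add[symmetric])
        then show ?thesis by (simp add: mult_ac)
      qed
      finally show ?thesis .
    qed
    have "mean_oscillation p \<mu> \<nu> u r \<le> (\<integral>\<^sup>+x. ennreal M * (l x + h x + w x / V x) \<partial>\<mu>)"
      unfolding mean_oscillation_def using fin_\<mu>
      by (intro nn_integral_mono_AE, eventually_elim) (use pointwise in \<open>auto simp: V_def\<close>)
    also have "\<dots> = ennreal M * ((\<integral>\<^sup>+x. l x \<partial>\<mu>) + (\<integral>\<^sup>+x. h x \<partial>\<mu>) + (\<integral>\<^sup>+x. w x / V x \<partial>\<mu>))"
      by (simp add: nn_integral_cmult nn_integral_add)
    also have "\<dots> \<le> ennreal M * (ennreal (k1 * r powr (\<beta> * p)) * I + ennreal (k2 * r powr (\<beta> * p)) * I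
        + ennreal (G * k3 * r powr (\<beta> * p)) * I)"
      by (intro mult_left_mono add_mono l_\<mu> h_\<mu> w_le) auto
    also have "\<dots> = ennreal (M * (k1 * r powr (\<beta> * p) + k2 * r powr (\<beta> * p) + G * k3 * r powr (\<beta> * p))) * I"
      using k G by (simp add: ennreal_mult' distrib_right mult.assoc)
    also have "M * (k1 * r powr (\<beta> * p) + k2 * r powr (\<beta> * p) + G * k3 * r powr (\<beta> * p)) = K * r powr (\<beta> * p)"
      by (simp add: K_def algebra_simps)
    finally show ?thesis by (simp add: u_def I_def)
  qed
  moreover have "0 \<le> K" using k G by (simp add: K_def)
  ultimately show ?thesis by blast
qed

text \<open>The lower bound on balls of \<open>m\<close> makes the integrand at most
  \<open>C * r powr (- N)\<close>, and \<mu> of the ball is at most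
  \<open>D * r powr \<delta>\<close>.\<close>

lemma averaging_m:
  assumes \<mu>: "upper_regular \<delta> D \<mu>"
  shows "averaging (C * D) (\<delta> - N) \<mu> m"
  unfolding averaging_def
proof (intro conjI allI impI)
  have D: "0 \<le> D" by (rule upper_regularD(2)[OF \<mu>])
  then show "0 \<le> C * D" using C_ge by simp
  fix y r assume r: "0 < (r::real)"
  have "(\<integral>\<^sup>+x\<in>ball y r. inverse (emeasure m (ball x r)) \<partial>\<mu>) \<le> (\<integral>\<^sup>+x. ennreal (C * r powr (- N)) * indicator (ball y r) x \<partial>\<mu>)"
  proof (intro nn_integral_mono mult_right_mono)
    fix x
    have "inverse (emeasure m (ball x r)) \<le> inverse (ennreal (r powr N / C))"
      using m_low[OF r] r C_ge by (intro inverse_ennreal_antimono) auto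
    also have "\<dots> = ennreal (C * r powr (- N))"
      using r C_ge by (simp add: inverse_ennreal powr_minus field_simps)
    finally show "inverse (emeasure m (ball x r)) \<le> ennreal (C * r powr (- N))" .
  qed simp
  also have "\<dots> = ennreal (C * r powr (- N)) * emeasure \<mu> (ball y r)"
    by (intro nn_integral_cmult_indicator) (simp add: upper_regularD(1)[OF \<mu>])
  also have "\<dots> \<le> ennreal (C * r powr (- N)) * ennreal (D * r powr \<delta>)"
    by (intro mult_left_mono upper_regularD(3)[OF \<mu>] r) auto
  also have "\<dots> = ennreal (C * D * r powr (\<delta> - N))"
    using C_ge D r by (simp add: ennreal_mult'[symmetric] powr_diff powr_minus divide_inverse mult_ac)
  finally show "(\<integral>\<^sup>+x\<in>ball y r. inverse (emeasure m (ball x r)) \<partial>\<mu>) \<le> ennreal (C * D * r powr (\<delta> - N))" .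
qed

text \<open>
  Letting \<open>\<nu> = m\<close> and \<open>r \<rightarrow> 0\<close> in the oscillation bound, the potential is \<open>\<mu>\<close>-almost everywhere
  the limit of its \<open>m\<close>-averages, although \<open>\<mu>\<close> may be singular with respect to \<open>m\<close>.
\<close>

lemma AE_eq_potential_of_continuous:
  assumes \<mu>: "upper_regular \<delta> D \<mu>" and \<delta>: "\<delta> \<le> N" and p: "1 < p"
    and \<beta>: "0 < \<alpha> + (\<delta> - N) / p" "\<alpha> + (\<delta> - N) / p < 1"
    and g [measurable]: "g \<in> borel_measurable m" and fin: "Lp_modular p m g < \<infinity>"
    and f: "continuous_on UNIV f" and eq: "AE x in m. f x = potential m s \<alpha> g x"
  shows "AE x in \<mu>. f x = potential m s \<alpha> g x"
proof -
  note [measurable_cong] = upper_regularD(1)[OF \<mu>]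
  define u where "u = potential m s \<alpha> g"
  have [measurable]: "u \<in> borel_measurable borel" unfolding u_def by measurable
  have [measurable]: "f \<in> borel_measurable borel" using f by (rule borel_measurable_continuous_onI)
  obtain K where K: "0 \<le> K" "\<And>r. 0 < r \<Longrightarrow> mean_oscillation p \<mu> m u r
      \<le> ennreal (K * r powr ((\<alpha> + (\<delta> - N) / p) * p)) * Lp_modular p m g"
    using mean_oscillation_potential[OF \<mu> upper_regular_m averaging_m[OF \<mu>] \<delta> order_refl p refl \<beta> refl] \<alpha>_pos g fin
    unfolding u_def by auto
  define b where "b = (\<alpha> + (\<delta> - N) / p) * p"
  have b: "0 < b" using \<beta> p by (simp add: b_def)
  define r where "r n = inverse (real (Suc n))" for n
  have r: "0 < r n" for n by (simp add: r_def)
  have r_lim: "r \<longlonglongrightarrow> 0" unfolding r_def by (rule LIMSEQ_inverse_real_of_nat)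
  \<comment> \<open>Under the inner integral \<open>f y\<close> may replace \<open>u y\<close> for
    \<open>m\<close>. Hence \<open>\<phi> n\<close> integrates to an oscillation of
    \<open>u\<close>, while its limit is controlled by the continuity of \<open>f\<close>.\<close>
  define \<phi> where "\<phi> n x = (\<integral>\<^sup>+y\<in>ball x (r n). ennreal (\<bar>f y - u x\<bar> powr p) \<partial>m) / emeasure m (ball x (r n))" for n x
  have ind: "indicator (ball x r) y = (if dist x y < r then 1 else 0 :: ennreal)" for x y :: 'a and r
    by (simp add: indicator_def)
  have vol: "emeasure m (ball x r) = (\<integral>\<^sup>+y. (if dist x y < r then 1 else 0) \<partial>m)" for x r
    using nn_integral_indicator[of "ball x r" m] by (simp add: m_sets ind)
  have [measurable]: "\<phi> n \<in> borel_measurable borel" for n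
    unfolding \<phi>_def vol ind by measurable
  have \<phi>_int: "(\<integral>\<^sup>+x. \<phi> n x \<partial>\<mu>) = mean_oscillation p \<mu> m u (r n)" for n
    unfolding \<phi>_def mean_oscillation_def
  proof (rule nn_integral_cong, rule arg_cong2[where f="(/)"], rule nn_integral_cong_AE)
    show "AE y in m. ennreal (\<bar>f y - u x\<bar> powr p) * indicator (ball x (r n)) y
        = ennreal (\<bar>u y - u x\<bar> powr p) * indicator (ball x (r n)) y" for x
      using eq by eventually_elim (simp add: u_def)
  qed (rule refl)
  \<comment> \<open>Near x the integrand exceeds any intermediate value \<open>e'\<close>, so its
    mean over a small ball, which has positive finite measure, is at least
    \<open>e'\<close>.\<close>
  have lower: "ennreal (\<bar>f x - u x\<bar> powr p) \<le> liminf (\<lambda>n. \<phi> n x)" for x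
    unfolding le_Liminf_iff
  proof (intro allI impI)
    fix e assume "e < ennreal (\<bar>f x - u x\<bar> powr p)"
    then obtain e' where e': "e < e'" "e' < ennreal (\<bar>f x - u x\<bar> powr p)" using dense by blast
    have "isCont f x" using f by (simp add: continuous_on_eq_continuous_at)
    then have "((\<lambda>y. ennreal (\<bar>f y - u x\<bar> powr p)) \<longlongrightarrow> ennreal (\<bar>f x - u x\<bar> powr p)) (at x)"
      unfolding isCont_def using p by (intro tendsto_ennrealI tendsto_powr' tendsto_intros) auto
    then have "\<forall>\<^sub>F y in at x. e' < ennreal (\<bar>f y - u x\<bar> powr p)"
      using e'(2) by (rule order_tendstoD)
    then obtain d where d: "0 < d" "\<And>y. y \<noteq> x \<Longrightarrow> dist y x < d \<Longrightarrow> e' < ennreal (\<bar>f y - u x\<bar> powr p)"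
      unfolding eventually_at by auto
    then have near: "dist x y < d \<Longrightarrow> e' \<le> ennreal (\<bar>f y - u x\<bar> powr p)" for y
      using e'(2) by (cases "y = x") (auto simp: dist_commute less_imp_le)
    have "\<forall>\<^sub>F n in sequentially. r n < d" using r_lim d(1) by (rule order_tendstoD)
    then show "\<forall>\<^sub>F n in sequentially. e < \<phi> n x"
    proof eventually_elim
      fix n assume n: "r n < d"
      let ?V = "emeasure m (ball x (r n))"
      have "0 < r n powr N / C" using r[of n] C_ge by simp
      then have "0 < ?V" using m_low[OF r, of n x] by (metis ennreal_less_zero_iff less_le_trans)
      moreover have "?V < \<infinity>" by (rule cut.ball_finite)
      ultimately have "e' = e' * ?V / ?V" by (simp add: ennreal_mult_divide_eq)
      also have "e' * ?V = (\<integral>\<^sup>+y. e' * indicator (ball x (r n)) y \<partial>m)"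
        by (rule nn_integral_cmult_indicator[symmetric]) simp
      also have "\<dots> / ?V \<le> \<phi> n x"
        unfolding \<phi>_def using n near
        by (intro divide_right_mono_ennreal nn_integral_mono) (auto simp: indicator_def)
      finally show "e < \<phi> n x" using e'(1) by (rule less_le_trans[rotated])
    qed
  qed
  have "(\<integral>\<^sup>+x. ennreal (\<bar>f x - u x\<bar> powr p) \<partial>\<mu>) \<le> (\<integral>\<^sup>+x. liminf (\<lambda>n. \<phi> n x) \<partial>\<mu>)"
    by (intro nn_integral_mono lower)
  \<comment> \<open>Fatou's lemma, for which the lower bound on the limit suffices.\<close>
  also have "\<dots> \<le> liminf (\<lambda>n. \<integral>\<^sup>+x. \<phi> n x \<partial>\<mu>)"
    by (rule nn_integral_liminf) measurable
  also have "\<dots> \<le> liminf (\<lambda>n. ennreal (K * r n powr b) * Lp_modular p m g)"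
    unfolding \<phi>_int b_def by (intro Liminf_mono always_eventually allI K r)
  also have "\<dots> = 0"
  proof (rule lim_imp_Liminf)
    have "(\<lambda>n. ennreal (K * r n powr b) * Lp_modular p m g) \<longlonglongrightarrow> ennreal (K * 0 powr b) * Lp_modular p m g"
    proof -
      obtain i where i: "Lp_modular p m g = ennreal i" "0 \<le> i"
        using fin by (cases "Lp_modular p m g") auto
      have "(\<lambda>n. ennreal (K * r n powr b * i)) \<longlonglongrightarrow> ennreal (K * 0 powr b * i)"
        using b r r_lim
        by (intro tendsto_ennrealI tendsto_mult tendsto_const tendsto_powr') (auto intro!: always_eventually less_imp_le)
      then show ?thesis using i K(1) by (simp add: ennreal_mult)
    qed
    then show "(\<lambda>n. ennreal (K * r n powr b) * Lp_modular p m g) \<longlonglongrightarrow> 0" using b by simp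
  qed simp
  finally have "(\<integral>\<^sup>+x. ennreal (\<bar>f x - u x\<bar> powr p) \<partial>\<mu>) = 0" by simp
  then have "AE x in \<mu>. ennreal (\<bar>f x - u x\<bar> powr p) = 0"
    by (subst (asm) nn_integral_0_iff_AE) auto
  then show ?thesis
  proof eventually_elim
    fix x assume "ennreal (\<bar>f x - u x\<bar> powr p) = 0"
    then have "\<bar>f x - u x\<bar> powr p \<le> 0" by (simp only: ennreal_eq_0_iff)
    then show "f x = potential m s \<alpha> g x" by (simp add: u_def[symmetric])
  qed
qed

section \<open>The trace operator\<close>

text \<open>Linearity holds wherever both ball averages are finite, hence almost everywhere, both
  for \<open>m\<close> (with \<eta> = N) and for the measure on \<open>F\<close>.\<close>

lemma AE_potential_linear:
  assumes \<mu>: "upper_regular \<eta> D \<mu>" and p: "1 < p" and \<eta>: "\<eta> \<le> N" "0 < \<alpha> + (\<eta> - N) / p"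
    and g: "g \<in> Lp_space p m" and h: "h \<in> Lp_space p m"
  shows "AE x in \<mu>. potential m s \<alpha> (\<lambda>y. a * g y + b * h y) x = a * potential m s \<alpha> g x + b * potential m s \<alpha> h x"
proof -
  have meas: "g \<in> borel_measurable m" "h \<in> borel_measurable m"
    and fin: "Lp_modular p m g < \<infinity>" "Lp_modular p m h < \<infinity>"
    using g h by (auto simp: Lp_space_iff)
  show ?thesis
    using ball_averages_weight_finite[OF \<mu> p \<eta> meas(1) fin(1)]
      ball_averages_weight_finite[OF \<mu> p \<eta> meas(2) fin(2)]
    by eventually_elim (rule potential_linear[OF meas])
qed

text \<open>The density \<open>g - (a * g1 + b * g2)\<close> has a potential vanishing
  \<open>m\<close>-almost everywhere. Comparison with the continuous function 0 makes it vanish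
  \<mu>-almost everywhere.\<close>

lemma AE_eq_linear_combination:
  assumes \<mu>: "upper_regular \<delta> D \<mu>" and \<delta>: "\<delta> \<le> N" and p: "1 < p"
    and \<beta>: "0 < \<alpha> + (\<delta> - N) / p" "\<alpha> + (\<delta> - N) / p < 1"
    and g: "g \<in> Lp_space p m" "g1 \<in> Lp_space p m" "g2 \<in> Lp_space p m"
    and eq: "AE x in m. potential m s \<alpha> g x = a * potential m s \<alpha> g1 x + b * potential m s \<alpha> g2 x"
  shows "AE x in \<mu>. potential m s \<alpha> g x = a * potential m s \<alpha> g1 x + b * potential m s \<alpha> g2 x"
proof -
  let ?c = "\<lambda>y. a * g1 y + b * g2 y"
  let ?h = "\<lambda>y. 1 * g y + (-1) * ?c y"
  have c: "?c \<in> Lp_space p m" by (rule Lp_space_linear[OF g(2,3) p])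
  have h: "?h \<in> Lp_space p m" by (rule Lp_space_linear[OF g(1) c p])
  have lin: "AE x in \<nu>. potential m s \<alpha> ?h x
      = potential m s \<alpha> g x - (a * potential m s \<alpha> g1 x + b * potential m s \<alpha> g2 x)"
    if "upper_regular \<eta> E \<nu>" "\<eta> \<le> N" "0 < \<alpha> + (\<eta> - N) / p" for \<nu> \<eta> E
    using AE_potential_linear[OF that(1) p that(2,3) g(1) c, of 1 "-1"]
      AE_potential_linear[OF that(1) p that(2,3) g(2,3), of a b]
    by eventually_elim simp
  have "AE x in m. 0 = potential m s \<alpha> ?h x"
    using lin[OF upper_regular_m] \<alpha>_pos eq by auto
  then have "AE x in \<mu>. 0 = potential m s \<alpha> ?h x"
    using h by (intro AE_eq_potential_of_continuous[OF \<mu> \<delta> p \<beta>]) (auto simp: Lp_space_iff)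
  then show ?thesis using lin[OF \<mu> \<delta> \<beta>(1)] by eventually_elim simp
qed

text \<open>The oscillation bound with \<nu> = \<mu>, where the averaging exponent is 0. Its p-th
  root has the factor \<open>t powr \<beta>\<close>, which the Besov weight cancels.\<close>

lemma besov_norm_potential_le:
  assumes \<mu>: "upper_regular \<delta> D \<mu>" and avg: "averaging G 0 \<mu> \<mu>"
    and F: "closed F" "emeasure \<mu> (- F) = 0" and \<delta>: "\<delta> \<le> N" and p: "1 < p"
    and \<beta>: "\<beta> = \<alpha> + (\<delta> - N) / p" "0 < \<beta>" "\<beta> < 1"
  shows "\<exists>B>0. \<forall>g\<in>Lp_space p m.
    besov_norm \<beta> p F \<mu> (potential m s \<alpha> g) \<le> ennreal B * Lp_norm p m g"
proof -
  note sets = upper_regularD(1)[OF \<mu>]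
  have "averaging G (\<delta> - \<delta>) \<mu> \<mu>" using avg by simp
  then obtain K where K: "0 \<le> K" "\<And>g r. g \<in> borel_measurable m \<Longrightarrow> Lp_modular p m g < \<infinity> \<Longrightarrow> 0 < r \<Longrightarrow>
      mean_oscillation p \<mu> \<mu> (potential m s \<alpha> g) r \<le> ennreal (K * r powr (\<beta> * p)) * Lp_modular p m g"
    using mean_oscillation_potential[OF \<mu> \<mu> _ \<delta> \<delta> p \<beta> \<beta>(1,2)] by blast
  define k where "k = Cs powr p * (averages_const p \<delta> D * (\<alpha> / (\<alpha> + (\<delta> - N) / p) + 1) powr p)"
  have k: "0 \<le> k"
    using averages_const_nonneg upper_regularD(2)[OF \<mu>] by (simp add: k_def)
  \<comment> \<open>The summand 1 makes \<open>B\<close> positive, as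
    \<open>ennreal_le_mult_INF\<close> demands later.\<close>
  define B where "B = k powr (1 / p) + K powr (1 / p) + 1"
  have B: "0 < B" by (simp add: B_def add_nonneg_pos)
  have "besov_norm \<beta> p F \<mu> (potential m s \<alpha> g) \<le> ennreal B * Lp_norm p m g" if "g \<in> Lp_space p m" for g
  proof -
    have g: "g \<in> borel_measurable m" "Lp_modular p m g < \<infinity>" using that by (auto simp: Lp_space_iff)
    let ?u = "potential m s \<alpha> g" and ?n = "Lp_norm p m g"
    have "Lp_norm p \<mu> ?u \<le> enn_powr (ennreal k * Lp_modular p m g) (1 / p)"
      unfolding Lp_norm_eq k_def using p \<beta>
      by (intro enn_powr_mono Lp_modular_potential_le[OF \<mu> p \<delta> _ g(1)]) auto
    also have "\<dots> = ennreal (k powr (1 / p)) * ?n"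
      using p k by (simp add: enn_powr_mult Lp_norm_eq)
    finally have 1: "Lp_norm p \<mu> ?u \<le> ennreal (k powr (1 / p)) * ?n" .
    have 2: "(SUP t\<in>{0<..}. ennreal (t powr (- \<beta>)) * besov_E p F \<mu> ?u t) \<le> ennreal (K powr (1 / p)) * ?n"
    proof (rule SUP_least)
      fix t :: real assume "t \<in> {0<..}"
      then have t: "0 < t" by simp
      have "besov_E p F \<mu> ?u t \<le> enn_powr (ennreal (K * t powr (\<beta> * p)) * Lp_modular p m g) (1 / p)"
        unfolding besov_E_eq[OF sets F] using p by (intro enn_powr_mono K(2) g t) auto
      also have "\<dots> = ennreal ((K * t powr (\<beta> * p)) powr (1 / p)) * ?n"
        using p K(1) by (simp add: enn_powr_mult Lp_norm_eq)
      also have "(K * t powr (\<beta> * p)) powr (1 / p) = K powr (1 / p) * t powr \<beta>"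
        using p by (simp add: powr_mult powr_powr)
      finally have "ennreal (t powr (- \<beta>)) * besov_E p F \<mu> ?u t
          \<le> ennreal (t powr (- \<beta>)) * (ennreal (K powr (1 / p) * t powr \<beta>) * ?n)"
        by (rule mult_left_mono) simp
      also have "\<dots> = ennreal (t powr (- \<beta>) * (K powr (1 / p) * t powr \<beta>)) * ?n"
        by (simp add: ennreal_mult mult.assoc)
      also have "t powr (- \<beta>) * (K powr (1 / p) * t powr \<beta>) = K powr (1 / p)"
        using t by (simp add: powr_minus)
      finally show "ennreal (t powr (- \<beta>)) * besov_E p F \<mu> ?u t \<le> ennreal (K powr (1 / p)) * ?n" .
    qed
    have "besov_norm \<beta> p F \<mu> ?u \<le> ennreal (k powr (1 / p)) * ?n + ennreal (K powr (1 / p)) * ?n"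
      unfolding besov_norm_def by (intro add_mono 1 2)
    also have "\<dots> = ennreal (k powr (1 / p) + K powr (1 / p)) * ?n"
      by (simp add: distrib_right)
    also have "\<dots> \<le> ennreal B * ?n"
      by (intro mult_right_mono ennreal_leI) (auto simp: B_def)
    finally show ?thesis .
  qed
  then show ?thesis using B by blast
qed

text \<open>\<open>R\<close> sends f to the potential of a chosen density of f. Another choice
  alters the result only on a \<mu>-null set, which is the content of \<open>R_eq\<close>.\<close>

lemma trace_operator:
  assumes \<mu>: "upper_regular \<delta> D \<mu>" and avg: "averaging G 0 \<mu> \<mu>"
    and F: "closed F" "emeasure \<mu> (- F) = 0" and \<delta>: "\<delta> \<le> N" and p: "1 < p"
    and \<beta>: "\<beta> = \<alpha> + (\<delta> - N) / p" "0 < \<beta>" "\<beta> < 1"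
  shows "\<exists>R. continuous_linear_operator
              m (potential_space m s \<alpha> p) (potential_norm m s \<alpha> p)
              \<mu> (besov_space \<beta> p F \<mu>) (besov_norm \<beta> p F \<mu>) R \<and>
            (\<forall>f\<in>potential_space m s \<alpha> p. continuous_on UNIV f \<longrightarrow> (AE x in \<mu>. R f x = f x))"
proof -
  note sets [measurable_cong] = upper_regularD(1)[OF \<mu>]
  let ?V = "potential_space m s \<alpha> p" and ?J = "potential m s \<alpha>"
  obtain B where B: "0 < B" "\<And>g. g \<in> Lp_space p m \<Longrightarrow>
      besov_norm \<beta> p F \<mu> (?J g) \<le> ennreal B * Lp_norm p m g"
    using besov_norm_potential_le[OF \<mu> avg F \<delta> p \<beta>] by blast
  define density where "density f = (SOME g. g \<in> Lp_space p m \<and> (AE x in m. f x = ?J g x))" for f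
  define R where "R f = ?J (density f)" for f
  have density: "density f \<in> Lp_space p m" "AE x in m. f x = ?J (density f) x" if "f \<in> ?V" for f
  proof -
    have "\<exists>g. g \<in> Lp_space p m \<and> (AE x in m. f x = ?J g x)"
      using that by (auto simp: potential_space_def)
    from someI_ex[OF this] show "density f \<in> Lp_space p m" "AE x in m. f x = ?J (density f) x"
      by (simp_all only: density_def)
  qed
  note combination = AE_eq_linear_combination[OF \<mu> \<delta> p \<beta>(2,3)[unfolded \<beta>(1)]]
  have R_eq: "AE x in \<mu>. R f x = ?J g x"
    if "f \<in> ?V" "g \<in> Lp_space p m" "AE x in m. f x = ?J g x" for f g
  proof -
    \<comment> \<open>Equality of two potentials is the linear combination with coefficients 1 and
      0.\<close>
    have "AE x in m. ?J (density f) x = 1 * ?J g x + 0 * ?J g x"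
      using density(2)[OF that(1)] that(3) by eventually_elim simp
    from combination[OF density(1)[OF that(1)] that(2) that(2) this]
    show ?thesis by (simp add: R_def)
  qed
  have bound: "besov_norm \<beta> p F \<mu> (R f) \<le> ennreal B * potential_norm m s \<alpha> p f" if f: "f \<in> ?V" for f
  proof -
    let ?G = "{g \<in> Lp_space p m. AE x in m. f x = ?J g x}"
    have "besov_norm \<beta> p F \<mu> (R f) \<le> ennreal B * (INF g\<in>?G. Lp_norm p m g)"
    \<comment> \<open>Every density of f competes in the infimum, since \<open>R f\<close> agrees
      with its potential up to a \<mu>-null set.\<close>
    proof (rule ennreal_le_mult_INF[OF B(1)])
      fix g assume g: "g \<in> ?G"
      then have "AE x in \<mu>. R f x = ?J g x" using R_eq f by simp
      then have "besov_norm \<beta> p F \<mu> (R f) = besov_norm \<beta> p F \<mu> (?J g)"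
        by (rule besov_norm_cong_AE[OF sets F])
      then show "besov_norm \<beta> p F \<mu> (R f) \<le> ennreal B * Lp_norm p m g" using B(2) g by simp
    qed
    also have "\<dots> \<le> ennreal B * potential_norm m s \<alpha> p f"
      by (intro mult_left_mono) (simp_all add: potential_norm_def)
    finally show ?thesis .
  qed
  have in_besov: "R f \<in> besov_space \<beta> p F \<mu>" if f: "f \<in> ?V" for f
  proof -
    have [measurable]: "density f \<in> borel_measurable m" and fin: "Lp_norm p m (density f) < \<infinity>"
      using density(1)[OF f] by (auto simp: Lp_space_def)
    have "R f \<in> borel_measurable \<mu>" unfolding R_def by measurable
    moreover have "besov_norm \<beta> p F \<mu> (R f) < \<infinity>"
      unfolding R_def by (rule le_less_trans[OF B(2)[OF density(1)[OF f]]]) (use fin in \<open>simp add: ennreal_mult_less_top\<close>)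
    ultimately show ?thesis by (simp add: besov_space_def)
  qed
  have well_defined: "AE x in \<mu>. R f x = R g x" if "f \<in> ?V" "g \<in> ?V" "AE x in m. f x = g x" for f g
    unfolding R_def[of g]
  proof (rule R_eq[OF that(1) density(1)[OF that(2)]])
    show "AE x in m. f x = ?J (density g) x"
      using that(3) density(2)[OF that(2)] by eventually_elim simp
  qed
  have linear: "AE x in \<mu>. R (\<lambda>y. a * f y + b * g y) x = a * R f x + b * R g x"
    if f: "f \<in> ?V" and g: "g \<in> ?V" for f g a b
  proof -
    let ?h = "\<lambda>y. a * f y + b * g y"
    let ?d = "\<lambda>y. a * density f y + b * density g y"
    have J: "AE x in \<nu>. ?J ?d x = a * ?J (density f) x + b * ?J (density g) x"
      if "upper_regular \<eta> E \<nu>" "\<eta> \<le> N" "0 < \<alpha> + (\<eta> - N) / p" for \<nu> \<eta> E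
      by (rule AE_potential_linear[OF that(1) p that(2,3) density(1)[OF f] density(1)[OF g]])
    have d: "?d \<in> Lp_space p m" by (rule Lp_space_linear[OF density(1)[OF f] density(1)[OF g] p])
    have h_eq: "AE x in m. ?h x = ?J ?d x"
      using J[OF upper_regular_m order_refl] \<alpha>_pos density(2)[OF f] density(2)[OF g] by auto
    \<comment> \<open>The combined densities form a density of the combination, though perhaps not
      the chosen one; \<open>R_eq\<close> absorbs the difference.\<close>
    have "?h \<in> ?V"
      using f g d h_eq by (auto simp: potential_space_def)
    then have "AE x in \<mu>. R ?h x = ?J ?d x" using d h_eq by (rule R_eq)
    then show ?thesis
      using J[OF \<mu> \<delta>] \<beta> by (auto simp: R_def)
  qed
  have "AE x in \<mu>. R f x = f x" if f: "f \<in> ?V" and c: "continuous_on UNIV f" for f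
  proof -
    have "AE x in \<mu>. f x = ?J (density f) x"
      using density[OF f] by (intro AE_eq_potential_of_continuous[OF \<mu> \<delta> p \<beta>(2,3)[unfolded \<beta>(1)] _ _ c])
        (auto simp: Lp_space_iff)
    then show ?thesis unfolding R_def by eventually_elim simp
  qed
  then show ?thesis
    using in_besov well_defined linear bound
    unfolding continuous_linear_operator_def by blast
qed

end

section \<open>Ball bounds for a regular subset at all centres and radii\<close>

text \<open>A ball that meets \<open>F\<close> lies in a ball of twice the radius about a point of
  \<open>F\<close>, and radii beyond the diameter are reduced to one comparable with it.\<close>

lemma ahlfors_regular_subset_bounds:
  fixes \<mu> :: "'a::metric_space measure"
  assumes sets: "sets \<mu> = sets borel" and F: "closed F" "emeasure \<mu> (- F) = 0" "\<not> is_singleton F" "F \<noteq> {}"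
    and reg: "ahlfors_regular \<delta> F \<mu>"
  shows "\<exists>D G. upper_regular \<delta> D \<mu> \<and> averaging G 0 \<mu> \<mu>"
proof -
  have \<delta>: "0 < \<delta>" using reg by (simp add: ahlfors_regular_def)
  obtain C where C: "0 < C"
    "\<And>x r. x \<in> F \<Longrightarrow> 0 < r \<Longrightarrow> ennreal r < ediam F \<Longrightarrow>
        ennreal (r powr \<delta> / C) \<le> emeasure \<mu> (ball x (2 * r) \<inter> F)"
    "\<And>x r. x \<in> F \<Longrightarrow> 0 < r \<Longrightarrow> ennreal r < ediam F \<Longrightarrow>
        emeasure \<mu> (ball x (2 * r) \<inter> F) \<le> ennreal (C * r powr \<delta>)"
    using reg unfolding ahlfors_regular_def by blast
  have "- F \<in> null_sets \<mu>" using F by (auto simp: null_sets_def sets)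
  then have AE: "AE x in \<mu>. x \<in> F" by (rule AE_I') auto
  have inter: "emeasure \<mu> (A \<inter> F) = emeasure \<mu> A" if "A \<in> sets borel" for A
    using F that by (intro emeasure_eq_AE) (use AE in \<open>auto simp: sets\<close>)
  have dist_le: "ennreal (dist x y) \<le> ediam F" if "x \<in> F" "y \<in> F" for x y
    unfolding ediam_def using that by (intro SUP_upper2[of x] SUP_upper2[of y]) auto
  \<comment> \<open>The radius 3/2 d is twice 3/4 d, an admissible radius in the regularity of
    \<open>F\<close>; a second point of \<open>F\<close> makes d positive.\<close>
  have whole: "F \<subseteq> ball z (3 / 2 * d)" "0 < d" if d: "ediam F = ennreal d" "0 \<le> d" and z: "z \<in> F" for d z
  proof -
    obtain y where "y \<in> F" "y \<noteq> z"
      using F(3) z is_singletonI'[of F] by blast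
    then have "0 < dist z y" "dist z y \<le> d" using dist_le[OF z, of y] d by simp_all
    then show d0: "0 < d" by linarith
    show "F \<subseteq> ball z (3 / 2 * d)"
    proof
      fix w assume "w \<in> F"
      then have "dist z w \<le> d" using dist_le[OF z, of w] d by simp
      then show "w \<in> ball z (3 / 2 * d)" using d0 by simp
    qed
  qed
  \<comment> \<open>Beyond the diameter d the ball carries at most the measure of \<open>F\<close>,
    which is bounded at the admissible radius 3/4 d \<le> r.\<close>
  have center: "emeasure \<mu> (ball z (2 * r)) \<le> ennreal (C * r powr \<delta>)" if z: "z \<in> F" and r: "0 < r" for z r
  proof (cases "ennreal r < ediam F")
    case True
    then show ?thesis using C(3)[OF z r] inter[of "ball z (2 * r)"] by simp
  next
    case False
    then have "ediam F < top" using le_less_trans[of "ediam F" "ennreal r" top] by simp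
    then obtain d where d: "ediam F = ennreal d" "0 \<le> d" by (cases "ediam F") auto
    have dr: "d \<le> r" using False d r by (simp add: not_less)
    have "emeasure \<mu> (ball z (2 * r)) = emeasure \<mu> (ball z (2 * r) \<inter> F)" by (simp add: inter)
    also have "\<dots> \<le> emeasure \<mu> (ball z (2 * (3 / 4 * d)) \<inter> F)"
      using whole(1)[OF d z] F by (intro emeasure_mono) (auto simp: sets)
    also have "\<dots> \<le> ennreal (C * (3 / 4 * d) powr \<delta>)"
      using whole(2)[OF d z] d by (intro C(3) z) (auto simp: ennreal_less_iff)
    also have "\<dots> \<le> ennreal (C * r powr \<delta>)"
      using C(1) \<delta> dr d by (intro ennreal_leI mult_left_mono powr_mono2) auto
    finally show ?thesis .
  qed
  have up: "emeasure \<mu> (ball x r) \<le> ennreal (C * r powr \<delta>)" if r: "0 < r" for x r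
  proof (cases "ball x r \<inter> F = {}")
    case True
    then have "emeasure \<mu> (ball x r) = 0" using inter[of "ball x r"] by simp
    then show ?thesis by simp
  next
    case False
    then obtain z where z: "z \<in> F" "dist x z < r" by auto
    have "ball x r \<subseteq> ball z (2 * r)"
    proof
      fix y assume "y \<in> ball x r"
      then show "y \<in> ball z (2 * r)" using z dist_triangle3[of z y x] by simp
    qed
    then have "emeasure \<mu> (ball x r) \<le> emeasure \<mu> (ball z (2 * r))"
      by (intro emeasure_mono) (auto simp: sets)
    also have "\<dots> \<le> ennreal (C * r powr \<delta>)" by (rule center[OF z(1) r])
    finally show ?thesis .
  qed
  \<comment> \<open>If \<open>F\<close> is bounded, no lower bound of order
    \<open>r powr \<delta>\<close> persists for large r, so the integral is estimated directly. The
    summand 1 in the constant serves that case.\<close>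
  have avg: "(\<integral>\<^sup>+x\<in>ball y r. inverse (emeasure \<mu> (ball x r)) \<partial>\<mu>) \<le> ennreal (C * 2 powr \<delta> * C + 1)"
    if r: "0 < r" for y r
  proof (cases "ennreal (r / 2) < ediam F")
    case True
    have "(\<integral>\<^sup>+x\<in>ball y r. inverse (emeasure \<mu> (ball x r)) \<partial>\<mu>)
        \<le> (\<integral>\<^sup>+x. ennreal (C / (r / 2) powr \<delta>) * indicator (ball y r) x \<partial>\<mu>)"
    proof (rule nn_integral_mono_AE, use AE in eventually_elim)
      fix x assume x: "x \<in> F"
      have "ennreal ((r / 2) powr \<delta> / C) \<le> emeasure \<mu> (ball x r)"
        using C(2)[OF x _ True] r inter[of "ball x r"] by simp
      then have "inverse (emeasure \<mu> (ball x r)) \<le> inverse (ennreal ((r / 2) powr \<delta> / C))"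
        using r C(1) by (intro inverse_ennreal_antimono) auto
      also have "\<dots> = ennreal (C / (r / 2) powr \<delta>)" using r C(1) by (simp add: inverse_ennreal)
      finally show "inverse (emeasure \<mu> (ball x r)) * indicator (ball y r) x
          \<le> ennreal (C / (r / 2) powr \<delta>) * indicator (ball y r) x"
        by (rule mult_right_mono) simp
    qed
    also have "\<dots> = ennreal (C / (r / 2) powr \<delta>) * emeasure \<mu> (ball y r)"
      by (intro nn_integral_cmult_indicator) (simp add: sets)
    also have "\<dots> \<le> ennreal (C / (r / 2) powr \<delta>) * ennreal (C * r powr \<delta>)"
      by (intro mult_left_mono up r) auto
    also have "\<dots> = ennreal (C * 2 powr \<delta> * C)"
      using C(1) r by (simp add: ennreal_mult'[symmetric] powr_divide)
    also have "\<dots> \<le> ennreal (C * 2 powr \<delta> * C + 1)" by (intro ennreal_leI) simp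
    finally show ?thesis .
  next
    case False
    then have "ediam F < top" using le_less_trans[of "ediam F" "ennreal (r / 2)" top] by simp
    then obtain d where d: "ediam F = ennreal d" "0 \<le> d" by (cases "ediam F") auto
    have dr: "d \<le> r / 2" using False d r by (simp add: not_less)
    \<comment> \<open>Since d \<le> r/2, every ball of radius r centred in \<open>F\<close> contains
      \<open>F\<close>. The integrand is then at most 1/\<mu>(F), and the integral at most
      1.\<close>
    define V where "V = emeasure \<mu> F"
    have "(\<integral>\<^sup>+x\<in>ball y r. inverse (emeasure \<mu> (ball x r)) \<partial>\<mu>)
        \<le> (\<integral>\<^sup>+x. inverse V * indicator F x \<partial>\<mu>)"
    proof (rule nn_integral_mono_AE, use AE in eventually_elim)
      fix x assume x: "x \<in> F"
      have "F \<subseteq> ball x r"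
        using whole[OF d x] dr subset_ball[of "3 / 2 * d" r x] by auto
      then have "ball x r \<inter> F = F" by blast
      then have "emeasure \<mu> (ball x r) = V" using inter[of "ball x r"] by (simp add: V_def)
      then show "inverse (emeasure \<mu> (ball x r)) * indicator (ball y r) x \<le> inverse V * indicator F x"
        using x by (simp add: indicator_def)
    qed
    also have "\<dots> = inverse V * emeasure \<mu> F"
      using F by (intro nn_integral_cmult_indicator) (simp add: sets)
    also have "\<dots> = 1 * V / V" by (simp add: V_def divide_ennreal_def mult.commute)
    also have "\<dots> \<le> 1" by (rule ennreal_mult_divide_le)
    also have "1 \<le> ennreal (C * 2 powr \<delta> * C + 1)" using C(1) by simp
    finally show ?thesis .
  qed
  have "upper_regular \<delta> C \<mu>" using up C(1) sets by (simp add: upper_regular_def)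
  moreover have "averaging (C * 2 powr \<delta> * C + 1) 0 \<mu> \<mu>" using avg C(1) by (simp add: averaging_def)
  ultimately show ?thesis by blast
qed

theorem theorem5p2:
  fixes m \<mu> :: "'a::metric_space measure"
    and F :: "'a set"
    and s :: "'a \<Rightarrow> 'a \<Rightarrow> real \<Rightarrow> real"
    and N \<delta> \<alpha> \<beta> p :: real
  assumes "sets m = sets borel"
    and "ahlfors_regular N UNIV m"
    and "emeasure m UNIV = \<infinity>"
    and "coifman_approximation m N s"
    and "closed F"
    and "\<not> is_singleton F"
    and "sets \<mu> = sets borel"
    and "emeasure \<mu> (- F) = 0"
    and "ahlfors_regular \<delta> F \<mu>"
    and "0 < \<delta>" and "\<delta> < N"
    and "0 < \<alpha>" and "\<alpha> < 1" and "1 < p"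
    and "\<beta> = \<alpha> - (N - \<delta>) / p"
    and "0 < \<beta>" and "\<beta> < 1"
  shows "\<exists>R. continuous_linear_operator
              m (potential_space m s \<alpha> p) (potential_norm m s \<alpha> p)
              \<mu> (besov_space \<beta> p F \<mu>) (besov_norm \<beta> p F \<mu>) R \<and>
            (\<forall>f\<in>potential_space m s \<alpha> p. continuous_on UNIV f \<longrightarrow> (AE x in \<mu>. R f x = f x))"
proof (cases "F = {}")
  case True
  \<comment> \<open>An empty \<open>F\<close> makes \<mu> the zero measure, so all statements almost
    everywhere hold and the zero operator works.\<close>
  have null: "AE x in \<mu>. P x" for P
  proof -
    have "UNIV \<in> null_sets \<mu>" using True assms(7,8) by (simp add: null_sets_def)
    then show ?thesis by (rule AE_I') auto
  qed
  have int: "(\<integral>\<^sup>+x. h x \<partial>\<mu>) = 0" for h :: "'a \<Rightarrow> ennreal"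
    using nn_integral_cong_AE[OF null, of h "\<lambda>_. 0"] by simp
  have "besov_norm \<beta> p F \<mu> (\<lambda>_. 0) = 0"
    by (simp add: besov_norm_def besov_E_def Lp_norm_def int enn_root_eq)
  then have "continuous_linear_operator m (potential_space m s \<alpha> p) (potential_norm m s \<alpha> p)
      \<mu> (besov_space \<beta> p F \<mu>) (besov_norm \<beta> p F \<mu>) (\<lambda>f x. 0)"
    using null by (auto simp: continuous_linear_operator_def besov_space_def)
  then show ?thesis using null by blast
next
  case False
  \<comment> \<open>On a one-point space the regularity of \<open>m\<close> would be void; two
    points of \<open>F\<close> exclude this.\<close>
  have X: "\<not> is_singleton (UNIV :: 'a set)"
  proof
    assume "is_singleton (UNIV :: 'a set)"
    then obtain a :: 'a where "UNIV = {a}" by (rule is_singletonE)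
    then have "F \<subseteq> {a}" by (metis subset_UNIV)
    then have "F = {a}" using False by blast
    then have "is_singleton F" by simp
    then show False using assms(6) by contradiction
  qed
  have N: "0 < N" using assms(10,11) by simp
  obtain C where C: "1 \<le> C" "\<And>x r. 0 < r \<Longrightarrow> ennreal (r powr N / C) \<le> emeasure m (ball x r)"
    "\<And>x r. 0 < r \<Longrightarrow> emeasure m (ball x r) \<le> ennreal (C * r powr N)"
    using ahlfors_regular_ball_bounds[OF assms(1,2,3) X] by blast
  from assms(4) obtain Cs where "0 < Cs"
    and s: "\<And>t x y. 0 < t \<Longrightarrow> s x y t = s y x t" "\<And>t x y. 0 < t \<Longrightarrow> 0 \<le> s x y t"
      "\<And>x y. continuous_on {0<..} (s x y)" "\<And>t x y. 0 < t \<Longrightarrow> s x y t \<le> Cs / t powr N"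
      "\<And>t x y. 0 < t \<Longrightarrow> Cs * t < dist x y \<Longrightarrow> s x y t = 0"
      "\<And>t x x' y. 0 < t \<Longrightarrow> \<bar>s x y t - s x' y t\<bar> \<le> Cs * dist x x' / t powr (N + 1)"
    unfolding coifman_approximation_def by metis
  interpret potential_theory m N C s \<alpha> Cs
    by unfold_locales (fact assms N C s \<open>0 < Cs\<close>)+
  obtain D G where "upper_regular \<delta> D \<mu>" "averaging G 0 \<mu> \<mu>"
    using ahlfors_regular_subset_bounds[OF assms(7,5,8,6) False assms(9)] by blast
  moreover have "\<beta> = \<alpha> + (\<delta> - N) / p" using assms(15) by (simp add: diff_divide_distrib)
  ultimately show ?thesis
    using assms by (intro trace_operator) auto
qed

end
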